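(* Let $\overline f=(f_n)_{n\in\mathbb N}$ be a sequence of $C^2$ diffeomorphisms of $\mathbb T^2$ such that the collection $\{f_n\}$ satisfies a common cone condition and the collection of maps, and their inverses, is uniformly bounded in the $C^2$ topology, i.e. $\max\{\sup_n\|f_n\|_{C^2},\sup_n\|f_n^{-1}\|_{C^2}\}<\infty$. Then $\mathcal W^s(\overline f)=\{W^s(x,\overline f)\}_{x\in\mathbb T^2}$ forms a $C^1$ foliation of $\mathbb T^2$. If moreover each $f_n$ is a $C^3$ diffeomorphism and the collection of maps, and their inverses, is uniformly bounded in the $C^3$ topology, i.e. $\max\{\sup_n\|f_n\|_{C^3},\sup_n\|f_n^{-1}\|_{C^3}\}<\infty$, then the foliation $\mathcal W^s(\overline f)$ is $C^{1+\text{H\"older}}$.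
   Context: $\mathbb T^2$ carries its standard flat Riemannian metric. A collection $\mathcal F\subset \mathrm{Diff}^1(\mathbb T^2)$ satisfies a common cone condition if there are constants $0<\mu<1<\eta$ and, for each $x\in\mathbb T^2$, one-dimensional subspaces $H_x,V_x\subset T_x\mathbb T^2$ depending continuously on $x$ with $T_x\mathbb T^2=H_x\oplus V_x$, such that, writing $K^s(x)=\{(v_1,v_2)\in H_x\oplus V_x:|v_1|\le\mu|v_2|\}$ and $K^u(x)=\{(v_1,v_2)\in H_x\oplus V_x:|v_2|\le\mu|v_1|\}$, every $f\in\mathcal F$ satisfies: (1) $D_xf(K^u(x))\subseteq \mathrm{int}\,K^u(f(x))$ and $D_xf^{-1}(K^s(x))\subseteq\mathrm{int}\,K^s(f^{-1}(x))$, and the angle between any vector of $D_xf(K^u(x))$ and $\partial K^u(f(x))$, and the angle between any vector of $D_xf^{-1}(K^s(x))$ and $\partial K^s(f^{-1}(x))$, are bounded away from zero uniformly; (2) $\|D_xf\,v\|\ge\eta\|v\|$ for $v\in K^u(x)$; (3) $\|D_xf^{-1}v\|\ge\eta\|v\|$ for $v\in K^s(x)$. The non-stationary stable set is $W^s(x,\overline f)=\{y\in\mathbb T^2:\lim_{n\to\infty}|f_n\circ\cdots\circ f_1(x)-f_n\circ\cdots\circ f_1(y)|=0\}$; under the common cone condition each $W^s(x,\overline f)$ is a one-dimensional curve, and these curves form a continuous foliation $\mathcal W^s(\overline f)$ of $\mathbb T^2$. *)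

theory Defs
  imports "HOL-Analysis.Analysis"
begin

text \<open>The torus T^2 = R^2 / Z^2 is handled through lifts to the universal cover R^2
 (type real^2). Zvec is the lattice Z^2.\<close>

definition Zvec :: "(real^2) set" where
  "Zvec = {k. \<forall>i. k $ i \<in> \<int>}"

definition torus_lift :: "(real^2 \<Rightarrow> real^2) \<Rightarrow> bool" where
  "torus_lift F \<longleftrightarrow> (\<forall>x k. k \<in> Zvec \<longrightarrow> F (x + k) - F x \<in> Zvec)"

definition torus_homeo_lift :: "(real^2 \<Rightarrow> real^2) \<Rightarrow> (real^2 \<Rightarrow> real^2) \<Rightarrow> bool" where
  "torus_homeo_lift F G \<longleftrightarrow> torus_lift F \<and> torus_lift G \<and>
     (\<forall>x. G (F x) = x) \<and> (\<forall>x. F (G x) = x)"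

definition C2_bounded :: "(real^2 \<Rightarrow> real^2) \<Rightarrow> real \<Rightarrow> bool" where
  "C2_bounded F C \<longleftrightarrow> (\<exists>D1 D2.
     (\<forall>x. (F has_derivative blinfun_apply (D1 x)) (at x)) \<and>
     (\<forall>x. (D1 has_derivative blinfun_apply (D2 x)) (at x)) \<and>
     continuous_on UNIV D2 \<and>
     (\<forall>x. norm (D1 x) \<le> C \<and> norm (D2 x) \<le> C))"

definition C3_bounded :: "(real^2 \<Rightarrow> real^2) \<Rightarrow> real \<Rightarrow> bool" where
  "C3_bounded F C \<longleftrightarrow> (\<exists>D1 D2 D3.
     (\<forall>x. (F has_derivative blinfun_apply (D1 x)) (at x)) \<and>
     (\<forall>x. (D1 has_derivative blinfun_apply (D2 x)) (at x)) \<and>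
     (\<forall>x. (D2 has_derivative blinfun_apply (D3 x)) (at x)) \<and>
     continuous_on UNIV D3 \<and>
     (\<forall>x. norm (D1 x) \<le> C \<and> norm (D2 x) \<le> C \<and> norm (D3 x) \<le> C))"

text \<open>Cones built from the splitting spanned by unit vector fields h (H_x) and v (V_x).\<close>
definition cone_u :: "(real^2 \<Rightarrow> real^2) \<Rightarrow> (real^2 \<Rightarrow> real^2) \<Rightarrow> real \<Rightarrow> real^2 \<Rightarrow> (real^2) set" where
  "cone_u h v \<mu> x = {a *\<^sub>R h x + b *\<^sub>R v x | a b. \<bar>b\<bar> \<le> \<mu> * \<bar>a\<bar>}"

definition cone_s :: "(real^2 \<Rightarrow> real^2) \<Rightarrow> (real^2 \<Rightarrow> real^2) \<Rightarrow> real \<Rightarrow> real^2 \<Rightarrow> (real^2) set" where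
  "cone_s h v \<mu> x = {a *\<^sub>R h x + b *\<^sub>R v x | a b. \<bar>a\<bar> \<le> \<mu> * \<bar>b\<bar>}"

definition vec_angle :: "real^2 \<Rightarrow> real^2 \<Rightarrow> real" where
  "vec_angle u w = arccos ((u \<bullet> w) / (norm u * norm w))"

definition common_cone_condition ::
  "(nat \<Rightarrow> real^2 \<Rightarrow> real^2) \<Rightarrow> (nat \<Rightarrow> real^2 \<Rightarrow> real^2) \<Rightarrow> bool" where
  "common_cone_condition Fs Gs \<longleftrightarrow> (\<exists>\<mu> \<eta> h v \<theta>.
     0 < \<mu> \<and> \<mu> < 1 \<and> 1 < \<eta> \<and> 0 < \<theta> \<and>
     continuous_on UNIV h \<and> continuous_on UNIV v \<and>
     (\<forall>x. norm (h x) = 1 \<and> norm (v x) = 1) \<and>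
     (\<forall>x a b. a *\<^sub>R h x + b *\<^sub>R v x = 0 \<longrightarrow> a = 0 \<and> b = 0) \<and>
     (\<forall>x k. k \<in> Zvec \<longrightarrow> (h (x + k) = h x \<or> h (x + k) = - h x) \<and>
                           (v (x + k) = v x \<or> v (x + k) = - v x)) \<and>
     (\<forall>n x.
        (\<forall>w \<in> cone_u h v \<mu> x - {0}.
            frechet_derivative (Fs n) (at x) w \<in> interior (cone_u h v \<mu> (Fs n x)) \<and>
            (\<forall>u \<in> frontier (cone_u h v \<mu> (Fs n x)) - {0}.
               \<theta> \<le> vec_angle (frechet_derivative (Fs n) (at x) w) u)) \<and>
        (\<forall>w \<in> cone_s h v \<mu> x - {0}.
            frechet_derivative (Gs n) (at x) w \<in> interior (cone_s h v \<mu> (Gs n x)) \<and>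
            (\<forall>u \<in> frontier (cone_s h v \<mu> (Gs n x)) - {0}.
               \<theta> \<le> vec_angle (frechet_derivative (Gs n) (at x) w) u)) \<and>
        (\<forall>w \<in> cone_u h v \<mu> x. \<eta> * norm w \<le> norm (frechet_derivative (Fs n) (at x) w)) \<and>
        (\<forall>w \<in> cone_s h v \<mu> x. \<eta> * norm w \<le> norm (frechet_derivative (Gs n) (at x) w))))"

text \<open>Non-stationary composition f_n o ... o f_1 (Fs 0 plays the role of f_1).\<close>
fun itcomp :: "(nat \<Rightarrow> real^2 \<Rightarrow> real^2) \<Rightarrow> nat \<Rightarrow> real^2 \<Rightarrow> real^2" where
  "itcomp Fs 0 = id"
| "itcomp Fs (Suc n) = Fs n \<circ> itcomp Fs n"

text \<open>Lift of the stable set: distance on T^2 is the distance to the lattice.\<close>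
definition stable_set :: "(nat \<Rightarrow> real^2 \<Rightarrow> real^2) \<Rightarrow> real^2 \<Rightarrow> (real^2) set" where
  "stable_set Fs x = {y. (\<lambda>n. infdist (itcomp Fs n x - itcomp Fs n y) Zvec) \<longlonglongrightarrow> 0}"

definition unit_box :: "(real^2) set" where
  "unit_box = {z. \<forall>i. -1 < z $ i \<and> z $ i < 1}"

definition C1_on :: "(real^2) set \<Rightarrow> (real^2 \<Rightarrow> real^2) \<Rightarrow> (real^2 \<Rightarrow> (real^2) \<Rightarrow>\<^sub>L (real^2)) \<Rightarrow> bool" where
  "C1_on S f Df \<longleftrightarrow> (\<forall>x\<in>S. (f has_derivative blinfun_apply (Df x)) (at x)) \<and> continuous_on S Df"

definition holder_on :: "real \<Rightarrow> (real^2) set \<Rightarrow> (real^2 \<Rightarrow> (real^2) \<Rightarrow>\<^sub>L (real^2)) \<Rightarrow> bool" where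
  "holder_on \<alpha> S Df \<longleftrightarrow> (\<exists>C. \<forall>x\<in>S. \<forall>y\<in>S. norm (Df x - Df y) \<le> C * dist x y powr \<alpha>)"

text \<open>Foliation chart around p for the partition W (leaf through y is W y):
 phi is a diffeomorphism of an open neighbourhood U of p onto the open square, with
 inverse psi, and the plaques (connected components of leaf \<inter> U) are the level sets of the
 second coordinate of phi. Regularity of phi, psi is recorded by P.\<close>
definition foliation_chart ::
  "((real^2) set \<Rightarrow> (real^2 \<Rightarrow> real^2) \<Rightarrow> (real^2 \<Rightarrow> (real^2) \<Rightarrow>\<^sub>L (real^2)) \<Rightarrow> bool) \<Rightarrow>
   (real^2 \<Rightarrow> (real^2) set) \<Rightarrow> real^2 \<Rightarrow> bool" where
  "foliation_chart P W p \<longleftrightarrow> (\<exists>U \<phi> \<psi> D\<phi> D\<psi>.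
     open U \<and> p \<in> U \<and>
     \<phi> ` U = unit_box \<and> (\<forall>z\<in>U. \<psi> (\<phi> z) = z) \<and> (\<forall>w\<in>unit_box. \<phi> (\<psi> w) = w) \<and>
     P U \<phi> D\<phi> \<and> P unit_box \<psi> D\<psi> \<and>
     (\<forall>y\<in>U. connected_component_set (W y \<inter> U) y = {z\<in>U. \<phi> z $ 2 = \<phi> y $ 2}))"

definition C1_foliation :: "(real^2 \<Rightarrow> (real^2) set) \<Rightarrow> bool" where
  "C1_foliation W \<longleftrightarrow> (\<forall>p. foliation_chart C1_on W p)"

definition C1_holder_foliation :: "(real^2 \<Rightarrow> (real^2) set) \<Rightarrow> bool" where
  "C1_holder_foliation W \<longleftrightarrow> (\<exists>\<alpha>. 0 < \<alpha> \<and> \<alpha> \<le> 1 \<and>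
     (\<forall>p. foliation_chart (\<lambda>S f Df. C1_on S f Df \<and> holder_on \<alpha> S Df) W p))"

end

theory Submission
  imports Defs
begin

text \<open>
  Push a fixed unstable vector \<open>w\<close> forward along the orbit, \<open>u\<^sub>n = D(f\<^sub>n \<circ> \<dots> \<circ> f\<^sub>1) w\<close>, and let
  \<open>\<xi> + \<sigma>\<^sub>n w\<close> be the vector whose image at time \<open>n\<close> is orthogonal to \<open>u\<^sub>n\<close>. The increments of \<open>\<sigma>\<^sub>n\<close> have
  a closed form of size \<open>|det D\<^sub>n| / |u\<^sub>n|\<^sup>2\<close>, where \<open>D\<^sub>n\<close> is the Jacobian of the composition. Differentiating
  them along \<open>w\<close> costs only a factor \<open>|u\<^sub>n|\<close>, so the derivatives are bounded by
  \<open>|det D\<^sub>n| / |u\<^sub>n|\<close>, which decays like \<open>\<eta>\<^sup>-\<^sup>n\<close> because it measures the contraction in the stable direction.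
  Hence \<open>\<sigma>\<^sub>n\<close> converges to the slope \<open>\<sigma>\<close> of the stable direction, together with its derivative along \<open>w\<close>.
  In the \<open>C\<^sup>3\<close> case the Lipschitz constants of \<open>\<sigma>\<^sub>n\<close> and of its derivative grow at most exponentially, and
  interpolation against the exponential convergence gives Hoelder continuity.

  The leaves are the solutions of the scalar equation \<open>a' = \<sigma>(a, t)\<close>. Only the derivative of \<open>\<sigma>\<close> in
  \<open>a\<close> is needed for the flow to be \<open>C\<^sup>1\<close>, since \<open>\<partial>a/\<partial>c = exp (\<integral> \<partial>\<sigma>/\<partial>a)\<close> for the initial value \<open>c\<close>.
  Points of one plaque are asymptotic by contraction of the stable direction. Conversely, expansivity in the unstable
  cone shows that a stable set meets a chart in countably many plaques, so that a connected component
  is a single plaque.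
\<close>

section \<open>Planar linear algebra and the cocycle over a cone system\<close>

text \<open>The splitting is only continuous, so no derivative may fall on \<open>h\<close> or
  \<open>v\<close>, and a one-sided sequence of maps determines no invariant unstable direction.
  Both obstacles are avoided by freezing the frame at the base point of a chart: w =
  \<open>h p\<close> and \<xi> = \<open>v p\<close> are constant vectors, w lies in the unstable
  cones of all nearby points, and \<sigma>_n becomes a quotient of inner products of cocycle values,
  which second derivatives of the maps suffice to differentiate. The same frame supplies the affine
  coordinates in which the leaves are graphs over the \<open>v p\<close> axis.

  Derivatives are bounded relative to the size of each factor of an increment. The logarithmic
  derivative of det D_n along w is a sum over the past of terms of size |u_m|, and the exponential
  growth of |u_m| lets the last term dominate; this is why the cost is a single factor |u_n|.

  The stable set is lifted modulo the lattice, so it contains all lattice translates of its points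
  and is not one leaf. Hence charts compare connected components, and a countability argument has to
  separate the plaques.\<close>

definition wedge :: "real^2 \<Rightarrow> real^2 \<Rightarrow> real" where
  "wedge x y = x $ 1 * y $ 2 - x $ 2 * y $ 1"

definition rot :: "real^2 \<Rightarrow> real^2" where
  "rot x = vector [- x $ 2, x $ 1]"

lemma rot_nth [simp]: "rot x $ 1 = - x $ 2" "rot x $ 2 = x $ 1"
  by (simp_all add: rot_def)

lemma inner_2: "(x::real^2) \<bullet> y = x $ 1 * y $ 1 + x $ 2 * y $ 2"
  by (simp add: inner_vec_def sum_2)

lemma wedge_eq_inner: "wedge x y = rot x \<bullet> y"
  by (simp add: wedge_def inner_2)

lemma norm_rot [simp]: "norm (rot x) = norm x"
  by (simp add: norm_eq_sqrt_inner inner_2 add.commute)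

lemma bounded_linear_rot: "bounded_linear rot"
  by (rule bounded_linear_intro[where K=1])
     (simp_all add: vec_eq_iff forall_2)

lemma abs_wedge_le: "\<bar>wedge x y\<bar> \<le> norm x * norm y"
  by (metis wedge_eq_inner norm_rot Cauchy_Schwarz_ineq2)

interpretation wedge: bounded_bilinear wedge
proof
  show "\<exists>K. \<forall>a b. norm (wedge a b) \<le> norm a * norm b * K"
    by (rule exI[of _ 1]) (simp add: abs_wedge_le)
qed (simp_all add: wedge_def algebra_simps)

lemma wedge_self [simp]: "wedge x x = 0"
  by (simp add: wedge_def)

lemma wedge_commute: "wedge x y = - wedge y x"
  by (simp add: wedge_def)

text \<open>Cramer's rule: \<open>wedge\<close> is the 2x2 determinant of its two arguments.\<close>

lemma wedge_decompose:
  assumes "wedge a b \<noteq> 0"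
  shows "x = (wedge x b / wedge a b) *\<^sub>R a + (wedge a x / wedge a b) *\<^sub>R b"
proof -
  have "wedge a b *\<^sub>R x = wedge x b *\<^sub>R a + wedge a x *\<^sub>R b"
    by (simp add: vec_eq_iff forall_2 wedge_def algebra_simps)
  then have "x = (1 / wedge a b) *\<^sub>R (wedge x b *\<^sub>R a + wedge a x *\<^sub>R b)"
    using assms by (metis divide_self scaleR_one scaleR_scaleR times_divide_eq_left mult_1)
  then show ?thesis by (simp add: scaleR_add_right)
qed

text \<open>The expansion of \<open>w\<close> in the orthogonal basis \<open>u\<close>,
  \<open>rot u\<close>, cleared of denominators so that \<open>u = 0\<close> is allowed.\<close>

lemma rot_decompose:
  "(u \<bullet> u) *\<^sub>R w = (u \<bullet> w) *\<^sub>R u + wedge u w *\<^sub>R rot u"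
  by (simp add: vec_eq_iff forall_2 wedge_def inner_2 algebra_simps)

definition detL :: "(real^2) \<Rightarrow>\<^sub>L (real^2) \<Rightarrow> real" where
  "detL M = wedge (blinfun_apply M (axis 1 1)) (blinfun_apply M (axis 2 1))"

lemma vec2_axis: "(x::real^2) = x $ 1 *\<^sub>R axis 1 1 + x $ 2 *\<^sub>R axis 2 1"
  by (simp add: vec_eq_iff forall_2 axis_def)

lemma wedge_blinfun: "wedge (blinfun_apply M x) (blinfun_apply M y) = detL M * wedge x y"
proof -
  let ?a = "blinfun_apply M (axis 1 1)" and ?b = "blinfun_apply M (axis 2 1)"
  have 1: "blinfun_apply M z = z $ 1 *\<^sub>R ?a + z $ 2 *\<^sub>R ?b" for z
    by (subst vec2_axis[of z]) (simp add: blinfun.bilinear_simps)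
  show ?thesis
    by (subst 1[of x], subst 1[of y])
       (simp add: wedge.bilinear_simps detL_def wedge_commute[of ?b ?a],
        simp add: wedge_def algebra_simps)
qed

lemma abs_detL_le: "\<bar>detL M\<bar> \<le> norm M * norm M"
proof -
  have "norm (blinfun_apply M (axis i 1)) \<le> norm M" for i
    using norm_blinfun[of M "axis i 1"] by simp
  then show ?thesis
    unfolding detL_def by (intro order_trans[OF abs_wedge_le] mult_mono) auto
qed

section \<open>Cones, and the derivative cocycle of a system satisfying the cone condition\<close>

lemma cone_u_scale: "w \<in> cone_u h v \<mu> x \<Longrightarrow> c *\<^sub>R w \<in> cone_u h v \<mu> x"
  unfolding cone_u_def
  by (clarsimp simp: scaleR_add_right)
     (metis abs_ge_zero abs_mult mult.left_commute mult_left_mono)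

lemma cone_s_scale: "w \<in> cone_s h v \<mu> x \<Longrightarrow> c *\<^sub>R w \<in> cone_s h v \<mu> x"
  unfolding cone_s_def
  by (clarsimp simp: scaleR_add_right)
     (metis abs_ge_zero abs_mult mult.left_commute mult_left_mono)

lemma Zvec_box:
  fixes x :: "real^2"
  obtains k where "k \<in> Zvec" "x + k \<in> cbox 0 1"
proof
  define k :: "real^2" where "k = (\<chi> i. - of_int \<lfloor>x $ i\<rfloor>)"
  show "k \<in> Zvec" by (simp add: Zvec_def k_def)
  show "x + k \<in> cbox 0 1"
    by (auto simp: k_def mem_box_cart) linarith+
qed

text \<open>The derivatives are parameters with values in the bounded linear maps rather than
  \<open>frechet_derivative\<close>: this makes \<open>DF n\<close> a map into a normed space, which
  \<open>D2F n\<close> can differentiate.\<close>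

locale cone_system =
  fixes F G :: "nat \<Rightarrow> real^2 \<Rightarrow> real^2"
    and DF DG :: "nat \<Rightarrow> real^2 \<Rightarrow> (real^2) \<Rightarrow>\<^sub>L (real^2)"
    and D2F :: "nat \<Rightarrow> real^2 \<Rightarrow> (real^2) \<Rightarrow>\<^sub>L (real^2) \<Rightarrow>\<^sub>L (real^2)"
    and C \<mu> \<eta> \<theta> :: real
    and h v :: "real^2 \<Rightarrow> real^2"
  assumes GF: "G n (F n x) = x"
    and FG: "F n (G n x) = x"
    and DF: "(F n has_derivative blinfun_apply (DF n x)) (at x)"
    and DG: "(G n has_derivative blinfun_apply (DG n x)) (at x)"
    and D2F: "(DF n has_derivative blinfun_apply (D2F n x)) (at x)"
    and D2F_cont: "continuous_on UNIV (D2F n)"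
    and norm_DF: "norm (DF n x) \<le> C"
    and norm_DG: "norm (DG n x) \<le> C"
    and norm_D2F: "norm (D2F n x) \<le> C"
    and mu: "0 < \<mu>" "\<mu> < 1"
    and eta: "1 < \<eta>"
    and theta: "0 < \<theta>"
    and h_cont: "continuous_on UNIV h"
    and v_cont: "continuous_on UNIV v"
    and norm_h [simp]: "norm (h x) = 1"
    and norm_v [simp]: "norm (v x) = 1"
    and indep: "a *\<^sub>R h x + b *\<^sub>R v x = 0 \<Longrightarrow> a = 0 \<and> b = 0"
    and h_per: "k \<in> Zvec \<Longrightarrow> h (x + k) = h x \<or> h (x + k) = - h x"
    and v_per: "k \<in> Zvec \<Longrightarrow> v (x + k) = v x \<or> v (x + k) = - v x"
    and cone_F: "w \<in> cone_u h v \<mu> x \<Longrightarrow> w \<noteq> 0 \<Longrightarrow>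
        blinfun_apply (DF n x) w \<in> interior (cone_u h v \<mu> (F n x))"
    and angle_F: "w \<in> cone_u h v \<mu> x \<Longrightarrow> w \<noteq> 0 \<Longrightarrow>
        u \<in> frontier (cone_u h v \<mu> (F n x)) \<Longrightarrow> u \<noteq> 0 \<Longrightarrow>
        \<theta> \<le> vec_angle (blinfun_apply (DF n x) w) u"
    and cone_G: "w \<in> cone_s h v \<mu> x \<Longrightarrow> w \<noteq> 0 \<Longrightarrow>
        blinfun_apply (DG n x) w \<in> cone_s h v \<mu> (G n x)"
    and expand_F: "w \<in> cone_u h v \<mu> x \<Longrightarrow> \<eta> * norm w \<le> norm (blinfun_apply (DF n x) w)"
    and expand_G: "w \<in> cone_s h v \<mu> x \<Longrightarrow> \<eta> * norm w \<le> norm (blinfun_apply (DG n x) w)"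
begin

abbreviation "cu \<equiv> cone_u h v \<mu>"
abbreviation "cs \<equiv> cone_s h v \<mu>"

text \<open>Orbits \<open>orb m n\<close> and the derivative cocycle \<open>coc m n\<close> start at time \<open>m\<close> and run for \<open>n\<close> steps.\<close>

primrec orb :: "nat \<Rightarrow> nat \<Rightarrow> real^2 \<Rightarrow> real^2" where
  "orb m 0 x = x"
| "orb m (Suc n) x = F (m + n) (orb m n x)"

primrec coc :: "nat \<Rightarrow> nat \<Rightarrow> real^2 \<Rightarrow> (real^2) \<Rightarrow>\<^sub>L (real^2)" where
  "coc m 0 x = id_blinfun"
| "coc m (Suc n) x = DF (m + n) (orb m n x) o\<^sub>L coc m n x"

lemma itcomp_eq_orb: "itcomp F n = orb 0 n"
  by (induction n) (auto simp: fun_eq_iff)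

lemma orb_shift: "orb m (Suc n) x = orb (Suc m) n (F m x)"
  by (induction n) auto

lemma coc_shift: "coc m (Suc n) x = coc (Suc m) n (F m x) o\<^sub>L DF m x"
proof (induction n)
  case (Suc n)
  have "coc m (Suc (Suc n)) x = DF (m + Suc n) (orb m (Suc n) x) o\<^sub>L coc m (Suc n) x" by simp
  also have "\<dots> = DF (Suc m + n) (orb (Suc m) n (F m x)) o\<^sub>L (coc (Suc m) n (F m x) o\<^sub>L DF m x)"
    unfolding Suc.IH orb_shift by simp
  finally show ?case
    by (simp add: blinfun_eqI)
qed (simp add: blinfun_eqI)

lemma zero_in_cu [simp]: "0 \<in> cu x"
  unfolding cone_u_def by (auto intro!: exI[of _ 0])

lemma h_in_cu: "h x \<in> cu x"
proof -
  have "h x = 1 *\<^sub>R h x + 0 *\<^sub>R v x \<and> \<bar>0::real\<bar> \<le> \<mu> * \<bar>1\<bar>" using mu by simp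
  then show ?thesis unfolding cone_u_def by blast
qed

lemma v_in_cs: "v x \<in> cs x"
proof -
  have "v x = 0 *\<^sub>R h x + 1 *\<^sub>R v x \<and> \<bar>0::real\<bar> \<le> \<mu> * \<bar>1\<bar>" using mu by simp
  then show ?thesis unfolding cone_s_def by blast
qed

lemma DF_cu: "w \<in> cu x \<Longrightarrow> blinfun_apply (DF n x) w \<in> cu (F n x)"
  using cone_F interior_subset by (cases "w = 0") fastforce+

text \<open>The expanded unit vector \<open>h 0\<close> forces \<eta> \<le> C. Powers of C therefore
  increase with the exponent, as the Lipschitz estimates along orbits require.\<close>

lemma C_ge_1: "1 < C"
proof -
  have "\<eta> * norm (h 0) \<le> norm (blinfun_apply (DF 0 0) (h 0))"
    by (rule expand_F) (rule h_in_cu)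
  also have "\<dots> \<le> norm (DF 0 0) * norm (h 0)" by (rule norm_blinfun)
  also have "\<dots> \<le> C" using norm_DF by simp
  finally show ?thesis using eta by simp
qed

lemma coc_cu:
  assumes "w \<in> cu x"
  shows "blinfun_apply (coc m n x) w \<in> cu (orb m n x)"
  by (induction n) (auto simp: assms DF_cu)

lemma coc_expand_Suc:
  assumes "w \<in> cu x"
  shows "\<eta> * norm (blinfun_apply (coc m n x) w) \<le> norm (blinfun_apply (coc m (Suc n) x) w)"
  using expand_F[OF coc_cu[OF assms]] by simp

lemma coc_expand:
  assumes "w \<in> cu x"
  shows "\<eta> ^ n * norm (blinfun_apply (coc m i x) w) \<le> norm (blinfun_apply (coc m (i + n) x) w)"
proof (induction n)
  case (Suc n)
  have "\<eta> ^ Suc n * norm (blinfun_apply (coc m i x) w) \<le> \<eta> * norm (blinfun_apply (coc m (i + n) x) w)"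
    using mult_left_mono[OF Suc, of \<eta>] eta by (simp add: mult.assoc)
  also have "\<dots> \<le> norm (blinfun_apply (coc m (i + Suc n) x) w)"
    using coc_expand_Suc[OF assms, of m "i + n"] by simp
  finally show ?case .
qed simp

lemma DF_DG: "blinfun_apply (DF n x) (blinfun_apply (DG n (F n x)) w) = w"
proof -
  have "((\<lambda>y. F n (G n y)) has_derivative (\<lambda>w. blinfun_apply (DF n (G n (F n x))) (blinfun_apply (DG n (F n x)) w)))
      (at (F n x))"
    by (rule has_derivative_compose[OF DG DF])
  moreover have "((\<lambda>y. F n (G n y)) has_derivative (\<lambda>w. w)) (at (F n x))"
    by (simp add: FG)
  ultimately have "(\<lambda>w. blinfun_apply (DF n (G n (F n x))) (blinfun_apply (DG n (F n x)) w)) = (\<lambda>w. w)"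
    by (rule has_derivative_unique)
  then show ?thesis by (simp add: GF fun_eq_iff)
qed

text \<open>The cone condition controls the stable cone only under the inverse maps. A vector of the
  cone at the end of the orbit is therefore pulled back one step at a time, each step stretching it
  by at least \<eta>; read forwards, y is contracted.\<close>

lemma coc_cs:
  assumes "w \<in> cs (orb m n x)" "w \<noteq> 0"
  shows "\<exists>y\<in>cs x. y \<noteq> 0 \<and> blinfun_apply (coc m n x) y = w \<and> \<eta> ^ n * norm w \<le> norm y"
  using assms
proof (induction n arbitrary: w)
  case 0
  then show ?case by auto
next
  case (Suc n)
  let ?x = "orb m n x"
  define w' where "w' = blinfun_apply (DG (m + n) (F (m + n) ?x)) w"
  have w: "w = blinfun_apply (DF (m + n) ?x) w'" by (simp add: w'_def DF_DG)
  have w'0: "w' \<noteq> 0" using w Suc.prems by auto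
  have w': "w' \<in> cs ?x" using cone_G[of w "F (m + n) ?x" "m + n"] Suc.prems by (simp add: w'_def GF)
  have ex: "\<eta> * norm w \<le> norm w'"
    using expand_G[of w "F (m + n) ?x" "m + n"] Suc.prems by (simp add: w'_def)
  from Suc.IH[OF w' w'0] obtain y where y: "y \<in> cs x" "y \<noteq> 0" "blinfun_apply (coc m n x) y = w'"
    "\<eta> ^ n * norm w' \<le> norm y" by auto
  have "\<eta> ^ Suc n * norm w \<le> \<eta> ^ n * norm w'"
    using mult_left_mono[OF ex, of "\<eta> ^ n"] eta by (simp add: mult_ac)
  with y w show ?case by (intro bexI[of _ y]) auto
qed

text \<open>Compactness of the unit square, a fundamental domain of the lattice. The fields are
  periodic only up to sign, which the absolute value removes; independence makes the minimum
  positive.\<close>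

lemma wedge_hv: "\<exists>c>0. \<forall>x. c \<le> \<bar>wedge (h x) (v x)\<bar>"
proof -
  let ?w = "\<lambda>x. \<bar>wedge (h x) (v x)\<bar>"
  have nz: "wedge (h x) (v x) \<noteq> 0" for x
  proof
    assume 0: "wedge (h x) (v x) = 0"
    have "(v x \<bullet> v x) *\<^sub>R h x = (v x \<bullet> h x) *\<^sub>R v x + wedge (v x) (h x) *\<^sub>R rot (v x)"
      by (rule rot_decompose)
    then have "1 *\<^sub>R h x + (- (v x \<bullet> h x)) *\<^sub>R v x = 0"
      using 0 wedge_commute[of "v x" "h x"] by (simp add: dot_square_norm)
    from indep[OF this] show False by simp
  qed
  have "continuous_on (cbox 0 1) ?w"
    by (intro continuous_intros wedge.continuous_on continuous_on_subset[OF h_cont]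
        continuous_on_subset[OF v_cont]) auto
  moreover have "(0::real^2) \<in> cbox 0 1" by (simp add: mem_box_cart)
  then have "cbox (0::real^2) 1 \<noteq> {}" by blast
  ultimately obtain x0 where x0: "\<And>y. y \<in> cbox 0 1 \<Longrightarrow> ?w x0 \<le> ?w y"
    using continuous_attains_inf[of "cbox (0::real^2) 1" ?w] by auto
  have "?w x0 \<le> ?w x" for x
  proof -
    obtain k where k: "k \<in> Zvec" "x + k \<in> cbox 0 1" by (rule Zvec_box)
    have "?w (x + k) = ?w x"
      using h_per[OF k(1), of x] v_per[OF k(1), of x]
      by (auto simp: wedge.minus_left wedge.minus_right)
    then show ?thesis using x0[OF k(2)] by simp
  qed
  then show ?thesis using nz[of x0] by (intro exI[of _ "?w x0"]) auto
qed

text \<open>For \<open>a\<close> with coordinates (p, q) and \<open>b\<close> with coordinates (r,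
  s) in the basis \<open>h x\<close>, \<open>v x\<close>, the area is (p s - q r)
  \<open>wedge (h x) (v x)\<close>, and the cone conditions give |q r| \<le> \<mu>^2 |p s|. The
  constant combines this with \<open>wedge_hv\<close> and with norm a \<le> (1 + \<mu>) |p|, norm b
  \<le> (1 + \<mu>) |s|.\<close>

lemma transversal:
  "\<exists>c>0. c \<le> 1 \<and> (\<forall>x. \<forall>a\<in>cu x. \<forall>b\<in>cs x. c * (norm a * norm b) \<le> \<bar>wedge a b\<bar>)"
proof -
  obtain c where c: "c > 0" "\<And>x. c \<le> \<bar>wedge (h x) (v x)\<bar>" using wedge_hv by auto
  define k where "k = c * (1 - \<mu>\<^sup>2) / (1 + \<mu>)\<^sup>2"
  have mu2: "\<mu>\<^sup>2 < 1" using mu by (simp add: power_less_one_iff)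
  have k0: "k > 0" unfolding k_def using c mu mu2 by simp
  have main: "k * (norm a * norm b) \<le> \<bar>wedge a b\<bar>" if a: "a \<in> cu x" and b: "b \<in> cs x" for a b x
  proof -
    obtain p q where pq: "a = p *\<^sub>R h x + q *\<^sub>R v x" "\<bar>q\<bar> \<le> \<mu> * \<bar>p\<bar>"
      using a by (auto simp: cone_u_def)
    obtain r s where rs: "b = r *\<^sub>R h x + s *\<^sub>R v x" "\<bar>r\<bar> \<le> \<mu> * \<bar>s\<bar>"
      using b by (auto simp: cone_s_def)
    have na: "norm a \<le> (1 + \<mu>) * \<bar>p\<bar>"
      unfolding pq using norm_triangle_ineq[of "p *\<^sub>R h x" "q *\<^sub>R v x"] pq(2) by (simp add: algebra_simps)
    have nb: "norm b \<le> (1 + \<mu>) * \<bar>s\<bar>"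
      unfolding rs using norm_triangle_ineq[of "r *\<^sub>R h x" "s *\<^sub>R v x"] rs(2) by (simp add: algebra_simps)
    have "wedge a b = (p * s - q * r) * wedge (h x) (v x)"
      unfolding pq rs by (simp add: wedge.bilinear_simps wedge_commute[of "v x" "h x"] algebra_simps)
    then have w: "\<bar>wedge a b\<bar> = \<bar>p * s - q * r\<bar> * \<bar>wedge (h x) (v x)\<bar>" by (simp add: abs_mult)
    have "\<bar>q * r\<bar> \<le> (\<mu> * \<bar>p\<bar>) * (\<mu> * \<bar>s\<bar>)"
      unfolding abs_mult using mu by (intro mult_mono pq rs) auto
    then have "(1 - \<mu>\<^sup>2) * (\<bar>p\<bar> * \<bar>s\<bar>) \<le> \<bar>p * s\<bar> - \<bar>q * r\<bar>"
      by (simp add: abs_mult algebra_simps power2_eq_square)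
    also have "\<dots> \<le> \<bar>p * s - q * r\<bar>" by linarith
    finally have l: "(1 - \<mu>\<^sup>2) * (\<bar>p\<bar> * \<bar>s\<bar>) \<le> \<bar>p * s - q * r\<bar>" .
    have "k * (norm a * norm b) \<le> k * (((1 + \<mu>) * \<bar>p\<bar>) * ((1 + \<mu>) * \<bar>s\<bar>))"
      using k0 mu by (intro mult_left_mono mult_mono na nb) auto
    also have "\<dots> = ((1 - \<mu>\<^sup>2) * (\<bar>p\<bar> * \<bar>s\<bar>)) * c"
    proof -
      have "k * (1 + \<mu>)\<^sup>2 = c * (1 - \<mu>\<^sup>2)" unfolding k_def using mu by simp
      moreover have "k * (((1 + \<mu>) * \<bar>p\<bar>) * ((1 + \<mu>) * \<bar>s\<bar>)) = k * (1 + \<mu>)\<^sup>2 * (\<bar>p\<bar> * \<bar>s\<bar>)"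
        by (simp add: power2_eq_square)
      ultimately show ?thesis by (simp only: mult_ac)
    qed
    also have "\<dots> \<le> \<bar>p * s - q * r\<bar> * \<bar>wedge (h x) (v x)\<bar>"
      using c(1) c(2)[of x] l by (intro mult_mono) auto
    finally show ?thesis using w by simp
  qed
  show ?thesis
  proof (intro exI[of _ "min k 1"] conjI allI ballI)
    fix x a b assume ab: "a \<in> cu x" "b \<in> cs x"
    have "min k 1 * (norm a * norm b) \<le> k * (norm a * norm b)"
      by (intro mult_right_mono) auto
    then show "min k 1 * (norm a * norm b) \<le> \<bar>wedge a b\<bar>" using main[OF ab] by linarith
  qed (use k0 in auto)
qed

definition tv :: real where
  "tv = (SOME c. c > 0 \<and> c \<le> 1 \<and> (\<forall>x. \<forall>a\<in>cu x. \<forall>b\<in>cs x. c * (norm a * norm b) \<le> \<bar>wedge a b\<bar>))"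

lemma tv: "tv > 0" "tv \<le> 1" "a \<in> cu x \<Longrightarrow> b \<in> cs x \<Longrightarrow> tv * (norm a * norm b) \<le> \<bar>wedge a b\<bar>"
  using someI_ex[OF transversal] unfolding tv_def[symmetric] by auto

text \<open>A finite-time substitute for the stable direction: y depends on n, but its contraction
  rate and the bound \<open>tv\<close> on its transversality to the unstable cone do not.\<close>

lemma stable_test_vector:
  "\<exists>y\<in>cs x. norm y = 1 \<and> norm (blinfun_apply (coc m n x) y) \<le> (1 / \<eta>) ^ n"
proof -
  let ?w = "v (orb m n x)"
  have w0: "?w \<noteq> 0" using norm_v[of "orb m n x"] by (metis norm_zero zero_neq_one)
  obtain y where y: "y \<in> cs x" "y \<noteq> 0" "blinfun_apply (coc m n x) y = ?w" "\<eta> ^ n * norm ?w \<le> norm y"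
    using coc_cs[OF v_in_cs w0] by blast
  let ?y = "(1 / norm y) *\<^sub>R y"
  have "norm (blinfun_apply (coc m n x) ?y) = 1 / norm y"
    by (simp add: blinfun.scaleR_right y)
  also have "\<dots> \<le> 1 / \<eta> ^ n" using y eta by (intro divide_left_mono mult_pos_pos) auto
  finally show ?thesis
    using y by (intro bexI[of _ ?y]) (auto simp: cone_s_scale power_one_over)
qed

text \<open>Write \<xi> in the basis of w and the vector y of \<open>stable_test_vector\<close>,
  with coefficients controlled by \<open>tv\<close>. The y-part is contracted, hence dominated by
  the growth of w, which is at least 1; this accounts for the factor 2. So a single vector of the
  unstable cone controls the norm of the whole cocycle.\<close>

lemma coc_norm:
  assumes w: "w \<in> cu x" "w \<noteq> 0"
  shows "norm (blinfun_apply (coc m n x) \<xi>) \<le> 2 / tv * norm \<xi> * (norm (blinfun_apply (coc m n x) w) / norm w)"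
proof -
  let ?A = "blinfun_apply (coc m n x)"
  obtain y where y: "y \<in> cs x" "norm y = 1" "norm (?A y) \<le> (1 / \<eta>) ^ n"
    using stable_test_vector by blast
  have t: "tv * norm w \<le> \<bar>wedge w y\<bar>" using tv(3)[OF w(1) y(1)] y(2) by simp
  have nw: "norm w > 0" using w by simp
  have "0 < tv * norm w" using nw tv(1) by simp
  then have wy: "wedge w y \<noteq> 0" "\<bar>wedge w y\<bar> > 0" using t by auto
  have 1: "1 \<le> norm (?A w) / norm w"
  proof -
    have "1 * norm w \<le> \<eta> ^ n * norm w" using eta by (intro mult_right_mono) auto
    also have "\<dots> \<le> norm (?A w)" using coc_expand[OF w(1), of n m 0] by simp
    finally show ?thesis using nw by (simp add: field_simps)
  qed
  have "?A \<xi> = (wedge \<xi> y / wedge w y) *\<^sub>R ?A w + (wedge w \<xi> / wedge w y) *\<^sub>R ?A y"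
    by (subst wedge_decompose[OF wy(1), of \<xi>]) (simp add: blinfun.bilinear_simps)
  then have "norm (?A \<xi>) \<le> \<bar>wedge \<xi> y\<bar> / \<bar>wedge w y\<bar> * norm (?A w) + \<bar>wedge w \<xi>\<bar> / \<bar>wedge w y\<bar> * norm (?A y)"
    by (metis norm_triangle_ineq norm_scaleR abs_divide)
  also have "\<dots> \<le> norm \<xi> / (tv * norm w) * norm (?A w) + (norm w * norm \<xi>) / (tv * norm w) * 1"
  proof (intro add_mono mult_mono frac_le)
    show "\<bar>wedge \<xi> y\<bar> \<le> norm \<xi>" using abs_wedge_le[of \<xi> y] y by simp
    have "(1 / \<eta>) ^ n \<le> 1" using eta by (intro power_le_one) auto
    then show "norm (?A y) \<le> 1" using y(3) by linarith
  qed (use t tv nw abs_wedge_le in auto)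
  also have "\<dots> = norm \<xi> / tv * (norm (?A w) / norm w + 1)"
    using nw tv(1) by (simp add: field_simps)
  also have "\<dots> \<le> norm \<xi> / tv * (norm (?A w) / norm w + norm (?A w) / norm w)"
    using 1 tv(1) by (intro mult_left_mono) auto
  finally show ?thesis by (simp add: field_simps)
qed

text \<open>Evaluating the area on w and a contracted test vector bounds the determinant by |u_n|
  \<eta>^-n / \<open>tv\<close>. The extra decay relative to |u_n| is the source of all convergence
  below.\<close>

lemma coc_wedge:
  assumes w: "w \<in> cu x" "norm w = 1"
  shows "\<bar>wedge (blinfun_apply (coc m n x) \<xi>) (blinfun_apply (coc m n x) \<zeta>)\<bar>
    \<le> \<bar>wedge \<xi> \<zeta>\<bar> / tv * norm (blinfun_apply (coc m n x) w) * (1 / \<eta>) ^ n"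
proof -
  let ?A = "blinfun_apply (coc m n x)" and ?d = "detL (coc m n x)"
  obtain y where y: "y \<in> cs x" "norm y = 1" "norm (?A y) \<le> (1 / \<eta>) ^ n"
    using stable_test_vector by blast
  have t: "tv \<le> \<bar>wedge w y\<bar>" using tv(3)[OF w(1) y(1)] y(2) w(2) by simp
  have "\<bar>?d\<bar> * tv \<le> \<bar>?d\<bar> * \<bar>wedge w y\<bar>" using t by (intro mult_left_mono) auto
  also have "\<dots> = \<bar>wedge (?A w) (?A y)\<bar>" by (simp add: wedge_blinfun abs_mult)
  also have "\<dots> \<le> norm (?A w) * norm (?A y)" by (rule abs_wedge_le)
  also have "\<dots> \<le> norm (?A w) * (1 / \<eta>) ^ n" using y by (intro mult_left_mono) auto
  finally have d: "\<bar>?d\<bar> \<le> norm (?A w) * (1 / \<eta>) ^ n / tv" using tv(1) by (simp add: pos_le_divide_eq)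
  have "\<bar>wedge (?A \<xi>) (?A \<zeta>)\<bar> = \<bar>?d\<bar> * \<bar>wedge \<xi> \<zeta>\<bar>" by (simp add: wedge_blinfun abs_mult)
  also have "\<dots> \<le> norm (?A w) * (1 / \<eta>) ^ n / tv * \<bar>wedge \<xi> \<zeta>\<bar>"
    using d by (intro mult_right_mono) auto
  finally show ?thesis by (simp add: field_simps)
qed

text \<open>Determinants of mutually inverse derivatives multiply to 1, and that of the inverse is
  at most C^2. Relative derivative bounds divide by the determinant, hence the interest in a lower
  bound.\<close>

lemma detL_DF_lower: "1 / C\<^sup>2 \<le> \<bar>detL (DF n x)\<bar>"
proof -
  let ?M = "DF n x" and ?N = "DG n (F n x)"
  let ?e = "axis 1 1 :: real^2" and ?f = "axis 2 1 :: real^2"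
  have "wedge ?e ?f = detL ?M * wedge (blinfun_apply ?N ?e) (blinfun_apply ?N ?f)"
    unfolding wedge_blinfun[symmetric] DF_DG ..
  then have "1 = detL ?M * detL ?N"
    by (simp add: wedge_def detL_def axis_def)
  then have "1 = \<bar>detL ?M\<bar> * \<bar>detL ?N\<bar>" by (metis abs_mult abs_one)
  also have "\<dots> \<le> \<bar>detL ?M\<bar> * C\<^sup>2"
  proof (intro mult_left_mono)
    have "\<bar>detL ?N\<bar> \<le> norm ?N * norm ?N" by (rule abs_detL_le)
    also have "\<dots> \<le> C * C" using norm_DG C_ge_1 by (intro mult_mono) auto
    finally show "\<bar>detL ?N\<bar> \<le> C\<^sup>2" by (simp add: power2_eq_square)
  qed auto
  finally show ?thesis using C_ge_1 by (simp add: field_simps)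
qed

end

section \<open>Derivative estimates along the unstable direction\<close>

lemma has_vector_derivative_compose:
  assumes "(f has_vector_derivative f') (at x)" "(g has_derivative g') (at (f x))"
  shows "((\<lambda>x. g (f x)) has_vector_derivative g' f') (at x)"
proof -
  have "((\<lambda>x. g (f x)) has_derivative (\<lambda>t. g' (t *\<^sub>R f'))) (at x)"
    by (rule has_derivative_compose[OF assms(1)[unfolded has_vector_derivative_def] assms(2)])
  then show ?thesis
    unfolding has_vector_derivative_def linear_cmul[OF has_derivative_linear[OF assms(2)]] .
qed

lemma line_deriv: "((\<lambda>a. z + a *\<^sub>R w) has_vector_derivative w) (at a)"
  unfolding has_vector_derivative_def by (auto intro!: derivative_eq_intros)

lemma has_vector_derivative_inner:
  assumes "(f has_vector_derivative f') (at x)" "(g has_vector_derivative g') (at x)"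
  shows "((\<lambda>x. f x \<bullet> g x) has_real_derivative (f x \<bullet> g' + f' \<bullet> g x)) (at x)"
  using bounded_bilinear.has_vector_derivative[OF bounded_bilinear_inner assms]
  unfolding has_real_derivative_iff_has_vector_derivative .

lemma has_vector_derivative_wedge:
  assumes "(f has_vector_derivative f') (at x)" "(g has_vector_derivative g') (at x)"
  shows "((\<lambda>x. wedge (f x) (g x)) has_real_derivative (wedge (f x) g' + wedge f' (g x))) (at x)"
  using bounded_bilinear.has_vector_derivative[OF wedge.bounded_bilinear_axioms assms]
  unfolding has_real_derivative_iff_has_vector_derivative .

text \<open>A bound for the derivative relative to the bound for the function behaves well under products: the
  factors \<open>K\<close> multiply and the rates \<open>R\<close> add.\<close>

definition rel_deriv_bound :: "(real \<Rightarrow> real) \<Rightarrow> real \<Rightarrow> real \<Rightarrow> real \<Rightarrow> bool" where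
  "rel_deriv_bound f a K R \<longleftrightarrow>
     \<bar>f a\<bar> \<le> K \<and> (\<exists>f'. (f has_real_derivative f') (at a) \<and> \<bar>f'\<bar> \<le> K * R)"

lemma rel_deriv_boundI:
  "(f has_real_derivative f') (at a) \<Longrightarrow> \<bar>f'\<bar> \<le> K * R \<Longrightarrow> \<bar>f a\<bar> \<le> K \<Longrightarrow> rel_deriv_bound f a K R"
  unfolding rel_deriv_bound_def by auto

lemma rel_deriv_bound_mult:
  assumes "rel_deriv_bound f a K R" "rel_deriv_bound g a L S"
  shows "rel_deriv_bound (\<lambda>x. f x * g x) a (K * L) (R + S)"
proof -
  obtain f' where f: "\<bar>f a\<bar> \<le> K" "(f has_real_derivative f') (at a)" "\<bar>f'\<bar> \<le> K * R"
    using assms(1) by (auto simp: rel_deriv_bound_def)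
  obtain g' where g: "\<bar>g a\<bar> \<le> L" "(g has_real_derivative g') (at a)" "\<bar>g'\<bar> \<le> L * S"
    using assms(2) by (auto simp: rel_deriv_bound_def)
  have p: "0 \<le> K" "0 \<le> L" "0 \<le> K * R" "0 \<le> L * S"
    using f(1,3) g(1,3) by linarith+
  have "((\<lambda>x. f x * g x) has_real_derivative (f' * g a + g' * f a)) (at a)"
    by (rule DERIV_mult[OF f(2) g(2)])
  moreover have "\<bar>f' * g a + g' * f a\<bar> \<le> K * L * (R + S)"
  proof -
    have "\<bar>f' * g a\<bar> \<le> (K * R) * L" unfolding abs_mult by (intro mult_mono f(1) f(3) g(1) g(3) p abs_ge_zero)
    moreover have "\<bar>g' * f a\<bar> \<le> (L * S) * K" unfolding abs_mult by (intro mult_mono f(1) f(3) g(1) g(3) p abs_ge_zero)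
    moreover have "K * L * (R + S) = (K * R) * L + (L * S) * K" by (simp add: algebra_simps)
    ultimately show ?thesis by linarith
  qed
  moreover have "\<bar>f a * g a\<bar> \<le> K * L" unfolding abs_mult by (intro mult_mono f(1) f(3) g(1) g(3) p abs_ge_zero)
  ultimately show ?thesis by (rule rel_deriv_boundI)
qed

lemma rel_deriv_bound_mono:
  assumes "rel_deriv_bound f a K R" "K \<le> L" "R \<le> S" "0 \<le> S"
  shows "rel_deriv_bound f a L S"
proof -
  obtain f' where f: "\<bar>f a\<bar> \<le> K" "(f has_real_derivative f') (at a)" "\<bar>f'\<bar> \<le> K * R"
    using assms(1) by (auto simp: rel_deriv_bound_def)
  have "K * R \<le> K * S" using f(1) assms(3) by (intro mult_left_mono) auto
  also have "\<dots> \<le> L * S" using assms by (intro mult_right_mono) auto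
  finally have "\<bar>f'\<bar> \<le> L * S" using f(3) by linarith
  then show ?thesis using f(1) assms(2) by (intro rel_deriv_boundI[OF f(2)]) auto
qed

section \<open>The derivative of the cocycle along a straight line\<close>

context cone_system
begin

lemma orb_add: "orb m (n + k) x = orb (m + n) k (orb m n x)"
  by (induction k) (auto simp: add.assoc)

lemma coc_add: "coc m (n + k) x = coc (m + n) k (orb m n x) o\<^sub>L coc m n x"
  by (induction k) (auto simp: add.assoc orb_add blinfun_eqI)

lemma orb_deriv: "(orb m n has_derivative blinfun_apply (coc m n x)) (at x)"
proof (induction n)
  case (Suc n)
  show ?case using has_derivative_compose[OF Suc DF[of "m + n" "orb m n x"]] by simp
qed simp

lemma orb_line:
  "((\<lambda>a. orb m n (z + a *\<^sub>R w)) has_vector_derivative blinfun_apply (coc m n (z + a *\<^sub>R w)) w) (at a)"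
  by (rule has_vector_derivative_compose[OF line_deriv orb_deriv])

text \<open>\<open>dcoc w \<xi> n z\<close> is the derivative at \<open>z\<close> in the direction \<open>w\<close> of the cocycle applied to \<open>\<xi>\<close>.\<close>

primrec dcoc :: "real^2 \<Rightarrow> real^2 \<Rightarrow> nat \<Rightarrow> real^2 \<Rightarrow> real^2" where
  "dcoc w \<xi> 0 z = 0"
| "dcoc w \<xi> (Suc n) z =
     blinfun_apply (blinfun_apply (D2F n (orb 0 n z)) (blinfun_apply (coc 0 n z) w)) (blinfun_apply (coc 0 n z) \<xi>)
     + blinfun_apply (DF n (orb 0 n z)) (dcoc w \<xi> n z)"

lemma DF_orb_line:
  "((\<lambda>a. DF n (orb 0 n (z + a *\<^sub>R w))) has_vector_derivative
      blinfun_apply (D2F n (orb 0 n (z + a *\<^sub>R w))) (blinfun_apply (coc 0 n (z + a *\<^sub>R w)) w)) (at a)"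
  by (rule has_vector_derivative_compose[OF orb_line D2F])

lemma coc_line:
  "((\<lambda>a. blinfun_apply (coc 0 n (z + a *\<^sub>R w)) \<xi>) has_vector_derivative dcoc w \<xi> n (z + a *\<^sub>R w)) (at a)"
proof (induction n)
  case (Suc n)
  from bounded_bilinear.has_vector_derivative[OF bounded_bilinear_blinfun_apply DF_orb_line Suc]
  show ?case by (simp add: add.commute)
qed simp

lemma norm_D2F_app: "norm (blinfun_apply (blinfun_apply (D2F n x) a) b) \<le> C * norm a * norm b"
proof -
  have "norm (blinfun_apply (blinfun_apply (D2F n x) a) b) \<le> norm (blinfun_apply (D2F n x) a) * norm b"
    by (rule norm_blinfun)
  also have "\<dots> \<le> (norm (D2F n x) * norm a) * norm b" by (intro mult_right_mono norm_blinfun) auto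
  also have "\<dots> \<le> (C * norm a) * norm b" by (intro mult_right_mono norm_D2F) auto
  finally show ?thesis .
qed

lemma norm_DF_app: "norm (blinfun_apply (DF n x) a) \<le> C * norm a"
  by (rule order_trans[OF norm_blinfun]) (intro mult_right_mono norm_DF; simp)

text \<open>The statement with the extra \<open>l\<close> steps is what makes the induction on \<open>n\<close> work; only \<open>l = 0\<close> is of interest.\<close>

lemma inhomogeneous_growth:
  fixes x y :: "nat \<Rightarrow> real^2"
  assumes w: "w \<in> cu z" "norm w = 1" and x0: "x 0 = 0"
    and xS: "\<And>n. x (Suc n) = blinfun_apply (DF n (orb 0 n z)) (x n) + y n"
  shows "norm (blinfun_apply (coc n l (orb 0 n z)) (x n)) \<le>
    (\<Sum>m<n. 2 / tv * norm (y m) * (norm (blinfun_apply (coc 0 (n + l) z) w) / norm (blinfun_apply (coc 0 (Suc m) z) w)))"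
proof (induction n arbitrary: l)
  case 0
  then show ?case by (simp add: x0)
next
  case (Suc n)
  let ?u = "\<lambda>n. blinfun_apply (coc 0 n z) w"
  have u: "?u (Suc n) \<in> cu (orb 0 (Suc n) z)" by (rule coc_cu[OF w(1)])
  have "1 \<le> \<eta> ^ Suc n" using eta by (intro one_le_power) simp
  moreover have "\<eta> ^ Suc n * norm (?u 0) \<le> norm (?u (0 + Suc n))" by (rule coc_expand[OF w(1)])
  ultimately have "1 \<le> norm (?u (Suc n))" using w(2) by (simp del: coc.simps(2) power_Suc)
  then have u0: "?u (Suc n) \<noteq> 0" by auto
  have s: "blinfun_apply (coc (Suc n) l (orb 0 (Suc n) z)) (?u (Suc n)) = ?u (Suc n + l)"
    using coc_add[of 0 "Suc n" l z] by (simp del: coc.simps orb.simps)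
  have "blinfun_apply (coc (Suc n) l (orb 0 (Suc n) z)) (x (Suc n)) =
      blinfun_apply (coc n (Suc l) (orb 0 n z)) (x n) + blinfun_apply (coc (Suc n) l (orb 0 (Suc n) z)) (y n)"
    unfolding xS coc_shift by (simp add: blinfun.bilinear_simps)
  then have "norm (blinfun_apply (coc (Suc n) l (orb 0 (Suc n) z)) (x (Suc n))) \<le>
      norm (blinfun_apply (coc n (Suc l) (orb 0 n z)) (x n)) + norm (blinfun_apply (coc (Suc n) l (orb 0 (Suc n) z)) (y n))"
    by (metis norm_triangle_ineq)
  also have "\<dots> \<le> (\<Sum>m<n. 2 / tv * norm (y m) * (norm (?u (n + Suc l)) / norm (?u (Suc m)))) +
      2 / tv * norm (y n) * (norm (?u (Suc n + l)) / norm (?u (Suc n)))"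
    using coc_norm[OF u u0, of "Suc n" l "y n"] unfolding s by (intro add_mono Suc.IH)
  finally show ?case by (simp del: coc.simps)
qed

text \<open>The norms grow at least geometrically, so their sum is comparable to the next term. The
  constant 1 / (\<eta> - 1) reproduces itself because 1 / (\<eta> - 1) + 1 = \<eta> / (\<eta> -
  1).\<close>

lemma sum_orbit_le:
  assumes w: "w \<in> cu z"
  shows "(\<Sum>m<n. norm (blinfun_apply (coc 0 m z) w)) \<le> norm (blinfun_apply (coc 0 n z) w) / (\<eta> - 1)"
proof (induction n)
  case 0
  then show ?case using eta by simp
next
  case (Suc n)
  let ?U = "\<lambda>n. norm (blinfun_apply (coc 0 n z) w)"
  have "(\<Sum>m<Suc n. ?U m) \<le> ?U n / (\<eta> - 1) + ?U n" using Suc by simp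
  also have "\<dots> = \<eta> * ?U n / (\<eta> - 1)" using eta by (simp add: field_simps)
  also have "\<dots> \<le> ?U (Suc n) / (\<eta> - 1)"
    using coc_expand_Suc[OF w, of 0 n] eta by (intro divide_right_mono) auto
  finally show ?case .
qed

text \<open>\<open>K1\<close> comes from the geometric sum in \<open>dcoc_bound\<close>.
  \<open>K2\<close> adds the three terms of the product rule in \<open>shear_line\<close>, and
  \<open>K3\<close> adds the rates of the four factors of the increment in \<open>sig_step\<close>.
  The terms with \<open>K1 * C\<close> arise where |u_(n+1)| is replaced by C |u_n|.\<close>

definition "K1 = 2 / tv * C / (\<eta> - 1)"

definition "K2 = 1 + K1 + K1 * C"

definition "K3 = 2 * C ^ 4 / (\<eta> - 1) + K2 + 2 * K1 + 2 * K1 * C"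

definition sig :: "real^2 \<Rightarrow> real^2 \<Rightarrow> nat \<Rightarrow> real^2 \<Rightarrow> real" where
  "sig w \<xi> n x = - (blinfun_apply (coc 0 n x) \<xi> \<bullet> blinfun_apply (coc 0 n x) w) /
     (blinfun_apply (coc 0 n x) w \<bullet> blinfun_apply (coc 0 n x) w)"

text \<open>The quotient rule for \<open>sig\<close> along w, kept as an explicit formula:
  continuity in x and the Lipschitz bounds of the C^3 case are read off from it.\<close>

definition dsig :: "real^2 \<Rightarrow> real^2 \<Rightarrow> nat \<Rightarrow> real^2 \<Rightarrow> real" where
  "dsig w \<xi> n x = (let u = blinfun_apply (coc 0 n x) w; q = blinfun_apply (coc 0 n x) \<xi> in
     - ((q \<bullet> dcoc w w n x + dcoc w \<xi> n x \<bullet> u) / (u \<bullet> u)) +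
     (q \<bullet> u) * (2 * (u \<bullet> dcoc w w n x)) / (u \<bullet> u)\<^sup>2)"

end

text \<open>All estimates are pointwise: w has to lie in the unstable cone at z alone, and
  derivatives are taken at a = 0 of functions of z + a w. Points off z enter only through
  continuity.\<close>

locale cone_line = cone_system +
  fixes w \<xi> z :: "real^2"
  assumes w: "w \<in> cone_u h v \<mu> z" "norm w = 1" and norm_xi: "norm \<xi> = 1"
begin

abbreviation "u n x \<equiv> blinfun_apply (coc 0 n x) w"
abbreviation "q n x \<equiv> blinfun_apply (coc 0 n x) \<xi>"

lemma U_ge: "\<eta> ^ n \<le> norm (u n z)"
  using coc_expand[OF w(1), of n 0 0] w(2) by simp

lemma U_ge_1: "1 \<le> norm (u n z)"
proof -
  have "1 \<le> \<eta> ^ n" using eta by (intro one_le_power) simp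
  then show ?thesis using U_ge[of n] by linarith
qed

lemma U_mono: "norm (u n z) \<le> norm (u (Suc n) z)"
proof -
  have "1 * norm (u n z) \<le> \<eta> * norm (u n z)" using eta by (intro mult_right_mono) auto
  then show ?thesis using coc_expand_Suc[OF w(1), of 0 n] by simp
qed

lemma U_Suc_le: "norm (u (Suc n) z) \<le> C * norm (u n z)"
  using norm_DF_app by simp

lemma K1_nonneg: "0 \<le> K1"
  using C_ge_1 tv eta by (simp add: K1_def)

text \<open>\<open>dcoc w w\<close> obeys a linear recursion whose source at time m has size C
  |u_m|^2. Propagating it from time m + 1 to n costs |u_n| / |u_(m+1)|, and |u_m| \<le> |u_(m+1)|
  leaves terms C |u_n| |u_m|, which \<open>sum_orbit_le\<close> adds up.\<close>

lemma dcoc_bound: "norm (dcoc w w n z) \<le> K1 * (norm (u n z))\<^sup>2"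
proof -
  let ?U = "\<lambda>n. norm (u n z)"
  define y where "y n = blinfun_apply (blinfun_apply (D2F n (orb 0 n z)) (u n z)) (u n z)" for n
  have "norm (dcoc w w n z) = norm (blinfun_apply (coc n 0 (orb 0 n z)) (dcoc w w n z))" by simp
  also have "\<dots> \<le> (\<Sum>m<n. 2 / tv * norm (y m) * (?U (n + 0) / ?U (Suc m)))"
    by (rule inhomogeneous_growth[OF w]) (auto simp: y_def)
  also have "\<dots> \<le> (\<Sum>m<n. 2 / tv * C * ?U n * ?U m)"
  proof (rule sum_mono)
    fix m
    have "norm (y m) \<le> C * ?U m * ?U m" unfolding y_def by (rule norm_D2F_app)
    also have "\<dots> \<le> C * ?U m * ?U (Suc m)" using C_ge_1 U_mono[of m] by (intro mult_left_mono) auto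
    finally have y: "norm (y m) \<le> C * ?U m * ?U (Suc m)" .
    have "2 / tv * norm (y m) * (?U (n + 0) / ?U (Suc m)) \<le> 2 / tv * (C * ?U m * ?U (Suc m)) * (?U n / ?U (Suc m))"
      unfolding add_0_right using tv(1) y by (intro mult_right_mono mult_left_mono) (auto simp del: coc.simps)
    also have "\<dots> = 2 / tv * C * ?U n * ?U m"
      using U_ge_1[of "Suc m"] by (auto simp del: coc.simps)
    finally show "2 / tv * norm (y m) * (?U (n + 0) / ?U (Suc m)) \<le> 2 / tv * C * ?U n * ?U m" .
  qed
  also have "\<dots> = 2 / tv * C * ?U n * (\<Sum>m<n. ?U m)" by (simp add: sum_distrib_left)
  also have "\<dots> \<le> 2 / tv * C * ?U n * (?U n / (\<eta> - 1))"
    using tv C_ge_1 by (intro mult_left_mono sum_orbit_le w) auto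
  finally show ?thesis by (simp add: K1_def power2_eq_square mult.assoc)
qed

lemma wedge_uq_Suc:
  "wedge (u (Suc n) x) (q (Suc n) x) = detL (DF n (orb 0 n x)) * wedge (u n x) (q n x)"
  by (simp add: wedge_blinfun)

text \<open>The product rule gives the absolute bound 2 C^2 |u_n|; the lower bound 1 / C^2 for the
  determinant turns it into a relative rate, whence C^4.\<close>

lemma detL_line:
  "rel_deriv_bound (\<lambda>a. detL (DF n (orb 0 n (z + a *\<^sub>R w)))) 0 \<bar>detL (DF n (orb 0 n z))\<bar> (2 * C ^ 4 * norm (u n z))"
proof -
  let ?M = "DF n (orb 0 n z)" and ?B = "blinfun_apply (D2F n (orb 0 n z)) (u n z)"
  let ?e = "axis 1 1 :: real^2" and ?f = "axis 2 1 :: real^2"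
  let ?d = "wedge (blinfun_apply ?M ?e) (blinfun_apply ?B ?f) + wedge (blinfun_apply ?B ?e) (blinfun_apply ?M ?f)"
  have D: "((\<lambda>a. blinfun_apply (DF n (orb 0 n (z + a *\<^sub>R w))) x) has_vector_derivative blinfun_apply ?B x) (at 0)" for x
    using has_vector_derivative_compose[OF DF_orb_line[of n z w 0], of "\<lambda>T. blinfun_apply T x" "\<lambda>T. blinfun_apply T x"]
    by (simp add: bounded_linear_imp_has_derivative blinfun.bounded_linear_left)
  have "((\<lambda>a. detL (DF n (orb 0 n (z + a *\<^sub>R w)))) has_real_derivative ?d) (at 0)"
    unfolding detL_def using has_vector_derivative_wedge[OF D D, of ?e ?f] by simp
  moreover have "\<bar>?d\<bar> \<le> \<bar>detL ?M\<bar> * (2 * C ^ 4 * norm (u n z))"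
  proof -
    have M: "norm (blinfun_apply ?M (axis i 1)) \<le> C" for i
      using norm_DF_app[of n _ "axis i 1"] by simp
    have B: "norm (blinfun_apply ?B (axis i 1)) \<le> C * norm (u n z)" for i
      using norm_D2F_app[of n "orb 0 n z" "u n z" "axis i 1"] by simp
    have "\<bar>?d\<bar> \<le> C * (C * norm (u n z)) + (C * norm (u n z)) * C"
      by (intro order_trans[OF abs_triangle_ineq] add_mono order_trans[OF abs_wedge_le] mult_mono M B)
        (use C_ge_1 in auto)
    also have "\<dots> = 1 / C\<^sup>2 * (2 * C ^ 4 * norm (u n z))"
      using C_ge_1 by (simp add: field_simps power2_eq_square power4_eq_xxxx)
    also have "\<dots> \<le> \<bar>detL ?M\<bar> * (2 * C ^ 4 * norm (u n z))"
      using C_ge_1 by (intro mult_right_mono detL_DF_lower) auto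
    finally show ?thesis .
  qed
  moreover have "\<bar>detL (DF n (orb 0 n (z + 0 *\<^sub>R w)))\<bar> \<le> \<bar>detL ?M\<bar>" by simp
  ultimately show ?thesis by (rule rel_deriv_boundI)
qed

text \<open>Each step multiplies the area by one determinant, so the relative rates add. Taking the
  area itself as the size bound keeps the product of n factors free of accumulated
  constants.\<close>

lemma wedge_uq_line:
  "rel_deriv_bound (\<lambda>a. wedge (u n (z + a *\<^sub>R w)) (q n (z + a *\<^sub>R w))) 0 \<bar>wedge (u n z) (q n z)\<bar>
    (2 * C ^ 4 * (\<Sum>m<n. norm (u m z)))"
proof (induction n)
  case 0
  have "((\<lambda>a. wedge w \<xi>) has_real_derivative 0) (at 0)" by simp
  then show ?case unfolding rel_deriv_bound_def by auto
next
  case (Suc n)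
  show ?case
    unfolding wedge_uq_Suc using rel_deriv_bound_mult[OF detL_line[of n] Suc]
    by (simp add: abs_mult algebra_simps)
qed

lemma wedge_uq_bound: "\<bar>wedge (u n z) (q n z)\<bar> \<le> norm (u n z) * (1 / \<eta>) ^ n / tv"
proof -
  have "\<bar>wedge (u n z) (q n z)\<bar> \<le> \<bar>wedge w \<xi>\<bar> / tv * norm (u n z) * (1 / \<eta>) ^ n"
    by (rule coc_wedge[OF w])
  also have "\<dots> \<le> 1 / tv * norm (u n z) * (1 / \<eta>) ^ n"
    using abs_wedge_le[of w \<xi>] w(2) norm_xi tv(1) eta
    by (intro mult_right_mono divide_right_mono) auto
  finally show ?thesis by simp
qed

lemma inverse_square_line:
  "rel_deriv_bound (\<lambda>a. 1 / (u n (z + a *\<^sub>R w) \<bullet> u n (z + a *\<^sub>R w))) 0 (1 / (norm (u n z))\<^sup>2) (2 * K1 * norm (u n z))"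
proof -
  let ?u = "u n z" and ?u' = "dcoc w w n z"
  have u0: "?u \<noteq> 0" "norm ?u > 0" using U_ge_1[of n] by auto
  have uD: "((\<lambda>a. u n (z + a *\<^sub>R w)) has_vector_derivative ?u') (at 0)"
    using coc_line[of n z w w 0] by simp
  let ?d = "- (?u \<bullet> ?u' + ?u' \<bullet> ?u) / (?u \<bullet> ?u)\<^sup>2"
  have "((\<lambda>a. 1 / (u n (z + a *\<^sub>R w) \<bullet> u n (z + a *\<^sub>R w))) has_real_derivative ?d) (at 0)"
    using DERIV_divide[OF DERIV_const[of 1] has_vector_derivative_inner[OF uD uD]] u0(1)
    by (simp add: power2_eq_square)
  moreover have "\<bar>?d\<bar> \<le> 1 / (norm ?u)\<^sup>2 * (2 * K1 * norm ?u)"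
  proof -
    have "\<bar>?u \<bullet> ?u' + ?u' \<bullet> ?u\<bar> \<le> 2 * (norm ?u * (K1 * (norm ?u)\<^sup>2))"
      using Cauchy_Schwarz_ineq2[of ?u ?u'] mult_left_mono[OF dcoc_bound[of n] norm_ge_zero[of ?u]]
        inner_commute[of ?u' ?u] by linarith
    then have "\<bar>?d\<bar> \<le> 2 * (norm ?u * (K1 * (norm ?u)\<^sup>2)) / ((norm ?u)\<^sup>2)\<^sup>2"
      by (simp only: abs_divide abs_minus_cancel dot_square_norm abs_power2 abs_power_minus) (simp add: divide_right_mono)
    also have "\<dots> = 1 / (norm ?u)\<^sup>2 * (2 * K1 * norm ?u)"
      using u0(2) by (simp add: field_simps power2_eq_square)
    finally show ?thesis .
  qed
  moreover have "\<bar>1 / (u n (z + 0 *\<^sub>R w) \<bullet> u n (z + 0 *\<^sub>R w))\<bar> \<le> 1 / (norm ?u)\<^sup>2"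
    by (simp add: dot_square_norm)
  ultimately show ?thesis by (rule rel_deriv_boundI)
qed

text \<open>This inner product measures how far one step tilts the normal of u_n away from the
  normal of u_(n+1). In \<open>K2\<close> the 1 stems from differentiating the map,
  \<open>K1\<close> from \<open>rot\<close> of u_n, and \<open>K1 * C\<close> from u_(n+1).\<close>

lemma shear_line:
  "rel_deriv_bound (\<lambda>a. blinfun_apply (DF n (orb 0 n (z + a *\<^sub>R w))) (rot (u n (z + a *\<^sub>R w))) \<bullet> u (Suc n) (z + a *\<^sub>R w)) 0
     (C * norm (u n z) * norm (u (Suc n) z)) (K2 * norm (u n z))"
proof -
  let ?M = "DF n (orb 0 n z)" and ?B = "blinfun_apply (D2F n (orb 0 n z)) (u n z)"
  let ?u = "u n z" and ?u' = "dcoc w w n z" and ?y = "u (Suc n) z" and ?y' = "dcoc w w (Suc n) z"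
  let ?x' = "blinfun_apply ?M (rot ?u') + blinfun_apply ?B (rot ?u)"
  have uD: "((\<lambda>a. u n (z + a *\<^sub>R w)) has_vector_derivative dcoc w w n z) (at 0)" for n
    using coc_line[of n z w w 0] by simp
  have "((\<lambda>a. rot (u n (z + a *\<^sub>R w))) has_vector_derivative rot ?u') (at 0)"
    using bounded_linear.has_vector_derivative[OF bounded_linear_rot uD] .
  from bounded_bilinear.has_vector_derivative[OF bounded_bilinear_blinfun_apply DF_orb_line[of n z w 0] this]
  have "((\<lambda>a. blinfun_apply (DF n (orb 0 n (z + a *\<^sub>R w))) (rot (u n (z + a *\<^sub>R w)))) has_vector_derivative ?x') (at 0)"
    by simp
  from has_vector_derivative_inner[OF this uD[of "Suc n"]]
  have D: "((\<lambda>a. blinfun_apply (DF n (orb 0 n (z + a *\<^sub>R w))) (rot (u n (z + a *\<^sub>R w))) \<bullet> u (Suc n) (z + a *\<^sub>R w))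
      has_real_derivative (blinfun_apply ?M (rot ?u) \<bullet> ?y' + ?x' \<bullet> ?y)) (at 0)"
    by (simp del: coc.simps dcoc.simps)
  have C0: "0 \<le> C" using C_ge_1 by simp
  have M: "norm (blinfun_apply ?M (rot ?u)) \<le> C * norm ?u"
    using norm_DF_app[of n _ "rot ?u"] by simp
  have y': "norm ?y' \<le> K1 * (norm ?y * (C * norm ?u))"
  proof -
    have "norm ?y' \<le> K1 * (norm ?y)\<^sup>2" by (rule dcoc_bound)
    also have "\<dots> \<le> K1 * (norm ?y * (C * norm ?u))"
      unfolding power2_eq_square by (intro mult_left_mono U_Suc_le K1_nonneg norm_ge_zero)
    finally show ?thesis .
  qed
  have x': "norm ?x' \<le> C * (K1 * (norm ?u)\<^sup>2) + C * norm ?u * norm ?u"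
  proof (intro norm_triangle_le add_mono)
    show "norm (blinfun_apply ?M (rot ?u')) \<le> C * (K1 * (norm ?u)\<^sup>2)"
      by (rule order_trans[OF norm_DF_app]) (use C0 dcoc_bound[of n] in \<open>intro mult_left_mono; simp\<close>)
    show "norm (blinfun_apply ?B (rot ?u)) \<le> C * norm ?u * norm ?u"
      using norm_D2F_app[of n _ ?u "rot ?u"] by simp
  qed
  have "\<bar>blinfun_apply ?M (rot ?u) \<bullet> ?y' + ?x' \<bullet> ?y\<bar> \<le>
      (C * norm ?u) * (K1 * (norm ?y * (C * norm ?u))) + (C * (K1 * (norm ?u)\<^sup>2) + C * norm ?u * norm ?u) * norm ?y"
    by (intro order_trans[OF abs_triangle_ineq] add_mono order_trans[OF Cauchy_Schwarz_ineq2] mult_mono M y' x')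
       (use C0 K1_nonneg in auto)
  also have "\<dots> = C * norm ?u * norm ?y * (K2 * norm ?u)"
    by (simp add: K2_def algebra_simps power2_eq_square del: coc.simps dcoc.simps)
  finally have D': "\<bar>blinfun_apply ?M (rot ?u) \<bullet> ?y' + ?x' \<bullet> ?y\<bar> \<le> C * norm ?u * norm ?y * (K2 * norm ?u)" .
  have "\<bar>blinfun_apply ?M (rot ?u) \<bullet> ?y\<bar> \<le> C * norm ?u * norm ?y"
    by (intro order_trans[OF Cauchy_Schwarz_ineq2] mult_right_mono M) auto
  then have "\<bar>blinfun_apply (DF n (orb 0 n (z + 0 *\<^sub>R w))) (rot (u n (z + 0 *\<^sub>R w))) \<bullet> u (Suc n) (z + 0 *\<^sub>R w)\<bar> \<le> C * norm ?u * norm ?y"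
    by (simp del: coc.simps)
  with D D' show ?thesis by (rule rel_deriv_boundI)
qed

text \<open>Split q_n into its parts along and orthogonal to u_n. The part along u_n is carried to a
  multiple of u_(n+1) with the same coefficient and cancels in the difference; only the orthogonal
  part, which is an area, survives.\<close>

lemma sig_diff:
  assumes "u n x \<noteq> 0" "u (Suc n) x \<noteq> 0"
  shows "sig w \<xi> (Suc n) x - sig w \<xi> n x =
    - (wedge (u n x) (q n x) * (blinfun_apply (DF n (orb 0 n x)) (rot (u n x)) \<bullet> u (Suc n) x)
      * (1 / (u n x \<bullet> u n x)) * (1 / (u (Suc n) x \<bullet> u (Suc n) x)))"
proof -
  let ?M = "blinfun_apply (DF n (orb 0 n x))" and ?u = "u n x" and ?q = "q n x"
  define W where "W = ?M (rot ?u) \<bullet> u (Suc n) x"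
  define a b c d where "a = ?u \<bullet> ?u" and "b = u (Suc n) x \<bullet> u (Suc n) x" and "c = ?u \<bullet> ?q"
    and "d = q (Suc n) x \<bullet> u (Suc n) x"
  have ab: "a \<noteq> 0" "b \<noteq> 0" using assms by (auto simp: a_def b_def simp del: coc.simps)
  have "a *\<^sub>R ?M ?q = c *\<^sub>R ?M ?u + wedge ?u ?q *\<^sub>R ?M (rot ?u)"
    using arg_cong[OF rot_decompose[of ?u ?q], of ?M] by (simp add: blinfun.bilinear_simps a_def c_def)
  then have "(a *\<^sub>R ?M ?q) \<bullet> u (Suc n) x = c * b + wedge ?u ?q * W"
    by (simp add: inner_add_left W_def b_def)
  then have e: "a * d = c * b + wedge ?u ?q * W" by (simp add: d_def)
  have "sig w \<xi> (Suc n) x - sig w \<xi> n x = - d / b + c / a"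
    by (simp add: sig_def a_def b_def c_def d_def inner_commute del: coc.simps)
  also have "\<dots> = - (a * d - c * b) / (a * b)" using ab by (simp add: field_simps)
  also have "\<dots> = - (wedge ?u ?q * W * (1 / a) * (1 / b))" unfolding e by simp
  finally show ?thesis unfolding W_def a_def b_def .
qed

lemma sig_line:
  assumes "u n z \<noteq> 0"
  shows "((\<lambda>a. sig w \<xi> n (z + a *\<^sub>R w)) has_real_derivative dsig w \<xi> n z) (at 0)"
proof -
  have D: "((\<lambda>a. blinfun_apply (coc 0 n (z + a *\<^sub>R w)) x) has_vector_derivative dcoc w x n z) (at 0)" for x
    using coc_line[of n z w x 0] by simp
  let ?u = "u n z" and ?q = "q n z"
  have "((\<lambda>a. - (q n (z + a *\<^sub>R w) \<bullet> u n (z + a *\<^sub>R w)) / (u n (z + a *\<^sub>R w) \<bullet> u n (z + a *\<^sub>R w)))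
      has_real_derivative
      (- (?q \<bullet> dcoc w w n z + dcoc w \<xi> n z \<bullet> ?u) * (?u \<bullet> ?u) -
        - (?q \<bullet> ?u) * (?u \<bullet> dcoc w w n z + dcoc w w n z \<bullet> ?u)) / ((?u \<bullet> ?u) * (?u \<bullet> ?u))) (at 0)"
    using DERIV_divide[OF DERIV_minus[OF has_vector_derivative_inner[OF D[of \<xi>] D[of w]]]
        has_vector_derivative_inner[OF D[of w] D[of w]]] assms by simp
  moreover have "dsig w \<xi> n z = (- (?q \<bullet> dcoc w w n z + dcoc w \<xi> n z \<bullet> ?u) * (?u \<bullet> ?u) -
        - (?q \<bullet> ?u) * (?u \<bullet> dcoc w w n z + dcoc w w n z \<bullet> ?u)) / ((?u \<bullet> ?u) * (?u \<bullet> ?u))"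
  proof -
    define a b c where "a = ?u \<bullet> ?u" and "b = ?q \<bullet> dcoc w w n z + dcoc w \<xi> n z \<bullet> ?u" and "c = ?u \<bullet> dcoc w w n z"
    have "a \<noteq> 0" using assms by (simp add: a_def)
    then have "- (b / a) + (?q \<bullet> ?u) * (2 * c) / a\<^sup>2 = (- b * a - - (?q \<bullet> ?u) * (c + c)) / (a * a)"
      by (simp add: field_simps power2_eq_square)
    then show ?thesis
      unfolding dsig_def Let_def a_def b_def c_def by (simp only: inner_commute[of "dcoc w w n z" ?u])
  qed
  ultimately show ?thesis unfolding sig_def by simp
qed

text \<open>The sizes of the four factors of the increment multiply to at most a constant times
  \<eta>^-n / |u_(n+1)|, and their rates add to at most \<open>K3\<close> |u_n|. The spare factor 1
  / |u_(n+1)| absorbs the |u_n| that differentiation costs.\<close>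

lemma sig_step:
  shows "\<bar>sig w \<xi> (Suc n) z - sig w \<xi> n z\<bar> \<le> C / tv * (1 / \<eta>) ^ n / norm (u (Suc n) z)"
    and "\<bar>dsig w \<xi> (Suc n) z - dsig w \<xi> n z\<bar> \<le> C / tv * K3 * (1 / \<eta>) ^ n"
proof -
  let ?U = "norm (u n z)" and ?V = "norm (u (Suc n) z)"
  define T where "T x = wedge (u n x) (q n x) * (blinfun_apply (DF n (orb 0 n x)) (rot (u n x)) \<bullet> u (Suc n) x)
      * (1 / (u n x \<bullet> u n x)) * (1 / (u (Suc n) x \<bullet> u (Suc n) x))" for x
  have U: "1 \<le> ?U" "1 \<le> ?V" "?U \<le> ?V" "?V \<le> C * ?U"
    by (rule U_ge_1 U_mono U_Suc_le)+
  have "rel_deriv_bound (\<lambda>a. T (z + a *\<^sub>R w)) 0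
     (\<bar>wedge (u n z) (q n z)\<bar> * (C * ?U * ?V) * (1 / ?U\<^sup>2) * (1 / ?V\<^sup>2))
     (2 * C ^ 4 * (\<Sum>m<n. norm (u m z)) + K2 * ?U + 2 * K1 * ?U + 2 * K1 * ?V)"
    unfolding T_def
    by (rule rel_deriv_bound_mult[OF rel_deriv_bound_mult[OF rel_deriv_bound_mult[OF wedge_uq_line shear_line]
          inverse_square_line] inverse_square_line])
  then have T: "rel_deriv_bound (\<lambda>a. T (z + a *\<^sub>R w)) 0 (C / tv * (1 / \<eta>) ^ n / ?V) (K3 * ?U)"
  proof (rule rel_deriv_bound_mono)
    have "\<bar>wedge (u n z) (q n z)\<bar> * (C * ?U * ?V) * (1 / ?U\<^sup>2) * (1 / ?V\<^sup>2) =
        \<bar>wedge (u n z) (q n z)\<bar> * (C / (?U * ?V))"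
      using U by (simp add: power2_eq_square del: coc.simps)
    also have "\<dots> \<le> (?U * (1 / \<eta>) ^ n / tv) * (C / (?U * ?V))"
      using U C_ge_1 by (intro mult_right_mono wedge_uq_bound) (auto simp del: coc.simps)
    also have "\<dots> = C / tv * (1 / \<eta>) ^ n / ?V"
      using U by (cases "u n z = 0") (simp_all del: coc.simps)
    finally show "\<bar>wedge (u n z) (q n z)\<bar> * (C * ?U * ?V) * (1 / ?U\<^sup>2) * (1 / ?V\<^sup>2) \<le> C / tv * (1 / \<eta>) ^ n / ?V" .
    have "2 * C ^ 4 * (\<Sum>m<n. norm (u m z)) \<le> 2 * C ^ 4 * (?U / (\<eta> - 1))"
      using C_ge_1 by (intro mult_left_mono sum_orbit_le w) auto
    moreover have "2 * K1 * ?V \<le> 2 * K1 * (C * ?U)"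
      using U K1_nonneg by (intro mult_left_mono) (auto simp del: coc.simps)
    ultimately show "2 * C ^ 4 * (\<Sum>m<n. norm (u m z)) + K2 * ?U + 2 * K1 * ?U + 2 * K1 * ?V \<le> K3 * ?U"
      by (simp add: K3_def algebra_simps del: coc.simps)
    show "0 \<le> K3 * ?U"
      using K1_nonneg C_ge_1 eta by (simp add: K3_def K2_def)
  qed
  have u0: "u n z \<noteq> 0" "u (Suc n) z \<noteq> 0" using U by (auto simp del: coc.simps)
  have "sig w \<xi> (Suc n) z - sig w \<xi> n z = - T z" unfolding T_def by (rule sig_diff[OF u0])
  moreover have "\<bar>T z\<bar> \<le> C / tv * (1 / \<eta>) ^ n / ?V"
    using T unfolding rel_deriv_bound_def by (auto simp del: coc.simps)
  ultimately show "\<bar>sig w \<xi> (Suc n) z - sig w \<xi> n z\<bar> \<le> C / tv * (1 / \<eta>) ^ n / ?V" by simp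
  obtain T' where T': "((\<lambda>a. T (z + a *\<^sub>R w)) has_real_derivative T') (at 0)"
    "\<bar>T'\<bar> \<le> C / tv * (1 / \<eta>) ^ n / ?V * (K3 * ?U)"
    using T unfolding rel_deriv_bound_def by blast
  \<comment> \<open>The closed form of the increment requires nonvanishing denominators. By
    continuity they do not vanish for a near 0, which is enough to compare derivatives at 0.\<close>
  have ev: "\<forall>\<^sub>F a in nhds 0. u n (z + a *\<^sub>R w) \<noteq> 0" if "u n z \<noteq> 0" for n
  proof -
    have "isCont (\<lambda>a. u n (z + a *\<^sub>R w)) 0"
      using has_vector_derivative_continuous[OF coc_line[of n z w w 0]] .
    then have "((\<lambda>a. u n (z + a *\<^sub>R w)) \<longlongrightarrow> u n (z + 0 *\<^sub>R w)) (at 0)"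
      unfolding isCont_def .
    then have "((\<lambda>a. u n (z + a *\<^sub>R w)) \<longlongrightarrow> u n z) (at 0)" by simp
    then have "\<forall>\<^sub>F a in at 0. u n (z + a *\<^sub>R w) \<noteq> 0" using that by (rule tendsto_imp_eventually_ne)
    then show ?thesis using that by (simp add: eventually_nhds_conv_at)
  qed
  have ev': "\<forall>\<^sub>F a in nhds 0. sig w \<xi> (Suc n) (z + a *\<^sub>R w) - sig w \<xi> n (z + a *\<^sub>R w) = - T (z + a *\<^sub>R w)"
    using ev[OF u0(1)] ev[OF u0(2)] by eventually_elim (unfold T_def, rule sig_diff)
  have D: "((\<lambda>a. sig w \<xi> (Suc n) (z + a *\<^sub>R w) - sig w \<xi> n (z + a *\<^sub>R w)) has_real_derivative (dsig w \<xi> (Suc n) z - dsig w \<xi> n z)) (at 0)"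
    by (intro DERIV_diff sig_line u0)
  have "((\<lambda>a. - T (z + a *\<^sub>R w)) has_real_derivative (dsig w \<xi> (Suc n) z - dsig w \<xi> n z)) (at 0)"
    by (rule iffD1[OF DERIV_cong_ev[OF refl ev' refl] D])
  from DERIV_unique[OF this DERIV_minus[OF T'(1)]]
  have "\<bar>dsig w \<xi> (Suc n) z - dsig w \<xi> n z\<bar> = \<bar>T'\<bar>" by simp
  also have "\<dots> \<le> C / tv * K3 * (1 / \<eta>) ^ n * (?U / ?V)" using T'(2) by (simp add: field_simps del: coc.simps)
  also have "C / tv * K3 * (1 / \<eta>) ^ n * (?U / ?V) \<le> C / tv * K3 * (1 / \<eta>) ^ n * 1"
  proof -
    have "?U / ?V \<le> 1" by (subst pos_divide_le_eq) (use U in linarith)+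
    then show ?thesis
    using U K1_nonneg C_ge_1 eta tv(1)
    by (intro mult_left_mono) (auto simp: K3_def K2_def simp del: coc.simps intro!: mult_nonneg_nonneg add_nonneg_nonneg)
  qed
  finally show "\<bar>dsig w \<xi> (Suc n) z - dsig w \<xi> n z\<bar> \<le> C / tv * K3 * (1 / \<eta>) ^ n" by simp
qed

end

section \<open>Exponential convergence and Lipschitz families\<close>

text \<open>The starting time m is free so that K may improve with it: \<open>sig_limit\<close>
  takes m = n and K proportional to 1 / |u_n|.\<close>

lemma geometric_limit:
  fixes f :: "nat \<Rightarrow> real"
  assumes step: "\<And>n. n \<ge> m \<Longrightarrow> \<bar>f (Suc n) - f n\<bar> \<le> K * q ^ n" and q: "0 \<le> q" "q < 1"
  shows "f \<longlonglongrightarrow> lim f" and "n \<ge> m \<Longrightarrow> \<bar>f n - lim f\<bar> \<le> K / (1 - q) * q ^ n"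
proof -
  \<comment> \<open>Keeping the factor 1 - q^k, the exact partial geometric sum, is what closes the
    induction over k.\<close>
  have tele: "\<bar>f (n + k) - f n\<bar> \<le> K / (1 - q) * (q ^ n * (1 - q ^ k))" if "n \<ge> m" for n k
  proof (induction k)
    case (Suc k)
    have "\<bar>f (n + Suc k) - f n\<bar> \<le> \<bar>f (Suc (n + k)) - f (n + k)\<bar> + \<bar>f (n + k) - f n\<bar>" by simp
    also have "\<dots> \<le> K * q ^ (n + k) + K / (1 - q) * (q ^ n * (1 - q ^ k))"
      using that by (intro add_mono step Suc) auto
    also have "\<dots> = K / (1 - q) * (q ^ n * (1 - q ^ Suc k))"
      using q by (simp add: field_simps power_add)
    finally show ?case .
  qed simp
  have K: "0 \<le> K / (1 - q) * q ^ n" if "n \<ge> m" for n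
  proof -
    have "0 \<le> K * q ^ n" using step[OF that] by linarith
    then show ?thesis using q by simp
  qed
  have bd: "\<bar>f (n + k) - f n\<bar> \<le> K / (1 - q) * q ^ n" if "n \<ge> m" for n k
  proof -
    have "K / (1 - q) * (q ^ n * (1 - q ^ k)) = K / (1 - q) * q ^ n - K / (1 - q) * q ^ n * q ^ k"
      by (simp add: algebra_simps)
    moreover have "0 \<le> K / (1 - q) * q ^ n * q ^ k"
      by (rule mult_nonneg_nonneg[OF K[OF that] zero_le_power[OF q(1)]])
    ultimately show ?thesis using tele[OF that, of k] by linarith
  qed
  have "Cauchy f"
    unfolding Cauchy_def
  proof (intro allI impI)
    fix e :: real assume "e > 0"
    have "(\<lambda>n. K / (1 - q) * q ^ n) \<longlonglongrightarrow> K / (1 - q) * 0"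
      using q by (intro tendsto_mult_left LIMSEQ_realpow_zero)
    then have "\<forall>\<^sub>F n in sequentially. K / (1 - q) * q ^ n < e / 2"
      using \<open>e > 0\<close> by (intro order_tendstoD(2)[of _ "0"]) auto
    then obtain N where N: "\<forall>n\<ge>N. K / (1 - q) * q ^ n < e / 2"
      unfolding eventually_sequentially by blast
    define M where "M = max m N"
    have M: "M \<ge> m" "K / (1 - q) * q ^ M < e / 2" using N by (auto simp: M_def)
    show "\<exists>M. \<forall>i\<ge>M. \<forall>j\<ge>M. dist (f i) (f j) < e"
    proof (intro exI[of _ M] allI impI)
      fix i j assume "M \<le> i" "M \<le> j"
      then have "\<bar>f i - f M\<bar> \<le> K / (1 - q) * q ^ M" "\<bar>f j - f M\<bar> \<le> K / (1 - q) * q ^ M"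
        using bd[OF M(1), of "i - M"] bd[OF M(1), of "j - M"] by auto
      then show "dist (f i) (f j) < e" using M(2) unfolding dist_real_def by linarith
    qed
  qed
  then show lim: "f \<longlonglongrightarrow> lim f"
    by (simp only: Cauchy_convergent_iff convergent_LIMSEQ_iff)
  assume n: "n \<ge> m"
  have "(\<lambda>k. \<bar>f (k + n) - f n\<bar>) \<longlonglongrightarrow> \<bar>lim f - f n\<bar>"
    by (intro tendsto_intros LIMSEQ_ignore_initial_segment lim)
  then have "\<bar>lim f - f n\<bar> \<le> K / (1 - q) * q ^ n"
    by (rule LIMSEQ_le_const2) (use bd[OF n] in \<open>auto simp: add.commute\<close>)
  then show "\<bar>f n - lim f\<bar> \<le> K / (1 - q) * q ^ n" by simp
qed

lemma uniform_limit_geometric: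
  fixes f :: "nat \<Rightarrow> 'a \<Rightarrow> real"
  assumes "\<And>n x. x \<in> S \<Longrightarrow> \<bar>f n x - g x\<bar> \<le> K * q ^ n" and q: "0 \<le> q" "q < 1"
  shows "uniform_limit S f g sequentially"
proof (rule uniform_limitI)
  fix e :: real assume "e > 0"
  have "(\<lambda>n. K * q ^ n) \<longlonglongrightarrow> K * 0"
    using q by (intro tendsto_mult_left LIMSEQ_realpow_zero)
  then have "\<forall>\<^sub>F n in sequentially. K * q ^ n < e"
    using \<open>e > 0\<close> by (intro order_tendstoD(2)[of _ "0"]) auto
  then show "\<forall>\<^sub>F n in sequentially. \<forall>x\<in>S. dist (f n x) (g x) < e"
  proof eventually_elim
    case (elim n)
    show ?case unfolding dist_real_def using assms(1)[of _ n] elim by (metis le_less_trans)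
  qed
qed

text \<open>Choose n with \<rho>^(n+1) < dist x y \<le> \<rho>^n for \<rho> = q / \<Lambda>. Then
  both the approximation error K q^n and the Lipschitz term M \<Lambda>^n dist x y are at most a
  multiple of q^n. The exponent is defined by \<rho>^\<alpha> = q, and 1 / q pays for passing from
  q^n to q^(n+1).\<close>

lemma holder_interpolation:
  fixes f :: "nat \<Rightarrow> 'a::metric_space \<Rightarrow> real"
  assumes q: "0 < q" "q < 1" and L: "1 \<le> \<Lambda>" and d: "dist x y \<le> 1"
    and fx: "\<And>n. \<bar>f n x - g x\<bar> \<le> K * q ^ n" and fy: "\<And>n. \<bar>f n y - g y\<bar> \<le> K * q ^ n"
    and fL: "\<And>n. \<bar>f n x - f n y\<bar> \<le> M * \<Lambda> ^ n * dist x y" and M: "0 \<le> M"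
  shows "\<bar>g x - g y\<bar> \<le> (2 * K + M) / q * dist x y powr (ln q / ln (q / \<Lambda>))"
proof (cases "x = y")
  case False
  define \<rho> where "\<rho> = q / \<Lambda>"
  define \<alpha> where "\<alpha> = ln q / ln \<rho>"
  have rho: "0 < \<rho>" "\<rho> < 1" using q L by (auto simp: \<rho>_def divide_simps)
  have d0: "0 < dist x y" using False by simp
  obtain n0 where n0: "\<rho> ^ n0 < dist x y" using real_arch_pow_inv[OF d0 rho(2)] by blast
  define N where "N = (LEAST n. \<rho> ^ n < dist x y)"
  have N: "\<rho> ^ N < dist x y" unfolding N_def using n0 by (rule LeastI)
  \<comment> \<open>Here dist x y \<le> 1 matters: at exponent 0 the power is 1, which is not below
    the distance, so a predecessor n exists.\<close>
  have "N \<noteq> 0" using N d by (cases N) auto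
  then obtain n where n: "N = Suc n" using not0_implies_Suc by blast
  have dn: "dist x y \<le> \<rho> ^ n"
    using not_less_Least[of n "\<lambda>n. \<rho> ^ n < dist x y"] n unfolding N_def by auto
  have K0: "0 \<le> K" using fx[of 0] by simp
  have "\<Lambda> ^ n * dist x y \<le> \<Lambda> ^ n * \<rho> ^ n" using dn L by (intro mult_left_mono) auto
  also have "\<dots> = q ^ n" using L by (simp add: \<rho>_def power_divide)
  finally have "M * (\<Lambda> ^ n * dist x y) \<le> M * q ^ n" using M by (rule mult_left_mono)
  then have "\<bar>g x - g y\<bar> \<le> (2 * K + M) * q ^ n"
    using fx[of n] fy[of n] fL[of n] by (simp add: algebra_simps)
  also have "\<dots> = (2 * K + M) / q * q ^ Suc n" using q by simp
  also have "\<dots> \<le> (2 * K + M) / q * dist x y powr \<alpha>"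
  proof (rule mult_left_mono)
    have a0: "\<alpha> \<ge> 0" unfolding \<alpha>_def using q rho by (simp add: divide_nonpos_nonpos)
    have "\<rho> powr \<alpha> = q" using rho q by (simp add: powr_def \<alpha>_def)
    have "(\<rho> ^ Suc n) powr \<alpha> = (\<rho> powr real (Suc n)) powr \<alpha>" by (subst powr_realpow[OF rho(1)]) simp
    also have "\<dots> = (\<rho> powr \<alpha>) powr real (Suc n)" unfolding powr_powr by (simp only: mult.commute)
    also have "\<dots> = q ^ Suc n" unfolding \<open>\<rho> powr \<alpha> = q\<close> by (rule powr_realpow[OF q(1)])
    finally have "q ^ Suc n = (\<rho> ^ Suc n) powr \<alpha>" ..
    also have "\<dots> \<le> dist x y powr \<alpha>" using N n rho a0 by (intro powr_mono2) auto
    finally show "q ^ Suc n \<le> dist x y powr \<alpha>" .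
    show "0 \<le> (2 * K + M) / q" using K0 M q by simp
  qed
  finally show ?thesis unfolding \<alpha>_def \<rho>_def .
qed auto

text \<open>Boundedness and Lipschitz constants growing at most exponentially in \<open>n\<close>, uniformly in the family index \<open>i\<close>.
  Uniformity is needed because the Hoelder exponent must not depend on the base point of the chart.\<close>

definition expo_lip :: "('i \<Rightarrow> 'a::metric_space set) \<Rightarrow> ('i \<Rightarrow> nat \<Rightarrow> 'a \<Rightarrow> 'b::real_normed_vector) \<Rightarrow> bool" where
  "expo_lip D f \<longleftrightarrow> (\<exists>K\<ge>0. \<exists>\<Lambda>\<ge>1. \<forall>i n. \<forall>x\<in>D i. \<forall>y\<in>D i.
     norm (f i n x) \<le> K * \<Lambda> ^ n \<and> norm (f i n x - f i n y) \<le> K * \<Lambda> ^ n * dist x y)"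

lemma expo_lipI:
  assumes "K \<ge> 0" "\<Lambda> \<ge> 1" "\<And>i n x. x \<in> D i \<Longrightarrow> norm (f i n x) \<le> K * \<Lambda> ^ n"
    "\<And>i n x y. x \<in> D i \<Longrightarrow> y \<in> D i \<Longrightarrow> norm (f i n x - f i n y) \<le> K * \<Lambda> ^ n * dist x y"
  shows "expo_lip D f"
  unfolding expo_lip_def using assms by blast

lemma expo_lipE:
  assumes "expo_lip D f"
  obtains K \<Lambda> where "K \<ge> 0" "\<Lambda> \<ge> 1" "\<And>i n x. x \<in> D i \<Longrightarrow> norm (f i n x) \<le> K * \<Lambda> ^ n"
    "\<And>i n x y. x \<in> D i \<Longrightarrow> y \<in> D i \<Longrightarrow> norm (f i n x - f i n y) \<le> K * \<Lambda> ^ n * dist x y"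
  using assms unfolding expo_lip_def by blast

text \<open>The difference of two products mixes sizes with Lipschitz constants, which is why
  \<open>expo_lip\<close> carries both. The growth rates multiply.\<close>

lemma expo_lip_bilinear:
  assumes bil: "bounded_bilinear prd" and f: "expo_lip D f" and g: "expo_lip D g"
  shows "expo_lip D (\<lambda>i n x. prd (f i n x) (g i n x))"
proof -
  interpret bounded_bilinear prd by (rule bil)
  obtain B where B: "B \<ge> 0" "\<And>a b. norm (prd a b) \<le> norm a * norm b * B" using nonneg_bounded by blast
  obtain K \<Lambda> where f: "K \<ge> 0" "\<Lambda> \<ge> 1" "\<And>i n x. x \<in> D i \<Longrightarrow> norm (f i n x) \<le> K * \<Lambda> ^ n"
    "\<And>i n x y. x \<in> D i \<Longrightarrow> y \<in> D i \<Longrightarrow> norm (f i n x - f i n y) \<le> K * \<Lambda> ^ n * dist x y"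
    by (rule expo_lipE[OF f]) (rule that)
  obtain L M where g: "L \<ge> 0" "M \<ge> 1" "\<And>i n x. x \<in> D i \<Longrightarrow> norm (g i n x) \<le> L * M ^ n"
    "\<And>i n x y. x \<in> D i \<Longrightarrow> y \<in> D i \<Longrightarrow> norm (g i n x - g i n y) \<le> L * M ^ n * dist x y"
    by (rule expo_lipE[OF g]) (rule that)
  have p: "0 \<le> K * \<Lambda> ^ n" "0 \<le> L * M ^ n" for n using f g by auto
  show ?thesis
  proof (rule expo_lipI[where K = "2 * K * L * B" and \<Lambda> = "\<Lambda> * M"])
    show "0 \<le> 2 * K * L * B" using f(1) g(1) B(1) by simp
    have "1 * 1 \<le> \<Lambda> * M" by (intro mult_mono f g) (use f in auto)
    then show "1 \<le> \<Lambda> * M" by simp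
    fix i n x assume x: "x \<in> D i"
    have "norm (prd (f i n x) (g i n x)) \<le> (K * \<Lambda> ^ n) * (L * M ^ n) * B"
      by (intro order_trans[OF B(2)] mult_right_mono mult_mono f(3) g(3) x p B(1)) auto
    moreover have "0 \<le> (K * \<Lambda> ^ n) * (L * M ^ n) * B" by (intro mult_nonneg_nonneg p B(1))
    ultimately have "norm (prd (f i n x) (g i n x)) \<le> 2 * ((K * \<Lambda> ^ n) * (L * M ^ n) * B)" by linarith
    then show "norm (prd (f i n x) (g i n x)) \<le> 2 * K * L * B * (\<Lambda> * M) ^ n"
      by (simp add: power_mult_distrib algebra_simps)
    fix y assume y: "y \<in> D i"
    have "prd (f i n x) (g i n x) - prd (f i n y) (g i n y)
        = prd (f i n x) (g i n x - g i n y) + prd (f i n x - f i n y) (g i n y)"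
      by (simp add: bilinear_simps)
    then have "norm (prd (f i n x) (g i n x) - prd (f i n y) (g i n y)) \<le>
        norm (prd (f i n x) (g i n x - g i n y)) + norm (prd (f i n x - f i n y) (g i n y))"
      by (metis norm_triangle_ineq)
    also have "\<dots> \<le> (K * \<Lambda> ^ n) * (L * M ^ n * dist x y) * B + (K * \<Lambda> ^ n * dist x y) * (L * M ^ n) * B"
      by (intro add_mono order_trans[OF B(2)] mult_right_mono mult_mono f(3,4) g(3,4) x y p B(1) mult_nonneg_nonneg) auto
    finally show "norm (prd (f i n x) (g i n x) - prd (f i n y) (g i n y)) \<le> 2 * K * L * B * (\<Lambda> * M) ^ n * dist x y"
      by (simp add: power_mult_distrib algebra_simps)
  qed
qed

lemma expo_lip_add:
  assumes f: "expo_lip D f" and g: "expo_lip D g"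
  shows "expo_lip D (\<lambda>i n x. f i n x + g i n x)"
proof -
  obtain K \<Lambda> where f: "K \<ge> 0" "\<Lambda> \<ge> 1" "\<And>i n x. x \<in> D i \<Longrightarrow> norm (f i n x) \<le> K * \<Lambda> ^ n"
    "\<And>i n x y. x \<in> D i \<Longrightarrow> y \<in> D i \<Longrightarrow> norm (f i n x - f i n y) \<le> K * \<Lambda> ^ n * dist x y"
    by (rule expo_lipE[OF f]) (rule that)
  obtain L M where g: "L \<ge> 0" "M \<ge> 1" "\<And>i n x. x \<in> D i \<Longrightarrow> norm (g i n x) \<le> L * M ^ n"
    "\<And>i n x y. x \<in> D i \<Longrightarrow> y \<in> D i \<Longrightarrow> norm (g i n x - g i n y) \<le> L * M ^ n * dist x y"
    by (rule expo_lipE[OF g]) (rule that)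
  have le: "K * \<Lambda> ^ n + L * M ^ n \<le> (K + L) * (max \<Lambda> M) ^ n" for n
    unfolding distrib_right using f g by (intro add_mono mult_left_mono power_mono) auto
  show ?thesis
  proof (rule expo_lipI[where K = "K + L" and \<Lambda> = "max \<Lambda> M"])
    show "0 \<le> K + L" "1 \<le> max \<Lambda> M" using f g by auto
    fix i n x assume x: "x \<in> D i"
    show "norm (f i n x + g i n x) \<le> (K + L) * max \<Lambda> M ^ n"
      by (intro order_trans[OF norm_triangle_ineq] order_trans[OF add_mono le] f(3) g(3) x)
    fix y assume y: "y \<in> D i"
    have "norm (f i n x + g i n x - (f i n y + g i n y)) \<le> norm (f i n x - f i n y) + norm (g i n x - g i n y)"
      by (rule norm_diff_triangle_ineq)
    also have "\<dots> \<le> K * \<Lambda> ^ n * dist x y + L * M ^ n * dist x y" by (intro add_mono f(4) g(4) x y)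
    also have "\<dots> \<le> (K + L) * max \<Lambda> M ^ n * dist x y"
      unfolding distrib_right[symmetric] by (intro mult_right_mono order_trans[OF _ le]) (auto simp: distrib_right)
    finally show "norm (f i n x + g i n x - (f i n y + g i n y)) \<le> (K + L) * max \<Lambda> M ^ n * dist x y" .
  qed
qed

lemma expo_lip_minus: "expo_lip D f \<Longrightarrow> expo_lip D (\<lambda>i n x. - f i n x)"
  unfolding expo_lip_def by (simp add: norm_minus_commute)

lemma expo_lip_const: "(\<And>i x. x \<in> D i \<Longrightarrow> norm (c i) \<le> B) \<Longrightarrow> expo_lip D (\<lambda>i n x. c i)"
  by (rule expo_lipI[where K = "max B 0" and \<Lambda> = 1]) (auto simp: le_max_iff_disj)

lemma expo_lip_zero: "expo_lip D (\<lambda>i n x. 0)"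
  by (rule expo_lipI[where K = 0 and \<Lambda> = 1]) auto

lemma expo_lip_inverse:
  fixes f :: "'i \<Rightarrow> nat \<Rightarrow> 'a::metric_space \<Rightarrow> real"
  assumes f: "expo_lip D f" and ge: "\<And>i n x. x \<in> D i \<Longrightarrow> 1 \<le> f i n x"
  shows "expo_lip D (\<lambda>i n x. inverse (f i n x))"
proof -
  obtain K \<Lambda> where f: "K \<ge> 0" "\<Lambda> \<ge> 1" "\<And>i n x. x \<in> D i \<Longrightarrow> norm (f i n x) \<le> K * \<Lambda> ^ n"
    "\<And>i n x y. x \<in> D i \<Longrightarrow> y \<in> D i \<Longrightarrow> norm (f i n x - f i n y) \<le> K * \<Lambda> ^ n * dist x y"
    by (rule expo_lipE[OF f]) (rule that)
  have 1: "1 \<le> \<Lambda> ^ n" for n using f(2) by (rule one_le_power)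
  show ?thesis
  proof (rule expo_lipI[where K = "K + 1" and \<Lambda> = \<Lambda>])
    fix i n x assume x: "x \<in> D i"
    have "1 * 1 \<le> (K + 1) * \<Lambda> ^ n" using f(1) 1 by (intro mult_mono) auto
    moreover have "norm (inverse (f i n x)) \<le> 1" using ge[OF x, of n] by (simp add: inverse_le_1_iff)
    ultimately show "norm (inverse (f i n x)) \<le> (K + 1) * \<Lambda> ^ n" by linarith
    fix y assume y: "y \<in> D i"
    have n: "1 \<le> f i n x" "1 \<le> f i n y" using ge x y by auto
    have "1 * 1 \<le> f i n x * f i n y" using n by (intro mult_mono) auto
    then have p: "1 \<le> f i n x * f i n y" by simp
    have "inverse (f i n x) - inverse (f i n y) = - (f i n x - f i n y) / (f i n x * f i n y)"
      using n by (simp add: field_simps)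
    then have "norm (inverse (f i n x) - inverse (f i n y)) = \<bar>f i n x - f i n y\<bar> / (f i n x * f i n y)"
      using p by (simp add: abs_divide abs_minus_commute)
    also have "\<dots> \<le> \<bar>f i n x - f i n y\<bar> / 1" using p by (intro divide_left_mono) auto
    also have "\<dots> \<le> K * \<Lambda> ^ n * dist x y" using f(4)[OF x y] by simp
    also have "\<dots> \<le> (K + 1) * \<Lambda> ^ n * dist x y" using 1[of n] by (intro mult_right_mono) auto
    finally show "norm (inverse (f i n x) - inverse (f i n y)) \<le> (K + 1) * \<Lambda> ^ n * dist x y" .
  qed (use f in auto)
qed

text \<open>A discrete Gronwall inequality. The base C + \<Lambda> dominates the rate of the
  recursion and that of its source at once; the optimal rate is irrelevant for
  interpolation.\<close>

lemma recursion_growth: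
  fixes r :: "nat \<Rightarrow> real"
  assumes "r 0 \<le> R" "\<And>n. r (Suc n) \<le> C * r n + K * \<Lambda> ^ n" "0 \<le> R" "0 \<le> C" "0 \<le> K" "1 \<le> \<Lambda>"
  shows "r n \<le> (R + K) * (C + \<Lambda>) ^ n"
proof (induction n)
  case 0
  then show ?case using assms by simp
next
  case (Suc n)
  have "r (Suc n) \<le> C * ((R + K) * (C + \<Lambda>) ^ n) + K * \<Lambda> ^ n"
    using assms(2)[of n] mult_left_mono[OF Suc assms(4)] by linarith
  also have "K * \<Lambda> ^ n \<le> (R + K) * (C + \<Lambda>) ^ n"
    using assms by (intro mult_mono power_mono) auto
  also have "C * ((R + K) * (C + \<Lambda>) ^ n) + (R + K) * (C + \<Lambda>) ^ n = (C + 1) * ((R + K) * (C + \<Lambda>) ^ n)"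
    by (simp add: algebra_simps)
  also have "\<dots> \<le> (C + \<Lambda>) * ((R + K) * (C + \<Lambda>) ^ n)"
    using assms by (intro mult_right_mono) auto
  finally show ?case by (simp add: mult_ac)
qed

text \<open>The coefficients need a bound C independent of n, since products of exponentially
  growing coefficients would grow faster than any exponential. \<open>recursion_growth\<close> is
  applied first to the sizes and then to the differences, whose source contains the sizes.\<close>

lemma expo_lip_recursion:
  fixes T :: "'i \<Rightarrow> nat \<Rightarrow> 'a::metric_space \<Rightarrow> 'b::real_normed_vector \<Rightarrow>\<^sub>L 'b" and X Y :: "'i \<Rightarrow> nat \<Rightarrow> 'a \<Rightarrow> 'b"
  assumes T: "expo_lip D T" and TC: "\<And>i n x. x \<in> D i \<Longrightarrow> norm (T i n x) \<le> C" and C0: "0 \<le> C"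
    and Y: "expo_lip D Y" and X0: "\<And>i x. X i 0 x = c i" "\<And>i x. x \<in> D i \<Longrightarrow> norm (c i) \<le> R" "0 \<le> R"
    and XS: "\<And>i n x. X i (Suc n) x = blinfun_apply (T i n x) (X i n x) + Y i n x"
  shows "expo_lip D X"
proof -
  obtain K \<Lambda> where T: "K \<ge> 0" "\<Lambda> \<ge> 1" "\<And>i n x y. x \<in> D i \<Longrightarrow> y \<in> D i \<Longrightarrow> norm (T i n x - T i n y) \<le> K * \<Lambda> ^ n * dist x y"
    by (rule expo_lipE[OF T]) (rule that)
  obtain L M where Y: "L \<ge> 0" "M \<ge> 1" "\<And>i n x. x \<in> D i \<Longrightarrow> norm (Y i n x) \<le> L * M ^ n"
    "\<And>i n x y. x \<in> D i \<Longrightarrow> y \<in> D i \<Longrightarrow> norm (Y i n x - Y i n y) \<le> L * M ^ n * dist x y"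
    by (rule expo_lipE[OF Y]) (rule that)
  have bd: "norm (X i n x) \<le> (R + L) * (C + M) ^ n" if x: "x \<in> D i" for i n x
  proof (rule recursion_growth[where r = "\<lambda>n. norm (X i n x)"])
    fix n
    have "norm (X i (Suc n) x) \<le> norm (T i n x) * norm (X i n x) + norm (Y i n x)"
      unfolding XS by (intro norm_triangle_le add_right_mono norm_blinfun)
    also have "\<dots> \<le> C * norm (X i n x) + L * M ^ n"
      by (intro add_mono mult_right_mono TC[OF x] Y(3)[OF x] norm_ge_zero)
    finally show "norm (X i (Suc n) x) \<le> C * norm (X i n x) + L * M ^ n" .
  qed (use X0(3) X0(2)[OF x] Y(1,2) C0 in \<open>auto simp: X0(1)\<close>)
  \<comment> \<open>Q exceeds both growth rates in the source of the difference recursion: \<Lambda>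
    (C + M) from the varying coefficient acting on X, and M from Y.\<close>
  define P Q where "P = K * (R + L) + L" and "Q = \<Lambda> * (C + M) + M"
  have P0: "0 \<le> P" using T(1) Y(1) X0(3) by (simp add: P_def)
  have LM1: "1 \<le> \<Lambda> * (C + M)"
    using mult_mono[of 1 \<Lambda> 1 "C + M"] T(1,2) Y(1,2) C0 by simp
  have Q1: "1 \<le> Q" using LM1 Y(1,2) by (simp add: Q_def)
  have lip: "norm (X i n x - X i n y) \<le> P * (C + Q) ^ n * dist x y" if x: "x \<in> D i" and y: "y \<in> D i" for i n x y
  proof -
    have "norm (X i n x - X i n y) \<le> (0 + P * dist x y) * (C + Q) ^ n"
    proof (rule recursion_growth[where r = "\<lambda>n. norm (X i n x - X i n y)"])
      fix n
      have "X i (Suc n) x - X i (Suc n) y = blinfun_apply (T i n x) (X i n x - X i n y)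
          + (blinfun_apply (T i n x - T i n y) (X i n y) + (Y i n x - Y i n y))"
        unfolding XS by (simp add: blinfun.bilinear_simps)
      then have "norm (X i (Suc n) x - X i (Suc n) y) \<le> norm (blinfun_apply (T i n x) (X i n x - X i n y))
          + (norm (blinfun_apply (T i n x - T i n y) (X i n y)) + norm (Y i n x - Y i n y))"
        by (simp only:) (rule order_trans[OF norm_triangle_ineq add_left_mono[OF norm_triangle_ineq]])
      also have "\<dots> \<le> C * norm (X i n x - X i n y) + ((K * \<Lambda> ^ n * dist x y) * ((R + L) * (C + M) ^ n) + L * M ^ n * dist x y)"
        using T(1,2) Y(1,2) C0
        by (intro add_mono order_trans[OF norm_blinfun] mult_mono TC T(3) x y bd Y(4)) auto
      also have "(K * \<Lambda> ^ n * dist x y) * ((R + L) * (C + M) ^ n) \<le> K * (R + L) * dist x y * Q ^ n"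
      proof -
        have "(\<Lambda> * (C + M)) ^ n \<le> Q ^ n" using LM1 Y(1,2) by (intro power_mono) (auto simp: Q_def)
        then have "K * (R + L) * dist x y * (\<Lambda> * (C + M)) ^ n \<le> K * (R + L) * dist x y * Q ^ n"
          using T(1) Y(1) X0(3) by (intro mult_left_mono) auto
        then show ?thesis by (simp add: power_mult_distrib mult_ac)
      qed
      also have "L * M ^ n * dist x y \<le> L * dist x y * Q ^ n"
      proof -
        have "M ^ n \<le> Q ^ n" using LM1 Y(1,2) by (intro power_mono) (auto simp: Q_def)
        then have "(L * dist x y) * M ^ n \<le> (L * dist x y) * Q ^ n" using Y(1) by (intro mult_left_mono) auto
        then show ?thesis by (simp add: mult_ac)
      qed
      finally show "norm (X i (Suc n) x - X i (Suc n) y) \<le> C * norm (X i n x - X i n y) + (P * dist x y) * Q ^ n"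
        by (simp add: P_def algebra_simps)
    qed (use X0(1,3) P0 C0 Q1 in auto)
    then show ?thesis by (simp add: mult_ac)
  qed
  have 1: "(R + L) * (C + M) ^ n \<le> (R + L + P) * (C + M + Q) ^ n" for n
    using X0(3) Y(1,2) C0 P0 Q1 by (intro mult_mono power_mono) auto
  have 2: "P * (C + Q) ^ n \<le> (R + L + P) * (C + M + Q) ^ n" for n
    using X0(3) Y(1,2) C0 P0 Q1 by (intro mult_mono power_mono) auto
  show ?thesis
  proof (rule expo_lipI[where K = "R + L + P" and \<Lambda> = "C + M + Q"])
    show "0 \<le> R + L + P" "1 \<le> C + M + Q" using X0(3) Y(1,2) P0 C0 Q1 by auto
    fix i n x assume x: "x \<in> D i"
    show "norm (X i n x) \<le> (R + L + P) * (C + M + Q) ^ n" by (rule order_trans[OF bd[OF x] 1])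
    fix y assume y: "y \<in> D i"
    show "norm (X i n x - X i n y) \<le> (R + L + P) * (C + M + Q) ^ n * dist x y"
      by (rule order_trans[OF lip[OF x y] mult_right_mono[OF 2]]) simp
  qed
qed

section \<open>The stable direction field\<close>

context cone_system
begin

lemma F_lipschitz: "dist (F n x) (F n y) \<le> C * dist x y"
proof -
  have "norm (F n x - F n y) \<le> C * norm (x - y)"
    by (rule differentiable_bound[OF convex_UNIV DF])
       (simp_all only: norm_blinfun.rep_eq[symmetric] norm_DF UNIV_I)
  then show ?thesis by (simp add: dist_norm)
qed

lemma DF_lipschitz: "norm (DF n x - DF n y) \<le> C * dist x y"
  unfolding dist_norm
  by (rule differentiable_bound[OF convex_UNIV D2F])
     (simp_all only: norm_blinfun.rep_eq[symmetric] norm_D2F UNIV_I)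

lemma orb_lipschitz: "dist (orb m n x) (orb m n y) \<le> C ^ n * dist x y"
proof (induction n)
  case (Suc n)
  have "dist (orb m (Suc n) x) (orb m (Suc n) y) \<le> C * dist (orb m n x) (orb m n y)"
    by (simp add: F_lipschitz)
  also have "\<dots> \<le> C * (C ^ n * dist x y)" using C_ge_1 by (intro mult_left_mono Suc) simp
  finally show ?case by (simp add: mult_ac)
qed simp

lemma orb_cont: "continuous_on UNIV (orb m n)"
  by (rule has_derivative_continuous_on[OF orb_deriv])

lemma DF_orb_cont: "continuous_on UNIV (\<lambda>x. DF n (orb m n x))"
proof -
  have "continuous_on UNIV (DF n)" by (rule has_derivative_continuous_on[OF D2F])
  then show ?thesis by (rule continuous_on_compose2[OF _ orb_cont]) simp
qed

lemma D2F_orb_cont: "continuous_on UNIV (\<lambda>x. D2F n (orb m n x))"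
  by (rule continuous_on_compose2[OF D2F_cont orb_cont]) auto

lemma coc_cont: "continuous_on UNIV (\<lambda>x. blinfun_apply (coc 0 n x) w)"
proof (induction n)
  case (Suc n)
  show ?case
    unfolding coc.simps blinfun_apply_blinfun_compose add_0 by (rule blinfun.continuous_on[OF DF_orb_cont Suc])
qed simp

lemma dcoc_cont: "continuous_on UNIV (\<lambda>x. dcoc w \<xi> n x)"
proof (induction n)
  case 0
  show ?case by simp
next
  case (Suc n)
  show ?case
    unfolding dcoc.simps
    by (rule continuous_on_add[OF blinfun.continuous_on[OF blinfun.continuous_on[OF D2F_orb_cont coc_cont] coc_cont]
      blinfun.continuous_on[OF DF_orb_cont Suc]])
qed

lemma sig_cont:
  assumes "\<And>x. x \<in> S \<Longrightarrow> blinfun_apply (coc 0 n x) w \<noteq> 0"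
  shows "continuous_on S (\<lambda>x. sig w \<xi> n x)" "continuous_on S (\<lambda>x. dsig w \<xi> n x)"
proof -
  have c: "continuous_on S (\<lambda>x. blinfun_apply (coc 0 n x) y)" "continuous_on S (\<lambda>x. dcoc w y n x)" for y
    by (rule continuous_on_subset[OF coc_cont subset_UNIV] continuous_on_subset[OF dcoc_cont subset_UNIV])+
  have nz: "\<forall>x\<in>S. blinfun_apply (coc 0 n x) w \<bullet> blinfun_apply (coc 0 n x) w \<noteq> 0"
    "\<forall>x\<in>S. (blinfun_apply (coc 0 n x) w \<bullet> blinfun_apply (coc 0 n x) w)\<^sup>2 \<noteq> 0"
    using assms by auto
  show "continuous_on S (\<lambda>x. sig w \<xi> n x)"
    unfolding sig_def by (intro continuous_on_divide continuous_on_minus continuous_on_inner c nz)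
  show "continuous_on S (\<lambda>x. dsig w \<xi> n x)"
    unfolding dsig_def Let_def
    by (intro continuous_on_divide continuous_on_minus continuous_on_add continuous_on_mult continuous_on_const
        continuous_on_power continuous_on_inner c nz)
qed

definition sigl :: "real^2 \<Rightarrow> real^2 \<Rightarrow> real^2 \<Rightarrow> real" where
  "sigl w \<xi> x = lim (\<lambda>n. sig w \<xi> n x)"

definition dsigl :: "real^2 \<Rightarrow> real^2 \<Rightarrow> real^2 \<Rightarrow> real" where
  "dsigl w \<xi> x = lim (\<lambda>n. dsig w \<xi> n x)"

definition "S1 = C / tv / (1 - 1 / \<eta>)"
definition "S2 = C / tv * K3 / (1 - 1 / \<eta>)"
definition "S3 = 1 / tv + S1"

lemma q_bounds: "0 < 1 / \<eta>" "0 \<le> 1 / \<eta>" "1 / \<eta> < 1" using eta by auto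

lemma S1_nonneg: "0 \<le> S1"
  using C_ge_1 tv(1) q_bounds(3) by (auto simp: S1_def intro!: divide_nonneg_nonneg)

text \<open>The first bound gains a factor |u_n|: in \<open>stable_direction\<close> the slope error
  multiplies the growing vector u_n, so convergence at rate \<eta>^-n alone would not give
  contraction.\<close>

lemma sig_limit:
  assumes w: "w \<in> cu z" "norm w = 1" "norm \<xi> = 1"
  shows "\<bar>sig w \<xi> n z - sigl w \<xi> z\<bar> * norm (blinfun_apply (coc 0 n z) w) \<le> S1 * (1 / \<eta>) ^ n"
    and "\<bar>sig w \<xi> n z - sigl w \<xi> z\<bar> \<le> S1 * (1 / \<eta>) ^ n"
    and "(\<lambda>n. sig w \<xi> n z) \<longlonglongrightarrow> sigl w \<xi> z"
    and "\<bar>dsig w \<xi> n z - dsigl w \<xi> z\<bar> \<le> S2 * (1 / \<eta>) ^ n"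
proof -
  interpret cone_line F G DF DG D2F C \<mu> \<eta> \<theta> h v w \<xi> z
    by unfold_locales (use w in auto)
  let ?U = "\<lambda>n. norm (u n z)"
  have mono: "?U n \<le> ?U m" if "n \<le> m" for n m
    using that by (rule lift_Suc_mono_le[of ?U, OF U_mono])
  \<comment> \<open>From time n on, every increment carries a factor at most 1 / |u_n|; freezing it
    leaves a geometric series with that constant in front.\<close>
  have step: "\<bar>sig w \<xi> (Suc m) z - sig w \<xi> m z\<bar> \<le> C / tv / ?U n * (1 / \<eta>) ^ m" if "n \<le> m" for n m
  proof -
    have "\<bar>sig w \<xi> (Suc m) z - sig w \<xi> m z\<bar> \<le> C / tv * (1 / \<eta>) ^ m / ?U (Suc m)" by (rule sig_step)
    also have "\<dots> \<le> C / tv * (1 / \<eta>) ^ m / ?U n"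
      using mono[of n "Suc m"] that U_ge_1[of n] C_ge_1 tv(1) eta by (intro frac_le) (auto simp del: coc.simps)
    finally show ?thesis by simp
  qed
  show lim: "(\<lambda>n. sig w \<xi> n z) \<longlonglongrightarrow> sigl w \<xi> z"
    unfolding sigl_def by (rule geometric_limit(1)[OF step[of 0] q_bounds(2,3)])
  have "\<bar>sig w \<xi> n z - sigl w \<xi> z\<bar> \<le> C / tv / ?U n / (1 - 1 / \<eta>) * (1 / \<eta>) ^ n"
    unfolding sigl_def by (rule geometric_limit(2)[OF step[of n] q_bounds(2,3)]) auto
  also have "C / tv / ?U n / (1 - 1 / \<eta>) * (1 / \<eta>) ^ n = S1 * (1 / \<eta>) ^ n / ?U n"
    by (simp add: S1_def)
  finally have *: "\<bar>sig w \<xi> n z - sigl w \<xi> z\<bar> \<le> S1 * (1 / \<eta>) ^ n / ?U n" .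
  have Upos: "0 < ?U n" using U_ge_1[of n] by linarith
  show 1: "\<bar>sig w \<xi> n z - sigl w \<xi> z\<bar> * ?U n \<le> S1 * (1 / \<eta>) ^ n"
    using * Upos by (simp add: pos_le_divide_eq)
  have "\<bar>sig w \<xi> n z - sigl w \<xi> z\<bar> * 1 \<le> \<bar>sig w \<xi> n z - sigl w \<xi> z\<bar> * ?U n"
    using U_ge_1[of n] by (intro mult_left_mono) auto
  from order_trans[OF this 1] show "\<bar>sig w \<xi> n z - sigl w \<xi> z\<bar> \<le> S1 * (1 / \<eta>) ^ n" by simp
  show "\<bar>dsig w \<xi> n z - dsigl w \<xi> z\<bar> \<le> S2 * (1 / \<eta>) ^ n"
    unfolding dsigl_def S2_def by (rule geometric_limit(2)[OF sig_step(2) q_bounds(2,3)]) auto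
qed

text \<open>With slope \<sigma>_n the image is orthogonal to u_n and has length |wedge(u_n, q_n)| /
  |u_n|, at most \<eta>^-n / \<open>tv\<close>. Passing to the limit slope adds the slope error
  times |u_n|. \<open>S3\<close> is the sum of the two constants.\<close>

lemma stable_direction:
  assumes w: "w \<in> cu z" "norm w = 1" "norm \<xi> = 1"
  shows "norm (blinfun_apply (coc 0 n z) (\<xi> + sigl w \<xi> z *\<^sub>R w)) \<le> S3 * (1 / \<eta>) ^ n"
proof -
  interpret cone_line F G DF DG D2F C \<mu> \<eta> \<theta> h v w \<xi> z
    by unfold_locales (use w in auto)
  let ?U = "norm (u n z)" and ?r = "q n z + sig w \<xi> n z *\<^sub>R u n z"
  have Upos: "0 < ?U" using U_ge_1[of n] by linarith
  have uu: "u n z \<bullet> u n z \<noteq> 0" using Upos by auto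
  define c d where "c = (u n z \<bullet> q n z) / (u n z \<bullet> u n z)" and "d = wedge (u n z) (q n z) / (u n z \<bullet> u n z)"
  have s: "sig w \<xi> n z = - c" unfolding sig_def c_def by (simp add: inner_commute)
  have eq: "q n z = c *\<^sub>R u n z + d *\<^sub>R rot (u n z)"
  proof -
    have "q n z = (1 / (u n z \<bullet> u n z)) *\<^sub>R ((u n z \<bullet> u n z) *\<^sub>R q n z)" using uu by simp
    then show ?thesis unfolding rot_decompose c_def d_def by (simp add: scaleR_add_right)
  qed
  have "?r = d *\<^sub>R rot (u n z)"
    unfolding s by (subst eq) simp
  then have "norm ?r = \<bar>wedge (u n z) (q n z)\<bar> / ?U\<^sup>2 * ?U"
    by (simp add: dot_square_norm d_def)
  also have "\<dots> = \<bar>wedge (u n z) (q n z)\<bar> / ?U" using Upos by (simp add: power2_eq_square)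
  also have "\<dots> \<le> (?U * (1 / \<eta>) ^ n / tv) / ?U" by (intro divide_right_mono wedge_uq_bound) simp
  also have "\<dots> = 1 / tv * (1 / \<eta>) ^ n" using Upos by simp
  finally have r: "norm ?r \<le> 1 / tv * (1 / \<eta>) ^ n" .
  have "blinfun_apply (coc 0 n z) (\<xi> + sigl w \<xi> z *\<^sub>R w) = ?r - (sig w \<xi> n z - sigl w \<xi> z) *\<^sub>R u n z"
    by (simp add: blinfun.bilinear_simps scaleR_left_diff_distrib)
  then have "norm (blinfun_apply (coc 0 n z) (\<xi> + sigl w \<xi> z *\<^sub>R w)) \<le> norm ?r + \<bar>sig w \<xi> n z - sigl w \<xi> z\<bar> * ?U"
    by (metis norm_triangle_ineq4 norm_scaleR)
  also have "\<dots> \<le> 1 / tv * (1 / \<eta>) ^ n + S1 * (1 / \<eta>) ^ n"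
    by (rule add_mono[OF r sig_limit(1)[OF assms]])
  finally show ?thesis by (simp add: S3_def algebra_simps)
qed

text \<open>Limits and derivatives commute because the derivatives along w converge uniformly on a
  short segment through z, which stays in S as S is open.\<close>

lemma sigl_regular:
  assumes S: "open S" "\<And>x. x \<in> S \<Longrightarrow> w \<in> cu x" and w: "norm w = 1" "norm \<xi> = 1"
  shows "continuous_on S (sigl w \<xi>)" "continuous_on S (dsigl w \<xi>)"
    and "z \<in> S \<Longrightarrow> ((\<lambda>a. sigl w \<xi> (z + a *\<^sub>R w)) has_real_derivative dsigl w \<xi> z) (at 0)"
proof -
  have nz: "blinfun_apply (coc 0 n x) w \<noteq> 0" if "x \<in> S" for n x
  proof -
    interpret cone_line F G DF DG D2F C \<mu> \<eta> \<theta> h v w \<xi> x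
      by unfold_locales (use w S(2)[OF that] in auto)
    show ?thesis using U_ge_1[of n] by auto
  qed
  have u1: "uniform_limit S (\<lambda>n. sig w \<xi> n) (sigl w \<xi>) sequentially"
    by (rule uniform_limit_geometric[OF sig_limit(2) q_bounds(2,3)]) (use S w in auto)
  have u2: "uniform_limit S (\<lambda>n. dsig w \<xi> n) (dsigl w \<xi>) sequentially"
    by (rule uniform_limit_geometric[OF sig_limit(4) q_bounds(2,3)]) (use S w in auto)
  show "continuous_on S (sigl w \<xi>)"
    by (rule uniform_limit_theorem[OF _ u1]) (use sig_cont(1)[OF nz] in auto)
  show "continuous_on S (dsigl w \<xi>)"
    by (rule uniform_limit_theorem[OF _ u2]) (use sig_cont(2)[OF nz] in auto)
  assume z: "z \<in> S"
  obtain e where e: "e > 0" "ball z e \<subseteq> S" using S(1) z open_contains_ball by blast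
  define I where "I = {-e<..<e}"
  have inS: "z + a *\<^sub>R w \<in> S" if "a \<in> I" for a
    using that e(2) w(1) by (auto simp: I_def dist_norm subset_iff)
  have der: "((\<lambda>a. sig w \<xi> n (z + a *\<^sub>R w)) has_derivative (\<lambda>t. t * dsig w \<xi> n (z + a *\<^sub>R w))) (at a within I)"
    if "a \<in> I" for n a
  proof -
    interpret cone_line F G DF DG D2F C \<mu> \<eta> \<theta> h v w \<xi> "z + a *\<^sub>R w"
      by unfold_locales (use w S(2)[OF inS[OF that]] in auto)
    have "((\<lambda>b. sig w \<xi> n (z + a *\<^sub>R w + b *\<^sub>R w)) has_real_derivative dsig w \<xi> n (z + a *\<^sub>R w)) (at 0)"
      by (rule sig_line[OF nz[OF inS[OF that]]])
    then have "((\<lambda>b. sig w \<xi> n (z + (a + b) *\<^sub>R w)) has_real_derivative dsig w \<xi> n (z + a *\<^sub>R w)) (at 0)"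
      by (simp only: scaleR_add_left add.assoc)
    then have "((\<lambda>b. sig w \<xi> n (z + b *\<^sub>R w)) has_real_derivative dsig w \<xi> n (z + a *\<^sub>R w)) (at a)"
      using DERIV_shift[of "\<lambda>b. sig w \<xi> n (z + b *\<^sub>R w)" _ 0 a] by (simp add: add.commute)
    then have "((\<lambda>b. sig w \<xi> n (z + b *\<^sub>R w)) has_derivative (\<lambda>t. t * dsig w \<xi> n (z + a *\<^sub>R w))) (at a)"
      by (simp only: has_field_derivative_def mult_commute_abs)
    then show ?thesis by (rule has_derivative_at_withinI)
  qed
  have "\<exists>g. \<forall>a\<in>I. (\<lambda>n. sig w \<xi> n (z + a *\<^sub>R w)) \<longlonglongrightarrow> g a \<and>
      (g has_derivative (\<lambda>t. t * dsigl w \<xi> (z + a *\<^sub>R w))) (at a within I)"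
  proof (rule has_derivative_sequence[OF _ der])
    show "convex I" by (simp add: I_def)
    show "0 \<in> I" using e by (simp add: I_def)
    show "(\<lambda>n. sig w \<xi> n (z + 0 *\<^sub>R w)) \<longlonglongrightarrow> sigl w \<xi> z"
      using sig_limit(3)[OF S(2)[OF z] w] by simp
    fix d :: real assume "d > 0"
    with u2 have "\<forall>\<^sub>F n in sequentially. \<forall>x\<in>S. dist (dsig w \<xi> n x) (dsigl w \<xi> x) < d"
      by (rule uniform_limitD)
    then show "\<forall>\<^sub>F n in sequentially. \<forall>a\<in>I. \<forall>t. norm (t * dsig w \<xi> n (z + a *\<^sub>R w) - t * dsigl w \<xi> (z + a *\<^sub>R w)) \<le> d * norm t"
    proof eventually_elim
      case (elim n)
      show ?case
      proof (intro ballI allI)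
        fix a t assume "a \<in> I"
        then have "\<bar>dsig w \<xi> n (z + a *\<^sub>R w) - dsigl w \<xi> (z + a *\<^sub>R w)\<bar> \<le> d"
          using elim inS by (auto simp: dist_real_def intro: less_imp_le)
        then have "\<bar>t\<bar> * \<bar>dsig w \<xi> n (z + a *\<^sub>R w) - dsigl w \<xi> (z + a *\<^sub>R w)\<bar> \<le> \<bar>t\<bar> * d"
          by (intro mult_left_mono) auto
        then show "norm (t * dsig w \<xi> n (z + a *\<^sub>R w) - t * dsigl w \<xi> (z + a *\<^sub>R w)) \<le> d * norm t"
          by (simp add: right_diff_distrib[symmetric] abs_mult mult.commute)
      qed
    qed
  qed
  then obtain g where g: "\<And>a. a \<in> I \<Longrightarrow> (\<lambda>n. sig w \<xi> n (z + a *\<^sub>R w)) \<longlonglongrightarrow> g a"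
    "\<And>a. a \<in> I \<Longrightarrow> (g has_derivative (\<lambda>t. t * dsigl w \<xi> (z + a *\<^sub>R w))) (at a within I)" by blast
  have geq: "g a = sigl w \<xi> (z + a *\<^sub>R w)" if "a \<in> I" for a
    by (rule LIMSEQ_unique[OF g(1)[OF that] sig_limit(3)[OF S(2)[OF inS[OF that]] w]])
  have I0: "0 \<in> I" "open I" using e by (auto simp: I_def)
  have "(g has_derivative (\<lambda>t. t * dsigl w \<xi> z)) (at 0)"
    using g(2)[OF I0(1)] at_within_open[OF I0] by simp
  then have "((\<lambda>a. sigl w \<xi> (z + a *\<^sub>R w)) has_derivative (\<lambda>t. t * dsigl w \<xi> z)) (at 0)"
    by (rule has_derivative_transform_within_open[OF _ I0(2) I0(1)]) (rule geq)
  then show "((\<lambda>a. sigl w \<xi> (z + a *\<^sub>R w)) has_real_derivative dsigl w \<xi> z) (at 0)"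
    by (simp only: has_field_derivative_def mult_commute_abs)
qed

section \<open>Hoelder continuity of the stable slope and of its derivative\<close>

definition unstable_frames :: "(real^2) \<times> (real^2) \<Rightarrow> (real^2) set" where
  "unstable_frames i = {x. fst i \<in> cu x \<and> norm (fst i) = 1 \<and> norm (snd i) = 1}"

lemma expo_lip_DF: "expo_lip D (\<lambda>i n x. DF n (orb 0 n x))"
proof (rule expo_lipI[where K = C and \<Lambda> = C])
  have 1: "1 \<le> C ^ n" for n using C_ge_1 by (intro one_le_power) simp
  fix i n x y
  have "C * 1 \<le> C * C ^ n" using 1[of n] C_ge_1 by (intro mult_left_mono) auto
  then show "norm (DF n (orb 0 n x)) \<le> C * C ^ n"
    using norm_DF[of n "orb 0 n x"] by linarith
  show "norm (DF n (orb 0 n x) - DF n (orb 0 n y)) \<le> C * C ^ n * dist x y"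
    unfolding mult.assoc using C_ge_1 orb_lipschitz[of 0 n x y]
    by (intro order_trans[OF DF_lipschitz[of n "orb 0 n x" "orb 0 n y"]] mult_left_mono) auto
qed (use C_ge_1 in auto)

lemma expo_lip_coc:
  assumes "\<And>i x. x \<in> D i \<Longrightarrow> norm (c i) \<le> 1"
  shows "expo_lip D (\<lambda>i n x. blinfun_apply (coc 0 n x) (c i))"
  by (rule expo_lip_recursion[OF expo_lip_DF _ _ expo_lip_zero, where C = C and R = 1 and c = c])
     (use assms norm_DF C_ge_1 in auto)

context
  fixes L :: real
  assumes D2F_lip: "\<And>n x y. norm (D2F n x - D2F n y) \<le> L * dist x y"
begin

text \<open>The C^3 bound acts solely through the Lipschitz constant L of the second derivatives. No
  sign of L is assumed, hence its absolute value in the constant.\<close>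

lemma expo_lip_D2F: "expo_lip D (\<lambda>i n x. D2F n (orb 0 n x))"
proof (rule expo_lipI[where K = "C + \<bar>L\<bar>" and \<Lambda> = C])
  have 1: "1 \<le> C ^ n" for n using C_ge_1 by (intro one_le_power) simp
  fix i n x y
  have "C * 1 \<le> (C + \<bar>L\<bar>) * C ^ n" using C_ge_1 1 by (intro mult_mono) auto
  then show "norm (D2F n (orb 0 n x)) \<le> (C + \<bar>L\<bar>) * C ^ n"
    using norm_D2F[of n "orb 0 n x"] by linarith
  have "norm (D2F n (orb 0 n x) - D2F n (orb 0 n y)) \<le> L * dist (orb 0 n x) (orb 0 n y)" by (rule D2F_lip)
  also have "\<dots> \<le> (C + \<bar>L\<bar>) * (C ^ n * dist x y)"
    using C_ge_1 by (intro mult_mono orb_lipschitz) auto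
  finally show "norm (D2F n (orb 0 n x) - D2F n (orb 0 n y)) \<le> (C + \<bar>L\<bar>) * C ^ n * dist x y"
    by (simp add: mult.assoc)
qed (use C_ge_1 in auto)

lemma expo_lip_dcoc:
  assumes "\<And>i x. x \<in> D i \<Longrightarrow> norm (c i) \<le> 1" "\<And>i x. x \<in> D i \<Longrightarrow> norm (d i) \<le> 1"
  shows "expo_lip D (\<lambda>i n x. dcoc (c i) (d i) n x)"
proof (rule expo_lip_recursion[OF expo_lip_DF, where C = C and R = 0 and c = "\<lambda>i. 0"])
  show "expo_lip D (\<lambda>i n x. blinfun_apply (blinfun_apply (D2F n (orb 0 n x)) (blinfun_apply (coc 0 n x) (c i)))
      (blinfun_apply (coc 0 n x) (d i)))"
    by (intro expo_lip_bilinear[OF bounded_bilinear_blinfun_apply] expo_lip_D2F expo_lip_coc assms)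
qed (use norm_DF C_ge_1 in auto)

text \<open>Both functions are polynomials in cocycle values, their derivatives and the inverse of
  |u_n|^2, which is at least 1 on the cone. The frame (w, \<xi>) is the family index, so the
  constants are the same for all frames and all base points.\<close>

lemma expo_lip_sig:
  shows "expo_lip unstable_frames (\<lambda>i. sig (fst i) (snd i))"
    and "expo_lip unstable_frames (\<lambda>i. dsig (fst i) (snd i))"
proof -
  let ?D = unstable_frames
  have n: "x \<in> ?D i \<Longrightarrow> norm (fst i) \<le> 1" "x \<in> ?D i \<Longrightarrow> norm (snd i) \<le> 1" for i x
    by (auto simp: unstable_frames_def)
  have inn: "expo_lip ?D f \<Longrightarrow> expo_lip ?D g \<Longrightarrow> expo_lip ?D (\<lambda>i n x. f i n x \<bullet> g i n x)"
    for f g :: "(real^2) \<times> (real^2) \<Rightarrow> nat \<Rightarrow> real^2 \<Rightarrow> real^2"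
    by (rule expo_lip_bilinear[OF bounded_bilinear_inner])
  have mul: "expo_lip ?D f \<Longrightarrow> expo_lip ?D g \<Longrightarrow> expo_lip ?D (\<lambda>i n x. f i n x * g i n x)"
    for f g :: "(real^2) \<times> (real^2) \<Rightarrow> nat \<Rightarrow> real^2 \<Rightarrow> real"
    by (rule expo_lip_bilinear[OF bounded_bilinear_mult])
  let ?u = "\<lambda>(i::(real^2) \<times> (real^2)) n x. blinfun_apply (coc 0 n x) (fst i)"
    and ?q = "\<lambda>(i::(real^2) \<times> (real^2)) n x. blinfun_apply (coc 0 n x) (snd i)"
  let ?u' = "\<lambda>(i::(real^2) \<times> (real^2)) n x. dcoc (fst i) (fst i) n x"
    and ?q' = "\<lambda>(i::(real^2) \<times> (real^2)) n x. dcoc (fst i) (snd i) n x"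
  have u: "expo_lip ?D ?u" and q: "expo_lip ?D ?q" and u': "expo_lip ?D ?u'" and q': "expo_lip ?D ?q'"
    by (rule expo_lip_coc expo_lip_dcoc; use n in blast)+
  have ge: "1 \<le> ?u i n x \<bullet> ?u i n x" if "x \<in> ?D i" for i n x
  proof -
    interpret cone_line F G DF DG D2F C \<mu> \<eta> \<theta> h v "fst i" "snd i" x
      by unfold_locales (use that in \<open>auto simp: unstable_frames_def\<close>)
    show ?thesis using one_le_power[OF U_ge_1[of n], of 2] by (simp add: dot_square_norm)
  qed
  let ?v = "\<lambda>(i::(real^2) \<times> (real^2)) n x. inverse (?u i n x \<bullet> ?u i n x)"
  have v: "expo_lip ?D ?v" by (rule expo_lip_inverse[OF inn[OF u u] ge])
  have "expo_lip ?D (\<lambda>i n x. - (?q i n x \<bullet> ?u i n x) * ?v i n x)"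
    by (rule mul[OF expo_lip_minus[OF inn[OF q u]] v])
  then show "expo_lip ?D (\<lambda>i. sig (fst i) (snd i))"
    unfolding sig_def[abs_def] divide_inverse .
  have two: "expo_lip ?D (\<lambda>i n x. 2::real)" by (rule expo_lip_const[where B = 2]) simp
  have "expo_lip ?D (\<lambda>i n x. - ((?q i n x \<bullet> ?u' i n x + ?q' i n x \<bullet> ?u i n x) * ?v i n x) +
     (?q i n x \<bullet> ?u i n x) * (2 * (?u i n x \<bullet> ?u' i n x)) * (?v i n x * ?v i n x))"
    by (intro expo_lip_add expo_lip_minus mul inn u q u' q' v two)
  then show "expo_lip ?D (\<lambda>i. dsig (fst i) (snd i))"
    unfolding dsig_def[abs_def] Let_def divide_inverse power2_eq_square inverse_mult_distrib .
qed

text \<open>Interpolation with the larger of the two growth rates gives one exponent for slope and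
  derivative. The exponent and the constant are fixed before the frame and the points, so all charts
  can share them.\<close>

lemma sigl_holder:
  "\<exists>\<alpha> K. 0 < \<alpha> \<and> \<alpha> \<le> 1 \<and> 0 \<le> K \<and> (\<forall>w \<xi> x y. norm w = 1 \<longrightarrow> norm \<xi> = 1 \<longrightarrow> w \<in> cu x \<longrightarrow> w \<in> cu y \<longrightarrow> dist x y \<le> 1 \<longrightarrow>
     \<bar>sigl w \<xi> x - sigl w \<xi> y\<bar> \<le> K * dist x y powr \<alpha> \<and> \<bar>dsigl w \<xi> x - dsigl w \<xi> y\<bar> \<le> K * dist x y powr \<alpha>)"
proof -
  obtain K1' \<Lambda>1 where 1: "K1' \<ge> 0" "\<Lambda>1 \<ge> 1" "\<And>i n x y. x \<in> unstable_frames i \<Longrightarrow> y \<in> unstable_frames i \<Longrightarrow>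
      norm (sig (fst i) (snd i) n x - sig (fst i) (snd i) n y) \<le> K1' * \<Lambda>1 ^ n * dist x y"
    by (rule expo_lipE[OF expo_lip_sig(1)]) (rule that)
  obtain K2' \<Lambda>2 where 2: "K2' \<ge> 0" "\<Lambda>2 \<ge> 1" "\<And>i n x y. x \<in> unstable_frames i \<Longrightarrow> y \<in> unstable_frames i \<Longrightarrow>
      norm (dsig (fst i) (snd i) n x - dsig (fst i) (snd i) n y) \<le> K2' * \<Lambda>2 ^ n * dist x y"
    by (rule expo_lipE[OF expo_lip_sig(2)]) (rule that)
  define \<Lambda> where "\<Lambda> = max \<Lambda>1 \<Lambda>2"
  define q where "q = 1 / \<eta>"
  have q: "0 < q" "q < 1" using q_bounds by (auto simp: q_def)
  have L: "1 \<le> \<Lambda>" using 1(2) by (simp add: \<Lambda>_def)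
  define \<alpha> where "\<alpha> = ln q / ln (q / \<Lambda>)"
  define K where "K = max ((2 * S1 + K1') / q) ((2 * S2 + K2') / q)"
  have lnq: "ln q < 0" using q by simp
  have lnL: "ln (q / \<Lambda>) = ln q - ln \<Lambda>" using q L by (simp add: ln_div)
  have "0 \<le> ln \<Lambda>" using L by simp
  then have a: "0 < \<alpha>" "\<alpha> \<le> 1"
    using lnq unfolding \<alpha>_def lnL by (auto simp: divide_neg_neg neg_divide_le_eq)
  have "0 \<le> (2 * S1 + K1') / q" using S1_nonneg 1(1) q by simp
  then have K: "0 \<le> K" by (simp add: K_def le_max_iff_disj)
  show ?thesis
  proof (rule exI[of _ \<alpha>], rule exI[of _ K], intro conjI allI impI a K)
    fix w \<xi> x y :: "real^2"
    assume as: "norm w = 1" "norm \<xi> = 1" "w \<in> cu x" "w \<in> cu y" and d: "dist x y \<le> 1"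
    have D: "x \<in> unstable_frames (w, \<xi>)" "y \<in> unstable_frames (w, \<xi>)"
      using as by (auto simp: unstable_frames_def)
    have sig_lip: "\<bar>sig w \<xi> n x - sig w \<xi> n y\<bar> \<le> K1' * \<Lambda> ^ n * dist x y" for n
    proof -
      have "\<bar>sig w \<xi> n x - sig w \<xi> n y\<bar> \<le> K1' * \<Lambda>1 ^ n * dist x y"
        using 1(3)[OF D, of n] by simp
      also have "\<dots> \<le> K1' * \<Lambda> ^ n * dist x y"
        using 1(1,2) by (intro mult_right_mono mult_left_mono power_mono) (auto simp: \<Lambda>_def)
      finally show ?thesis .
    qed
    have dsig_lip: "\<bar>dsig w \<xi> n x - dsig w \<xi> n y\<bar> \<le> K2' * \<Lambda> ^ n * dist x y" for n
    proof -
      have "\<bar>dsig w \<xi> n x - dsig w \<xi> n y\<bar> \<le> K2' * \<Lambda>2 ^ n * dist x y"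
        using 2(3)[OF D, of n] by simp
      also have "\<dots> \<le> K2' * \<Lambda> ^ n * dist x y"
        using 2(1,2) by (intro mult_right_mono mult_left_mono power_mono) (auto simp: \<Lambda>_def)
      finally show ?thesis .
    qed
    have "\<bar>sigl w \<xi> x - sigl w \<xi> y\<bar> \<le> (2 * S1 + K1') / q * dist x y powr \<alpha>"
      unfolding \<alpha>_def
      by (rule holder_interpolation[OF q L d _ _ sig_lip 1(1)]; unfold q_def; rule sig_limit(2); fact as)
    also have "\<dots> \<le> K * dist x y powr \<alpha>" by (intro mult_right_mono) (auto simp: K_def)
    finally show "\<bar>sigl w \<xi> x - sigl w \<xi> y\<bar> \<le> K * dist x y powr \<alpha>" .
    have "\<bar>dsigl w \<xi> x - dsigl w \<xi> y\<bar> \<le> (2 * S2 + K2') / q * dist x y powr \<alpha>"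
      unfolding \<alpha>_def
      by (rule holder_interpolation[OF q L d _ _ dsig_lip 2(1)]; unfold q_def; rule sig_limit(4); fact as)
    also have "\<dots> \<le> K * dist x y powr \<alpha>" by (intro mult_right_mono) (auto simp: K_def)
    finally show "\<bar>dsigl w \<xi> x - dsigl w \<xi> y\<bar> \<le> K * dist x y powr \<alpha>" .
  qed
qed

end

end

section \<open>Flow of a scalar differential equation\<close>

text \<open>Squaring avoids differentiating an absolute value: f^2 times exp (-2 L t) decreases and
  f^2 times exp (2 L t) increases. The two cases compare forwards and backwards in time.\<close>

lemma gronwall_comparison:
  fixes f f' :: "real \<Rightarrow> real"
  assumes der: "\<And>t. t \<in> {l..u} \<Longrightarrow> (f has_real_derivative f' t) (at t within {l..u})"
    and bd: "\<And>t. t \<in> {l..u} \<Longrightarrow> \<bar>f' t\<bar> \<le> L * \<bar>f t\<bar>"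
    and t: "t \<in> {l..u}" "t' \<in> {l..u}"
  shows "\<bar>f t\<bar> \<le> exp (L * \<bar>t - t'\<bar>) * \<bar>f t'\<bar>"
proof -
  have cont: "continuous_on {l..u} f"
    using der by (meson DERIV_continuous_on)
  have ff: "\<bar>2 * (f x * f' x)\<bar> \<le> 2 * (L * (f x)\<^sup>2)" if "x \<in> {l..u}" for x
  proof -
    have "\<bar>f x\<bar> * \<bar>f' x\<bar> \<le> \<bar>f x\<bar> * (L * \<bar>f x\<bar>)" by (intro mult_left_mono bd that) simp
    then show ?thesis by (simp add: abs_mult power2_eq_square mult_ac)
  qed
  have at: "(f has_real_derivative f' x) (at x)" if "x \<in> {l<..<u}" for x
    using der[of x] at_within_Icc_at[of l x u] that by simp
  have D: "((\<lambda>x. (f x)\<^sup>2 * exp (c * x)) has_real_derivative (2 * (f x * f' x) + c * (f x)\<^sup>2) * exp (c * x)) (at x)"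
    if "x \<in> {l<..<u}" for x c
    using at[OF that] by (auto intro!: derivative_eq_intros simp: algebra_simps power2_eq_square)
  have le: "(f t)\<^sup>2 \<le> exp (2 * L * \<bar>t - t'\<bar>) * (f t')\<^sup>2"
  proof (cases "t' \<le> t")
    case True
    have "(f t)\<^sup>2 * exp (- (2 * L) * t) \<le> (f t')\<^sup>2 * exp (- (2 * L) * t')"
    proof (rule DERIV_nonpos_imp_decreasing_open[OF True])
      fix x assume x: "t' < x" "x < t"
      then have x': "x \<in> {l<..<u}" using t by auto
      have "2 * (f x * f' x) + - (2 * L) * (f x)\<^sup>2 \<le> 0" using ff[of x] x' by auto
      then have "(2 * (f x * f' x) + - (2 * L) * (f x)\<^sup>2) * exp (- (2 * L) * x) \<le> 0"
        by (intro mult_nonpos_nonneg) auto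
      with D[OF x'] show "\<exists>y. ((\<lambda>x. (f x)\<^sup>2 * exp (- (2 * L) * x)) has_real_derivative y) (at x) \<and> y \<le> 0"
        by blast
    qed (use t in \<open>auto intro!: continuous_intros continuous_on_subset[OF cont]\<close>)
    from mult_right_mono[OF this, of "exp (2 * L * t)"] show ?thesis
      using True by (simp add: mult.assoc exp_add[symmetric] algebra_simps)
  next
    case False
    then have le: "t \<le> t'" by simp
    have "(f t)\<^sup>2 * exp (2 * L * t) \<le> (f t')\<^sup>2 * exp (2 * L * t')"
    proof (rule DERIV_nonneg_imp_increasing_open[OF le])
      fix x assume x: "t < x" "x < t'"
      then have x': "x \<in> {l<..<u}" using t by auto
      have "0 \<le> 2 * (f x * f' x) + (2 * L) * (f x)\<^sup>2" using ff[of x] x' by auto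
      then have "0 \<le> (2 * (f x * f' x) + (2 * L) * (f x)\<^sup>2) * exp (2 * L * x)"
        by (intro mult_nonneg_nonneg) auto
      with D[OF x'] show "\<exists>y. ((\<lambda>x. (f x)\<^sup>2 * exp (2 * L * x)) has_real_derivative y) (at x) \<and> 0 \<le> y"
        by blast
    qed (use t in \<open>auto intro!: continuous_intros continuous_on_subset[OF cont]\<close>)
    from mult_right_mono[OF this, of "exp (- (2 * L * t))"] show ?thesis
      using le by (simp add: mult.assoc exp_add[symmetric] algebra_simps)
  qed
  have "exp (2 * L * \<bar>t - t'\<bar>) = (exp (L * \<bar>t - t'\<bar>))\<^sup>2"
    by (simp add: power2_eq_square exp_add[symmetric])
  with le have "\<bar>f t\<bar>\<^sup>2 \<le> (exp (L * \<bar>t - t'\<bar>) * \<bar>f t'\<bar>)\<^sup>2"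
    by (simp add: power_mult_distrib)
  then show ?thesis by (rule power2_le_imp_le) simp
qed

text \<open>Truncation extends the equation to all states and times, so that the Picard map acts on
  the complete space of bounded continuous functions on the line without any range
  condition.\<close>

definition clip :: "real \<Rightarrow> real \<Rightarrow> real" where
  "clip m x = max (- m) (min m x)"

lemma clip_in: "0 \<le> m \<Longrightarrow> clip m x \<in> {-m..m}"
  by (auto simp: clip_def)

lemma clip_id: "x \<in> {-m..m} \<Longrightarrow> clip m x = x"
  by (auto simp: clip_def)

lemma clip_lipschitz: "\<bar>clip m x - clip m y\<bar> \<le> \<bar>x - y\<bar>"
  by (auto simp: clip_def max_def min_def)

lemma clip_cont: "continuous_on S (clip m)"
  unfolding clip_def[abs_def] by (intro continuous_intros)

lemma exp_lipschitz:
  fixes a b :: real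
  assumes "a \<le> 1" "b \<le> 1"
  shows "\<bar>exp a - exp b\<bar> \<le> exp 1 * \<bar>a - b\<bar>"
proof -
  have "norm (exp a - exp b) \<le> exp 1 * norm (a - b)"
    by (rule field_differentiable_bound[of "{..1}" exp exp]) (use assms in \<open>auto intro!: derivative_eq_intros\<close>)
  then show ?thesis by simp
qed

text \<open>In \<open>delta\<close>, \<delta> \<le> r / 2 keeps times in the domain, 6 \<delta> B
  \<le> r keeps solutions starting within r / 2 inside [-r, r], and 4 \<delta> L \<le> 1 gives the
  Picard map the contraction factor 3/4. Differentiability is in the state only, since the stable
  slope is differentiated only along w.\<close>

locale scalar_flow =
  fixes s ds :: "real \<Rightarrow> real \<Rightarrow> real" and r B L \<delta> :: real
  assumes r: "0 < r"
    and s_cont: "continuous_on ({-r..r} \<times> {-r..r}) (\<lambda>p. s (fst p) (snd p))"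
    and ds_cont: "continuous_on ({-r..r} \<times> {-r..r}) (\<lambda>p. ds (fst p) (snd p))"
    and s_deriv: "a \<in> {-r..r} \<Longrightarrow> t \<in> {-r..r} \<Longrightarrow> ((\<lambda>a. s a t) has_real_derivative ds a t) (at a within {-r..r})"
    and s_bound: "a \<in> {-r..r} \<Longrightarrow> t \<in> {-r..r} \<Longrightarrow> \<bar>s a t\<bar> \<le> B"
    and ds_bound: "a \<in> {-r..r} \<Longrightarrow> t \<in> {-r..r} \<Longrightarrow> \<bar>ds a t\<bar> \<le> L"
    and delta: "0 < \<delta>" "\<delta> \<le> r / 2" "6 * \<delta> * B \<le> r" "4 * \<delta> * L \<le> 1"
begin

lemma L_nonneg: "0 \<le> L"
  using ds_bound[of 0 0] r by auto

lemma B_nonneg: "0 \<le> B"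
  using s_bound[of 0 0] r by auto

lemma time_in: "t \<in> {-\<delta>..\<delta>} \<Longrightarrow> t \<in> {-r..r}"
  using delta r by auto

lemma s_lipschitz:
  assumes "a \<in> {-r..r}" "b \<in> {-r..r}" "t \<in> {-r..r}"
  shows "\<bar>s a t - s b t\<bar> \<le> L * \<bar>a - b\<bar>"
proof -
  have "norm (s a t - s b t) \<le> L * norm (a - b)"
    by (rule field_differentiable_bound[of "{-r..r}" "\<lambda>a. s a t" "\<lambda>a. ds a t"])
       (use assms s_deriv ds_bound in auto)
  then show ?thesis by simp
qed

definition rhs :: "(real \<Rightarrow>\<^sub>C real) \<Rightarrow> real \<Rightarrow> real" where
  "rhs f \<tau> = s (clip r (apply_bcontfun f \<tau>)) (clip \<delta> \<tau>)"

text \<open>The difference of two integrals from -\<delta> stands for the oriented integral from 0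
  to t, so that negative t needs no separate treatment.\<close>

definition picard :: "real \<Rightarrow> (real \<Rightarrow>\<^sub>C real) \<Rightarrow> real \<Rightarrow> real" where
  "picard c f t = c + (integral {-\<delta>..clip \<delta> t} (rhs f) - integral {-\<delta>..0} (rhs f))"

lemma rhs_cont: "continuous_on S (\<lambda>\<tau>. rhs f \<tau>)"
proof -
  have "continuous_on S (\<lambda>\<tau>. (clip r (apply_bcontfun f \<tau>), clip \<delta> \<tau>))"
    by (intro continuous_on_Pair continuous_on_compose2[OF clip_cont[of UNIV]] clip_cont) auto
  moreover have "(\<lambda>\<tau>. (clip r (apply_bcontfun f \<tau>), clip \<delta> \<tau>)) ` S \<subseteq> {-r..r} \<times> {-r..r}"
  proof -
    have "clip r x \<in> {-r..r}" "clip \<delta> x \<in> {-r..r}" for x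
      using clip_in[of r x] time_in[OF clip_in[of \<delta> x]] r delta by simp_all
    then show ?thesis by blast
  qed
  ultimately have "continuous_on S (\<lambda>\<tau>. s (fst (clip r (apply_bcontfun f \<tau>), clip \<delta> \<tau>)) (snd (clip r (apply_bcontfun f \<tau>), clip \<delta> \<tau>)))"
    by (rule continuous_on_compose2[OF s_cont])
  then show ?thesis unfolding rhs_def fst_conv snd_conv .
qed

lemma rhs_bound: "\<bar>rhs f \<tau>\<bar> \<le> B"
  unfolding rhs_def by (intro s_bound clip_in time_in) (use r delta in auto)

text \<open>At most 2 \<delta> e for the integral up to t and \<delta> e for the one up to 0. This
  crude 3 \<delta> explains the numbers 6 and 4 in the conditions on \<delta>.\<close>

lemma integral_diff_bound:
  fixes g :: "real \<Rightarrow> real"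
  assumes g: "continuous_on {-\<delta>..\<delta>} g" "\<And>t. t \<in> {-\<delta>..\<delta>} \<Longrightarrow> \<bar>g t\<bar> \<le> e" and t: "t \<in> {-\<delta>..\<delta>}"
  shows "\<bar>integral {-\<delta>..t} g - integral {-\<delta>..0} g\<bar> \<le> 3 * \<delta> * e"
proof -
  have e: "0 \<le> e" using g(2)[of 0] delta by auto
  have b: "\<bar>integral {-\<delta>..x} g\<bar> \<le> e * (x + \<delta>)" if "x \<in> {-\<delta>..\<delta>}" for x
  proof -
    have "continuous_on {-\<delta>..x} g" using that by (intro continuous_on_subset[OF g(1)]) auto
    then have "norm (integral {-\<delta>..x} g) \<le> e * (x - - \<delta>)"
      by (intro integral_bound) (use that g(2) in auto)
    then show ?thesis by simp
  qed
  have "\<bar>integral {-\<delta>..t} g\<bar> \<le> e * (2 * \<delta>)"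
    by (rule order_trans[OF b[OF t]]) (use e t in \<open>auto intro!: mult_left_mono\<close>)
  moreover have "\<bar>integral {-\<delta>..0} g\<bar> \<le> e * \<delta>" using b[of 0] delta by simp
  ultimately show ?thesis by (simp add: algebra_simps)
qed

lemma integral_diff_deriv:
  fixes g :: "real \<Rightarrow> real"
  assumes g: "continuous_on {-\<delta>..\<delta>} g" and t: "t \<in> {-\<delta>..\<delta>}"
  shows "((\<lambda>t. integral {-\<delta>..t} g - integral {-\<delta>..0} g) has_real_derivative g t) (at t within {-\<delta>..\<delta>})"
  using DERIV_diff[OF integral_has_real_derivative[OF g t] DERIV_const] by simp

lemma picard_cont: "continuous_on UNIV (picard c f)"
proof -
  have "continuous_on {-\<delta>..\<delta>} (\<lambda>t. integral {-\<delta>..t} (rhs f) - integral {-\<delta>..0} (rhs f))"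
    by (rule DERIV_continuous_on[OF integral_diff_deriv[OF rhs_cont]])
  then have "continuous_on UNIV (\<lambda>t. integral {-\<delta>..clip \<delta> t} (rhs f) - integral {-\<delta>..0} (rhs f))"
    by (rule continuous_on_compose2[OF _ clip_cont]) (use delta clip_in in auto)
  then show ?thesis unfolding picard_def[abs_def] by (intro continuous_on_add continuous_on_const)
qed

lemma clip_delta_in: "clip \<delta> t \<in> {-\<delta>..\<delta>}"
  using delta by (intro clip_in) auto

lemma picard_bcontfun: "picard c f \<in> bcontfun"
proof (rule bcontfun_normI[OF picard_cont])
  fix t
  have "\<bar>integral {-\<delta>..clip \<delta> t} (rhs f) - integral {-\<delta>..0} (rhs f)\<bar> \<le> 3 * \<delta> * B"
    by (rule integral_diff_bound[OF rhs_cont rhs_bound clip_delta_in])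
  then show "norm (picard c f t) \<le> \<bar>c\<bar> + 3 * \<delta> * B"
    unfolding picard_def real_norm_def by linarith
qed

lemma picard_fixpoint: "\<exists>f. \<forall>t. apply_bcontfun f t = picard c f t"
proof -
  let ?T = "\<lambda>f. Bcontfun (picard c f)"
  have app: "apply_bcontfun (?T f) = picard c f" for f
    by (rule Bcontfun_inverse[OF picard_bcontfun])
  have "\<exists>!f. ?T f = f"
  proof (rule banach_fix_type[of "3 / 4"])
    show "\<forall>f g. dist (?T f) (?T g) \<le> 3 / 4 * dist f g"
    proof (intro allI dist_bound)
      fix f g :: "real \<Rightarrow>\<^sub>C real" and t
      have d: "\<bar>rhs f \<tau> - rhs g \<tau>\<bar> \<le> L * dist f g" for \<tau>
      proof -
        have "\<bar>rhs f \<tau> - rhs g \<tau>\<bar> \<le> L * \<bar>clip r (apply_bcontfun f \<tau>) - clip r (apply_bcontfun g \<tau>)\<bar>"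
          unfolding rhs_def using r by (intro s_lipschitz clip_in time_in clip_delta_in) auto
        also have "\<dots> \<le> L * dist f g"
          using order_trans[OF clip_lipschitz, of "apply_bcontfun f \<tau>" "apply_bcontfun g \<tau>" "dist f g" r]
            dist_bounded[of f \<tau> g] L_nonneg by (intro mult_left_mono) (auto simp: dist_real_def)
        finally show ?thesis .
      qed
      have i: "integral {-\<delta>..x} (rhs f) - integral {-\<delta>..x} (rhs g) = integral {-\<delta>..x} (\<lambda>t. rhs f t - rhs g t)" for x
        by (intro integral_diff[symmetric] integrable_continuous_real rhs_cont)
      have "picard c f t - picard c g t = integral {-\<delta>..clip \<delta> t} (\<lambda>t. rhs f t - rhs g t) - integral {-\<delta>..0} (\<lambda>t. rhs f t - rhs g t)"
        unfolding picard_def i[symmetric] by simp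
      moreover have "\<bar>integral {-\<delta>..clip \<delta> t} (\<lambda>t. rhs f t - rhs g t) - integral {-\<delta>..0} (\<lambda>t. rhs f t - rhs g t)\<bar> \<le> 3 * \<delta> * (L * dist f g)"
        by (rule integral_diff_bound[OF _ d clip_delta_in]) (intro continuous_on_diff rhs_cont)
      moreover have "3 * \<delta> * (L * dist f g) \<le> 3 / 4 * dist f g"
        using mult_right_mono[OF delta(4), of "3 / 4 * dist f g"] by (simp add: mult_ac)
      ultimately show "dist (apply_bcontfun (?T f) t) (apply_bcontfun (?T g) t) \<le> 3 / 4 * dist f g"
        unfolding app dist_real_def by linarith
    qed
  qed auto
  then show ?thesis using app by metis
qed

text \<open>The fixed point moves away from c by at most 3 \<delta> B \<le> r / 2, so it never
  leaves [-r, r]; there the truncations are the identity and the original equation holds.\<close>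

lemma solution_exists:
  assumes c: "\<bar>c\<bar> \<le> r / 2"
  shows "\<exists>x. x 0 = c \<and> (\<forall>t\<in>{-\<delta>..\<delta>}. x t \<in> {-r..r} \<and> (x has_real_derivative s (x t) t) (at t within {-\<delta>..\<delta>}))"
proof -
  obtain f where f: "\<And>t. apply_bcontfun f t = picard c f t" using picard_fixpoint by blast
  have *: "\<bar>integral {-\<delta>..clip \<delta> t} (rhs f) - integral {-\<delta>..0} (rhs f)\<bar> \<le> 3 * \<delta> * B" for t
    by (rule integral_diff_bound[OF rhs_cont rhs_bound clip_delta_in])
  have rng: "apply_bcontfun f t \<in> {-r..r}" for t
  proof -
    have "3 * \<delta> * B \<le> r / 2" using delta(3) by simp
    with *[of t] c have "\<bar>apply_bcontfun f t\<bar> \<le> r" unfolding f picard_def by linarith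
    then show ?thesis by auto
  qed
  show ?thesis
  proof (intro exI[of _ "apply_bcontfun f"] conjI ballI rng)
    show "apply_bcontfun f 0 = c" unfolding f picard_def using clip_id[of 0 \<delta>] delta by simp
    fix t assume t: "t \<in> {-\<delta>..\<delta>}"
    have "((\<lambda>t. c + (integral {-\<delta>..t} (rhs f) - integral {-\<delta>..0} (rhs f))) has_real_derivative rhs f t) (at t within {-\<delta>..\<delta>})"
      using DERIV_add[OF DERIV_const integral_diff_deriv[OF rhs_cont t]] by simp
    then have "(apply_bcontfun f has_real_derivative rhs f t) (at t within {-\<delta>..\<delta>})"
      by (rule has_field_derivative_transform_within[OF _ zero_less_one t])
         (simp add: f picard_def clip_id)
    then show "(apply_bcontfun f has_real_derivative s (apply_bcontfun f t) t) (at t within {-\<delta>..\<delta>})"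
      unfolding rhs_def clip_id[OF t] clip_id[OF rng] .
  qed
qed

section \<open>Dependence of the solutions on the initial value\<close>

definition X :: "real \<Rightarrow> real \<Rightarrow> real" where
  "X c = (SOME x. x 0 = c \<and> (\<forall>t\<in>{-\<delta>..\<delta>}. x t \<in> {-r..r} \<and> (x has_real_derivative s (x t) t) (at t within {-\<delta>..\<delta>})))"

lemma X:
  assumes "\<bar>c\<bar> \<le> r / 2"
  shows "X c 0 = c" "t \<in> {-\<delta>..\<delta>} \<Longrightarrow> X c t \<in> {-r..r}"
    "t \<in> {-\<delta>..\<delta>} \<Longrightarrow> (X c has_real_derivative s (X c t) t) (at t within {-\<delta>..\<delta>})"
  using someI_ex[OF solution_exists[OF assms]] unfolding X_def[symmetric] by auto

definition "M = exp (L * \<delta>)"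

lemma M_ge_1: "1 \<le> M"
  using L_nonneg delta by (simp add: M_def)

text \<open>Gronwall's estimate is used in both time directions. The second inequality, from time t
  back to 0, later makes the chart injective with a Lipschitz inverse.\<close>

lemma X_gronwall:
  assumes c: "\<bar>c\<bar> \<le> r / 2" "\<bar>c'\<bar> \<le> r / 2" and t: "t \<in> {-\<delta>..\<delta>}"
  shows "\<bar>X c t - X c' t\<bar> \<le> M * \<bar>c - c'\<bar>" "\<bar>c - c'\<bar> \<le> M * \<bar>X c t - X c' t\<bar>"
proof -
  have g: "\<bar>X c x - X c' x\<bar> \<le> exp (L * \<bar>x - y\<bar>) * \<bar>X c y - X c' y\<bar>" if "x \<in> {-\<delta>..\<delta>}" "y \<in> {-\<delta>..\<delta>}" for x y
  proof (rule gronwall_comparison[OF _ _ that])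
    fix t assume t: "t \<in> {-\<delta>..\<delta>}"
    show "((\<lambda>t. X c t - X c' t) has_real_derivative s (X c t) t - s (X c' t) t) (at t within {-\<delta>..\<delta>})"
      by (rule DERIV_diff[OF X(3)[OF c(1) t] X(3)[OF c(2) t]])
    show "\<bar>s (X c t) t - s (X c' t) t\<bar> \<le> L * \<bar>X c t - X c' t\<bar>"
      by (rule s_lipschitz[OF X(2)[OF c(1) t] X(2)[OF c(2) t] time_in[OF t]])
  qed
  have 0: "0 \<in> {-\<delta>..\<delta>}" using delta by simp
  have e: "exp (L * \<bar>x\<bar>) \<le> M" if "x \<in> {-\<delta>..\<delta>}" for x
    using that L_nonneg unfolding M_def by (auto intro!: mult_left_mono)
  have "\<bar>X c t - X c' t\<bar> \<le> exp (L * \<bar>t\<bar>) * \<bar>c - c'\<bar>" using g[OF t 0] by (simp add: X(1)[OF c(1)] X(1)[OF c(2)])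
  also have "\<dots> \<le> M * \<bar>c - c'\<bar>" by (intro mult_right_mono e t) simp
  finally show "\<bar>X c t - X c' t\<bar> \<le> M * \<bar>c - c'\<bar>" .
  have "\<bar>c - c'\<bar> \<le> exp (L * \<bar>t\<bar>) * \<bar>X c t - X c' t\<bar>" using g[OF 0 t] by (simp add: X(1)[OF c(1)] X(1)[OF c(2)])
  also have "\<dots> \<le> M * \<bar>X c t - X c' t\<bar>" by (intro mult_right_mono e t) simp
  finally show "\<bar>c - c'\<bar> \<le> M * \<bar>X c t - X c' t\<bar>" .
qed

lemma X_time_lipschitz:
  assumes c: "\<bar>c\<bar> \<le> r / 2" and t: "t \<in> {-\<delta>..\<delta>}" "t' \<in> {-\<delta>..\<delta>}"
  shows "\<bar>X c t - X c t'\<bar> \<le> B * \<bar>t - t'\<bar>"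
proof -
  have "norm (X c t - X c t') \<le> B * norm (t - t')"
  proof (rule field_differentiable_bound[of "{-\<delta>..\<delta>}" "X c" "\<lambda>t. s (X c t) t"])
    fix z assume "z \<in> {-\<delta>..\<delta>}"
    then show "norm (s (X c z) z) \<le> B"
      unfolding real_norm_def by (intro s_bound X(2) c time_in)
  qed (use t X(3)[OF c] in auto)
  then show ?thesis by simp
qed

lemma X_lipschitz:
  assumes c: "\<bar>c\<bar> \<le> r / 2" "\<bar>c'\<bar> \<le> r / 2" and t: "t \<in> {-\<delta>..\<delta>}" "t' \<in> {-\<delta>..\<delta>}"
  shows "\<bar>X c t - X c' t'\<bar> \<le> M * \<bar>c - c'\<bar> + B * \<bar>t - t'\<bar>"
  using X_gronwall(1)[OF c t(1)] X_time_lipschitz[OF c(2) t] by linarith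

definition "k c t = ds (X c t) t"
definition "I c t = integral {-\<delta>..t} (k c) - integral {-\<delta>..0} (k c)"
definition "dX c t = exp (I c t)"

lemma X_cont: "\<bar>c\<bar> \<le> r / 2 \<Longrightarrow> continuous_on {-\<delta>..\<delta>} (X c)"
  by (rule DERIV_continuous_on[OF X(3)])

lemma k_cont:
  assumes c: "\<bar>c\<bar> \<le> r / 2"
  shows "continuous_on {-\<delta>..\<delta>} (\<lambda>t. k c t)"
proof -
  have "continuous_on {-\<delta>..\<delta>} (\<lambda>t. (X c t, t))"
    by (intro continuous_on_Pair X_cont c continuous_on_id)
  from continuous_on_compose2[OF ds_cont this] show ?thesis
    unfolding k_def using X(2)[OF c] time_in by (auto simp: image_subset_iff)
qed

lemma k_bound: "\<bar>c\<bar> \<le> r / 2 \<Longrightarrow> t \<in> {-\<delta>..\<delta>} \<Longrightarrow> \<bar>k c t\<bar> \<le> L"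
  unfolding k_def by (intro ds_bound X(2) time_in)

lemma I_bound: "\<bar>c\<bar> \<le> r / 2 \<Longrightarrow> t \<in> {-\<delta>..\<delta>} \<Longrightarrow> \<bar>I c t\<bar> \<le> 1"
proof -
  assume c: "\<bar>c\<bar> \<le> r / 2" and t: "t \<in> {-\<delta>..\<delta>}"
  have "\<bar>I c t\<bar> \<le> 3 * \<delta> * L"
    unfolding I_def by (rule integral_diff_bound[OF k_cont[OF c] k_bound[OF c] t])
  moreover have "3 * (\<delta> * L) \<le> 4 * (\<delta> * L)" using delta L_nonneg by (intro mult_right_mono) auto
  ultimately show ?thesis using delta(4) by (simp add: mult.assoc)
qed

lemma dX_bounds: "\<bar>c\<bar> \<le> r / 2 \<Longrightarrow> t \<in> {-\<delta>..\<delta>} \<Longrightarrow> exp (-1) \<le> dX c t" "\<bar>c\<bar> \<le> r / 2 \<Longrightarrow> t \<in> {-\<delta>..\<delta>} \<Longrightarrow> dX c t \<le> exp 1"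
  using I_bound[of c t] unfolding dX_def by auto

lemma dX_pos [simp]: "0 < dX c t" "dX c t \<noteq> 0"
  by (simp_all add: dX_def)

lemma dX_deriv: "\<bar>c\<bar> \<le> r / 2 \<Longrightarrow> t \<in> {-\<delta>..\<delta>} \<Longrightarrow> ((\<lambda>t. dX c t) has_real_derivative k c t * dX c t) (at t within {-\<delta>..\<delta>})"
proof -
  assume c: "\<bar>c\<bar> \<le> r / 2" and t: "t \<in> {-\<delta>..\<delta>}"
  have "((\<lambda>t. I c t) has_real_derivative k c t) (at t within {-\<delta>..\<delta>})"
    unfolding I_def by (rule integral_diff_deriv[OF k_cont[OF c] t])
  then have "((\<lambda>t. exp (I c t)) has_real_derivative exp (I c t) * k c t) (at t within {-\<delta>..\<delta>})"
    by (rule DERIV_chain2[OF DERIV_exp])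
  then show ?thesis unfolding dX_def by (simp only: mult.commute)
qed

lemma I_modulus:
  assumes c: "\<bar>c\<bar> \<le> r / 2" "\<bar>c'\<bar> \<le> r / 2" and t: "t \<in> {-\<delta>..\<delta>}" "t' \<in> {-\<delta>..\<delta>}"
    and e: "\<And>\<tau>. \<tau> \<in> {-\<delta>..\<delta>} \<Longrightarrow> \<bar>k c \<tau> - k c' \<tau>\<bar> \<le> e"
  shows "\<bar>I c t - I c' t'\<bar> \<le> L * \<bar>t - t'\<bar> + 3 * \<delta> * e"
proof -
  have "norm (I c t - I c t') \<le> L * norm (t - t')"
    by (rule field_differentiable_bound[of "{-\<delta>..\<delta>}" "\<lambda>t. I c t" "k c"])
       (use t c in \<open>auto simp: I_def intro!: integral_diff_deriv k_cont k_bound\<close>)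
  moreover have "\<bar>I c t' - I c' t'\<bar> \<le> 3 * \<delta> * e"
  proof -
    have i: "integral {-\<delta>..x} (k c) - integral {-\<delta>..x} (k c') = integral {-\<delta>..x} (\<lambda>t. k c t - k c' t)"
      if "x \<in> {-\<delta>..\<delta>}" for x
      using that c by (intro integral_diff[symmetric] integrable_continuous_real continuous_on_subset[OF k_cont]) auto
    have "I c t' - I c' t' = integral {-\<delta>..t'} (\<lambda>t. k c t - k c' t) - integral {-\<delta>..0} (\<lambda>t. k c t - k c' t)"
      using i[OF t(2)] i[of 0] delta unfolding I_def by auto
    also have "\<bar>\<dots>\<bar> \<le> 3 * \<delta> * e"
      by (rule integral_diff_bound[OF continuous_on_diff[OF k_cont[OF c(1)] k_cont[OF c(2)]] e t(2)])
    finally show ?thesis .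
  qed
  ultimately show ?thesis by simp
qed

text \<open>Leaving e open lets one estimate serve twice: e from uniform continuity of
  \<open>ds\<close> gives continuity of \<open>dX\<close>, and a Hoelder bound for e gives a Hoelder
  bound for the chart derivatives.\<close>

lemma dX_modulus:
  assumes c: "\<bar>c\<bar> \<le> r / 2" "\<bar>c'\<bar> \<le> r / 2" and t: "t \<in> {-\<delta>..\<delta>}" "t' \<in> {-\<delta>..\<delta>}"
    and e: "\<And>\<tau>. \<tau> \<in> {-\<delta>..\<delta>} \<Longrightarrow> \<bar>k c \<tau> - k c' \<tau>\<bar> \<le> e"
  shows "\<bar>dX c t - dX c' t'\<bar> \<le> exp 1 * (L * \<bar>t - t'\<bar> + 3 * \<delta> * e)"
proof -
  have "\<bar>dX c t - dX c' t'\<bar> \<le> exp 1 * \<bar>I c t - I c' t'\<bar>"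
    unfolding dX_def using I_bound[of c t] I_bound[of c' t'] c t by (intro exp_lipschitz) auto
  also have "\<dots> \<le> exp 1 * (L * \<bar>t - t'\<bar> + 3 * \<delta> * e)"
    by (intro mult_left_mono I_modulus assms) auto
  finally show ?thesis .
qed

lemma ds_uniform:
  assumes "0 < e"
  obtains d where "0 < d" "\<And>a b t. a \<in> {-r..r} \<Longrightarrow> b \<in> {-r..r} \<Longrightarrow> t \<in> {-r..r} \<Longrightarrow> \<bar>a - b\<bar> < d \<Longrightarrow> \<bar>ds a t - ds b t\<bar> < e"
proof -
  have "uniformly_continuous_on ({-r..r} \<times> {-r..r}) (\<lambda>p. ds (fst p) (snd p))"
    by (intro compact_uniformly_continuous ds_cont compact_Times compact_Icc)
  then obtain d where d: "d > 0" "\<forall>x\<in>{-r..r} \<times> {-r..r}. \<forall>y\<in>{-r..r} \<times> {-r..r}. dist y x < d \<longrightarrow>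
      dist (ds (fst y) (snd y)) (ds (fst x) (snd x)) < e"
    using assms unfolding uniformly_continuous_on_def by meson
  show ?thesis
  proof (rule that[OF d(1)])
    fix a b t assume "a \<in> {-r..r}" "b \<in> {-r..r}" "t \<in> {-r..r}" "\<bar>a - b\<bar> < d"
    then show "\<bar>ds a t - ds b t\<bar> < e"
      using d(2)[rule_format, of "(b, t)" "(a, t)"] by (auto simp: dist_Pair_Pair dist_real_def)
  qed
qed

lemma linearization:
  assumes ab: "a \<in> {-r..r}" "b \<in> {-r..r}" "t \<in> {-r..r}"
    and e: "\<And>x. x \<in> {-r..r} \<Longrightarrow> \<bar>x - b\<bar> \<le> \<bar>a - b\<bar> \<Longrightarrow> \<bar>ds x t - ds b t\<bar> \<le> e"
  shows "\<bar>s a t - s b t - ds b t * (a - b)\<bar> \<le> e * \<bar>a - b\<bar>"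
proof -
  have sub: "x \<in> {-r..r}" "\<bar>x - b\<bar> \<le> \<bar>a - b\<bar>" if "x \<in> closed_segment b a" for x
    using that ab by (auto simp: closed_segment_eq_real_ivl split: if_splits)
  have D: "((\<lambda>x. s x t - ds b t * x) has_real_derivative (ds x t - ds b t)) (at x within closed_segment b a)"
    if "x \<in> closed_segment b a" for x
  proof -
    have "closed_segment b a \<subseteq> {-r..r}" using sub by auto
    then have "((\<lambda>x. s x t) has_real_derivative ds x t) (at x within closed_segment b a)"
      using s_deriv[OF sub(1)[OF that] ab(3)] DERIV_subset by blast
    then show ?thesis by (auto intro!: derivative_eq_intros)
  qed
  have "norm ((s a t - ds b t * a) - (s b t - ds b t * b)) \<le> e * norm (a - b)"
    by (rule field_differentiable_bound[OF convex_closed_segment D]) (use sub e in auto)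
  then show ?thesis by (simp add: algebra_simps)
qed

text \<open>The quotient \<open>\<kappa>\<close> of the difference \<open>\<Delta>\<close> of two solutions by the solution \<open>dX\<close> of the linearized equation
  has a small derivative and starts at the difference of the initial values.\<close>

lemma X_initial_deriv:
  assumes c: "\<bar>c\<bar> < r / 2" and t: "t \<in> {-\<delta>..\<delta>}"
  shows "((\<lambda>c. X c t) has_real_derivative dX c t) (at c)"
proof -
  have c': "\<bar>c\<bar> \<le> r / 2" using c by simp
  \<comment> \<open>The losses ahead: exp 1 from dividing by \<open>dX\<close>, exp 1 from
    multiplying by it again, M from Gronwall's estimate, and \<delta> from the length of the time
    interval.\<close>
  let ?K = "exp 1 * (exp 1 * M * \<delta>)"
  have K: "0 < ?K" using M_ge_1 delta by simp
  have est: "\<exists>d>0. \<forall>y. norm (y - c) < d \<longrightarrow> norm (X y t - X c t - (y - c) * dX c t) \<le> e * norm (y - c)" if e: "e > 0" for e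
  proof -
    let ?e = "e / ?K"
    have e': "?e > 0" using e K by simp
    obtain d where d: "0 < d" "\<And>a b t. a \<in> {-r..r} \<Longrightarrow> b \<in> {-r..r} \<Longrightarrow> t \<in> {-r..r} \<Longrightarrow> \<bar>a - b\<bar> < d \<Longrightarrow> \<bar>ds a t - ds b t\<bar> < ?e"
      using ds_uniform[OF e'] by metis
    \<comment> \<open>The first term keeps the two solutions within the modulus d of
      \<open>ds\<close> at all times; the second keeps y an admissible initial value.\<close>
    define d' where "d' = min (d / M) (r / 2 - \<bar>c\<bar>)"
    have d'0: "d' > 0" using d M_ge_1 c by (simp add: d'_def)
    show ?thesis
    proof (intro exI[of _ d'] conjI allI impI d'0)
      fix y assume y: "norm (y - c) < d'"
      then have yr: "\<bar>y\<bar> \<le> r / 2" and "\<bar>y - c\<bar> < d / M" unfolding d'_def by auto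
      then have Md: "M * \<bar>y - c\<bar> < d" using M_ge_1 by (simp add: pos_less_divide_eq mult.commute)
      define \<Delta> where "\<Delta> \<tau> = X y \<tau> - X c \<tau>" for \<tau>
      have \<Delta>: "\<bar>\<Delta> \<tau>\<bar> \<le> M * \<bar>y - c\<bar>" if "\<tau> \<in> {-\<delta>..\<delta>}" for \<tau>
        unfolding \<Delta>_def by (rule X_gronwall(1)[OF yr c' that])
      define \<kappa>' where "\<kappa>' \<tau> = (s (X y \<tau>) \<tau> - s (X c \<tau>) \<tau> - k c \<tau> * \<Delta> \<tau>) / dX c \<tau>" for \<tau>
      have D: "((\<lambda>\<tau>. \<Delta> \<tau> / dX c \<tau>) has_real_derivative \<kappa>' \<tau>) (at \<tau> within {-\<delta>..\<delta>})" if "\<tau> \<in> {-\<delta>..\<delta>}" for \<tau>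
      proof -
        have "((\<lambda>\<tau>. \<Delta> \<tau> / dX c \<tau>) has_real_derivative
            ((s (X y \<tau>) \<tau> - s (X c \<tau>) \<tau>) * dX c \<tau> - \<Delta> \<tau> * (k c \<tau> * dX c \<tau>)) / (dX c \<tau> * dX c \<tau>)) (at \<tau> within {-\<delta>..\<delta>})"
          unfolding \<Delta>_def by (intro DERIV_divide DERIV_diff X(3) dX_deriv yr c' that dX_pos)
        moreover have "((s (X y \<tau>) \<tau> - s (X c \<tau>) \<tau>) * dX c \<tau> - \<Delta> \<tau> * (k c \<tau> * dX c \<tau>)) / (dX c \<tau> * dX c \<tau>) = \<kappa>' \<tau>"
          unfolding \<kappa>'_def by (simp add: divide_simps) (simp add: algebra_simps)
        ultimately show ?thesis by simp
      qed
      have bd: "norm (\<kappa>' \<tau>) \<le> ?e * (M * \<bar>y - c\<bar>) * exp 1" if \<tau>: "\<tau> \<in> {-\<delta>..\<delta>}" for \<tau>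
      proof -
        have lin: "\<bar>s (X y \<tau>) \<tau> - s (X c \<tau>) \<tau> - k c \<tau> * \<Delta> \<tau>\<bar> \<le> ?e * \<bar>\<Delta> \<tau>\<bar>"
          unfolding k_def \<Delta>_def
        proof (rule linearization)
          fix x assume x: "x \<in> {-r..r}" "\<bar>x - X c \<tau>\<bar> \<le> \<bar>X y \<tau> - X c \<tau>\<bar>"
          then have "\<bar>x - X c \<tau>\<bar> < d" using \<Delta>[OF \<tau>] Md unfolding \<Delta>_def by linarith
          then show "\<bar>ds x \<tau> - ds (X c \<tau>) \<tau>\<bar> \<le> ?e"
            using d(2)[OF x(1) X(2)[OF c' \<tau>] time_in[OF \<tau>]] by (intro less_imp_le) auto
        qed (use X(2) yr c' \<tau> time_in in auto)
        also have "\<dots> \<le> ?e * (M * \<bar>y - c\<bar>)" using e' by (intro mult_left_mono \<Delta> \<tau>) auto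
        finally have "\<bar>s (X y \<tau>) \<tau> - s (X c \<tau>) \<tau> - k c \<tau> * \<Delta> \<tau>\<bar> / dX c \<tau> \<le> ?e * (M * \<bar>y - c\<bar>) / exp (-1)"
          using dX_bounds(1)[OF c' \<tau>] e' M_ge_1 by (intro frac_le) auto
        moreover have "\<bar>\<kappa>' \<tau>\<bar> = \<bar>s (X y \<tau>) \<tau> - s (X c \<tau>) \<tau> - k c \<tau> * \<Delta> \<tau>\<bar> / dX c \<tau>"
          unfolding \<kappa>'_def abs_divide using dX_pos(1)[of c \<tau>] by (simp only: abs_of_pos)
        moreover have "?e * (M * \<bar>y - c\<bar>) / exp (-1) = ?e * (M * \<bar>y - c\<bar>) * exp 1"
          by (simp add: exp_minus divide_inverse)
        ultimately show ?thesis by (simp only: real_norm_def)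
      qed
      have "norm (\<Delta> t / dX c t - \<Delta> 0 / dX c 0) \<le> ?e * (M * \<bar>y - c\<bar>) * exp 1 * norm (t - 0)"
        by (rule field_differentiable_bound[of "{-\<delta>..\<delta>}" "\<lambda>\<tau>. \<Delta> \<tau> / dX c \<tau>" \<kappa>']) (use D bd t delta in auto)
      also have "\<dots> \<le> ?e * (M * \<bar>y - c\<bar>) * exp 1 * \<delta>"
        using t e delta M_ge_1 by (intro mult_left_mono) auto
      also have "\<Delta> 0 / dX c 0 = y - c" by (simp add: \<Delta>_def dX_def I_def X(1)[OF yr] X(1)[OF c'])
      finally have "\<bar>\<Delta> t / dX c t - (y - c)\<bar> \<le> ?e * (M * \<bar>y - c\<bar>) * exp 1 * \<delta>" by simp
      then have "dX c t * \<bar>\<Delta> t / dX c t - (y - c)\<bar> \<le> exp 1 * (?e * (M * \<bar>y - c\<bar>) * exp 1 * \<delta>)"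
        using dX_bounds(2)[OF c' t] by (intro mult_mono) auto
      also have "\<dots> = e * \<bar>y - c\<bar>" using M_ge_1 delta(1) by (simp add: field_simps)
      also have "dX c t * \<bar>\<Delta> t / dX c t - (y - c)\<bar> = \<bar>\<Delta> t - (y - c) * dX c t\<bar>"
      proof -
        have "dX c t * \<bar>\<Delta> t / dX c t - (y - c)\<bar> = \<bar>dX c t * (\<Delta> t / dX c t - (y - c))\<bar>"
          using dX_pos(1)[of c t] by (simp only: abs_mult abs_of_pos)
        also have "dX c t * (\<Delta> t / dX c t - (y - c)) = \<Delta> t - (y - c) * dX c t"
          by (simp add: field_simps)
        finally show ?thesis .
      qed
      finally show "norm (X y t - X c t - (y - c) * dX c t) \<le> e * norm (y - c)" by (simp add: \<Delta>_def)
    qed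
  qed
  have "((\<lambda>c. X c t) has_derivative (\<lambda>y. y * dX c t)) (at c)"
    unfolding has_derivative_within_alt using est by (auto intro: bounded_linear_mult_left)
  then show ?thesis by (simp only: has_field_derivative_def mult_commute_abs)
qed

lemma dX_cont: "continuous_on ({-\<delta>..\<delta>} \<times> {-(r/2)..r/2}) (\<lambda>p. dX (snd p) (fst p))"
  unfolding continuous_on_iff
proof (intro ballI allI impI)
  fix p :: "real \<times> real" and e :: real assume p: "p \<in> {-\<delta>..\<delta>} \<times> {-(r/2)..r/2}" and e: "e > 0"
  obtain t c where tc: "p = (t, c)" by (cases p)
  have t: "t \<in> {-\<delta>..\<delta>}" and c: "\<bar>c\<bar> \<le> r / 2" using p tc by auto
  \<comment> \<open>Each of the two terms of \<open>dX_modulus\<close> is to stay below e / 2: 3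
    \<delta> e1 exp 1 by this choice, and the time term by the second entry of
    \<open>d'\<close>.\<close>
  define e1 where "e1 = e / (exp 1 * (6 * \<delta> + 1))"
  have e1: "e1 > 0" using e delta by (simp add: e1_def)
  obtain d where d: "0 < d" "\<And>a b t. a \<in> {-r..r} \<Longrightarrow> b \<in> {-r..r} \<Longrightarrow> t \<in> {-r..r} \<Longrightarrow> \<bar>a - b\<bar> < d \<Longrightarrow> \<bar>ds a t - ds b t\<bar> < e1"
    using ds_uniform[OF e1] by metis
  define d' where "d' = min (d / M) (e / (exp 1 * (2 * L + 1)))"
  have d': "d' > 0" using d e L_nonneg M_ge_1 by (simp add: d'_def)
  show "\<exists>d>0. \<forall>p'\<in>{-\<delta>..\<delta>} \<times> {-(r/2)..r/2}. dist p' p < d \<longrightarrow> dist (dX (snd p') (fst p')) (dX (snd p) (fst p)) < e"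
  proof (intro exI[of _ d'] conjI ballI impI d')
    fix p' assume p': "p' \<in> {-\<delta>..\<delta>} \<times> {-(r/2)..r/2}" "dist p' p < d'"
    obtain t' c' where tc': "p' = (t', c')" by (cases p')
    have t': "t' \<in> {-\<delta>..\<delta>}" and c': "\<bar>c'\<bar> \<le> r / 2" using p' tc' by auto
    have dd: "\<bar>t' - t\<bar> < d'" "\<bar>c' - c\<bar> < d'"
      using p'(2) dist_fst_le[of p' p] dist_snd_le[of p' p] by (auto simp: tc tc' dist_real_def)
    have "M * \<bar>c' - c\<bar> < d"
      using dd(2) M_ge_1 unfolding d'_def by (simp add: pos_less_divide_eq mult.commute)
    then have "\<bar>k c' \<tau> - k c \<tau>\<bar> \<le> e1" if \<tau>: "\<tau> \<in> {-\<delta>..\<delta>}" for \<tau>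
      unfolding k_def using X_gronwall(1)[OF c' c \<tau>]
      by (intro less_imp_le d(2) X(2)[OF c \<tau>] X(2)[OF c' \<tau>] time_in[OF \<tau>]) auto
    then have "\<bar>dX c' t' - dX c t\<bar> \<le> exp 1 * (L * \<bar>t' - t\<bar> + 3 * \<delta> * e1)"
      by (rule dX_modulus[OF c' c t' t])
    also have "\<dots> < e"
    proof -
      have "\<bar>t' - t\<bar> < e / (exp 1 * (2 * L + 1))" using dd(1) unfolding d'_def by simp
      then have 1: "\<bar>t' - t\<bar> * (exp 1 * (2 * L + 1)) < e" using L_nonneg by (simp add: pos_less_divide_eq)
      have 2: "e1 * (exp 1 * (6 * \<delta> + 1)) = e" using delta by (simp add: e1_def)
      define P Q where "P = exp 1 * (L * \<bar>t' - t\<bar>)" and "Q = exp 1 * (\<delta> * e1)"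
      have "0 < e1 * exp 1" using e1 by simp
      moreover have "e1 * exp 1 + 6 * Q = e" using 2 by (simp add: Q_def algebra_simps)
      moreover have "0 \<le> \<bar>t' - t\<bar> * exp 1" by simp
      moreover have "\<bar>t' - t\<bar> * exp 1 + 2 * P < e" using 1 by (simp add: P_def algebra_simps)
      moreover have "exp 1 * (L * \<bar>t' - t\<bar> + 3 * \<delta> * e1) = P + 3 * Q" by (simp add: P_def Q_def algebra_simps)
      ultimately show ?thesis by linarith
    qed
    finally show "dist (dX (snd p') (fst p')) (dX (snd p) (fst p)) < e" by (simp add: tc tc' dist_real_def)
  qed
qed

text \<open>Joint differentiability follows from the time derivative at the point together with the
  partial derivative in c, which is jointly continuous by \<open>dX_cont\<close>.\<close>

lemma flow_deriv:
  assumes c: "\<bar>c\<bar> < r / 2" and t: "\<bar>t\<bar> < \<delta>"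
  shows "((\<lambda>(t, c). X c t) has_derivative (\<lambda>(x, y). s (X c t) t * x + dX c t * y)) (at (t, c))"
proof -
  let ?A = "{-\<delta><..<\<delta>}" and ?B = "{-(r/2)<..<r/2}"
  have tA: "t \<in> ?A" and cB: "c \<in> ?B" using c t by auto
  have "((\<lambda>(t, c). X c t) has_derivative (\<lambda>(x, y). s (X c t) t * x + blinfun_apply (blinfun_mult_right (dX c t)) y)) (at (t, c) within ?A \<times> ?B)"
  proof (rule has_derivative_partialsI[where fy = "\<lambda>t c. blinfun_mult_right (dX c t)"])
    have "(X c has_real_derivative s (X c t) t) (at t within {-\<delta>..\<delta>})"
      using c tA by (intro X(3)) auto
    then have "(X c has_real_derivative s (X c t) t) (at t within ?A)"
      by (rule DERIV_subset) auto
    then show "((\<lambda>t. X c t) has_derivative (\<lambda>x. s (X c t) t * x)) (at t within ?A)"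
      unfolding has_field_derivative_def .
    show "((\<lambda>c. X c t) has_derivative blinfun_apply (blinfun_mult_right (dX c t))) (at c within ?B)"
      if "t \<in> ?A" "c \<in> ?B" for t c
    proof -
      have "((\<lambda>c. X c t) has_real_derivative dX c t) (at c)"
        using that by (intro X_initial_deriv) auto
      then show ?thesis
        unfolding has_field_derivative_def blinfun_mult_right.rep_eq by (rule has_derivative_at_withinI)
    qed
    have "continuous_on (?A \<times> ?B) (\<lambda>p. dX (snd p) (fst p))"
      by (rule continuous_on_subset[OF dX_cont]) auto
    then have "continuous_on (?A \<times> ?B) (\<lambda>p. blinfun_mult_right (dX (snd p) (fst p)))"
      by (rule bounded_linear.continuous_on[OF bounded_linear_blinfun_mult_right])
    then have "continuous (at (t, c) within ?A \<times> ?B) (\<lambda>p. blinfun_mult_right (dX (snd p) (fst p)))"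
      using tA cB unfolding continuous_on_eq_continuous_within by blast
    then show "continuous (at (t, c) within ?A \<times> ?B) (\<lambda>(t, c). blinfun_mult_right (dX c t))"
      by (simp add: case_prod_unfold)
  qed (use cB in auto)
  moreover have "at (t, c) within ?A \<times> ?B = at (t, c)"
    using tA cB by (intro at_within_open open_Times) auto
  ultimately show ?thesis by simp
qed

end

section \<open>Expansivity in the unstable cone\<close>

text \<open>A perturbation of relative size \<kappa> leaves w \<bullet> (w + e) \<ge> (1 - \<kappa>)
  |w|^2 and |w + e| \<le> (1 + \<kappa>) |w|, so the cosine of the angle is at least (1 - \<kappa>)
  / (1 + \<kappa>) when c is positive is compared with c; for c \<le> 0 positivity of the inner
  product suffices.\<close>

lemma cos_le_vec_angle:
  assumes w: "w \<noteq> 0" and e: "norm e \<le> \<kappa> * norm w" and k: "0 \<le> \<kappa>" "\<kappa> < 1"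
    and c: "c * (1 + \<kappa>) < 1 - \<kappa>" and c1: "c = cos b" "0 \<le> b" "b \<le> pi"
  shows "vec_angle w (w + e) < b"
proof -
  have nw: "0 < norm w" using w by simp
  have ke: "\<kappa> * norm w < 1 * norm w" using k nw by (intro mult_strict_right_mono) auto
  have n1: "norm (w + e) \<le> (1 + \<kappa>) * norm w" using norm_triangle_ineq[of w e] e by (simp add: algebra_simps)
  have n0: "0 < norm (w + e)" using norm_diff_ineq[of w e] e ke by linarith
  have "- (norm w * norm e) \<le> w \<bullet> e" using Cauchy_Schwarz_ineq2[of w e] by linarith
  moreover have "norm w * norm e \<le> norm w * (\<kappa> * norm w)" using e by (intro mult_left_mono) auto
  ultimately have ip: "(1 - \<kappa>) * (norm w * norm w) \<le> w \<bullet> (w + e)"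
    by (simp add: inner_add_right dot_square_norm power2_eq_square algebra_simps)
  have "c * (norm w * norm (w + e)) < w \<bullet> (w + e)"
  proof (cases "c \<le> 0")
    case True
    have "c * (norm w * norm (w + e)) \<le> 0" using True by (intro mult_nonpos_nonneg) auto
    also have "0 < (1 - \<kappa>) * (norm w * norm w)" using k nw by simp
    finally show ?thesis using ip by linarith
  next
    case False
    have "c * (norm w * norm (w + e)) \<le> c * (norm w * ((1 + \<kappa>) * norm w))"
      using False n1 by (intro mult_left_mono) auto
    also have "\<dots> = c * (1 + \<kappa>) * (norm w * norm w)" by (simp add: mult_ac)
    also have "\<dots> < (1 - \<kappa>) * (norm w * norm w)" using c nw by (intro mult_strict_right_mono) auto
    finally show ?thesis using ip by linarith
  qed
  then have less: "c < (w \<bullet> (w + e)) / (norm w * norm (w + e))"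
    using nw n0 by (simp add: pos_less_divide_eq)
  have "w \<bullet> (w + e) \<le> norm w * norm (w + e)" by (rule norm_cauchy_schwarz)
  then have le1: "(w \<bullet> (w + e)) / (norm w * norm (w + e)) \<le> 1"
    using nw n0 by (simp add: pos_divide_le_eq)
  have "vec_angle w (w + e) < arccos c"
    unfolding vec_angle_def using less le1 c1 by (intro arccos_less_arccos) auto
  also have "arccos c = b" unfolding c1(1) using c1 by (intro arccos_cos) auto
  finally show ?thesis .
qed

lemma Zvec_small: "k \<in> Zvec \<Longrightarrow> norm k < 1 \<Longrightarrow> k = 0"
proof -
  assume k: "k \<in> Zvec" "norm k < 1"
  have "k $ i = 0" for i
  proof -
    have "\<bar>k $ i\<bar> < 1" using component_le_norm_cart[of k i] k(2) by linarith
    moreover have "k $ i \<in> \<int>" using k(1) by (simp add: Zvec_def)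
    then obtain j where j: "k $ i = of_int j" by (rule Ints_cases)
    ultimately have "j = 0" by simp
    then show ?thesis using j by simp
  qed
  then show "k = 0" by (simp add: vec_eq_iff)
qed

lemma Zvec_diff: "a \<in> Zvec \<Longrightarrow> b \<in> Zvec \<Longrightarrow> a - b \<in> Zvec"
  by (simp add: Zvec_def)

lemma zero_in_Zvec: "0 \<in> Zvec"
  by (simp add: Zvec_def)

lemma countable_Zvec: "countable Zvec"
proof -
  have "Zvec \<subseteq> range (\<lambda>(i::int, j::int). vector [of_int i, of_int j] :: real^2)"
  proof
    fix k assume k: "k \<in> Zvec"
    have "k $ 1 \<in> \<int>" "k $ 2 \<in> \<int>" using k by (simp_all add: Zvec_def)
    then obtain i j where "k $ 1 = of_int i" "k $ 2 = of_int j"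
      using Ints_cases[of "k $ 1"] Ints_cases[of "k $ 2"] by metis
    then have "k = (\<lambda>(i, j). vector [of_int i, of_int j]) (i, j)"
      by (simp add: vec_eq_iff forall_2)
    then show "k \<in> range (\<lambda>(i::int, j::int). vector [of_int i, of_int j] :: real^2)" by blast
  qed
  then show ?thesis by (rule countable_subset) simp
qed

text \<open>Separability: every point of A is within \<rho> / 2 of some q in a countable dense set,
  and all points of A that near to q share one value, which \<open>g\<close> selects.\<close>

lemma countable_image_locally_constant:
  fixes A :: "(real^2) set" and f :: "real^2 \<Rightarrow> 'b"
  assumes "0 < \<rho>" and f: "\<And>x y. x \<in> A \<Longrightarrow> y \<in> A \<Longrightarrow> dist x y < \<rho> \<Longrightarrow> f x = f y"
  shows "countable (f ` A)"
proof -
  obtain D :: "(real^2) set" where D: "countable D" "\<And>X. open X \<Longrightarrow> X \<noteq> {} \<Longrightarrow> \<exists>d\<in>D. d \<in> X"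
    by (rule countable_dense_setE) (rule that)
  define g where "g q = f (SOME z. z \<in> A \<and> dist q z < \<rho> / 2)" for q
  have "f ` A \<subseteq> g ` D"
  proof
    fix y assume "y \<in> f ` A"
    then obtain z where z: "z \<in> A" "y = f z" by (elim imageE)
    have "open (ball z (\<rho> / 2))" "ball z (\<rho> / 2) \<noteq> {}" using assms(1) by simp_all
    then obtain q where q: "q \<in> D" "q \<in> ball z (\<rho> / 2)" using D(2) by blast
    let ?z = "SOME z. z \<in> A \<and> dist q z < \<rho> / 2"
    have zq: "dist q z < \<rho> / 2" "dist z q < \<rho> / 2" using q(2) by (simp_all add: dist_commute)
    have sz: "?z \<in> A \<and> dist q ?z < \<rho> / 2"
      by (rule someI[of "\<lambda>z. z \<in> A \<and> dist q z < \<rho> / 2" z]) (intro conjI z(1) zq(1))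
    have "dist z ?z \<le> dist z q + dist q ?z" by (rule dist_triangle)
    then have "dist z ?z < \<rho>" using sz zq(2) by linarith
    then have "y = g q" unfolding g_def z(2) by (rule f[OF z(1) conjunct1[OF sz]])
    then show "y \<in> g ` D" by (rule image_eqI[OF _ q(1)])
  qed
  then show ?thesis by (rule countable_subset) (rule countable_image[OF D(1)])
qed

context cone_system
begin

lemma F_taylor: "norm (F n y - F n x - blinfun_apply (DF n x) (y - x)) \<le> C * (norm (y - x))\<^sup>2"
proof -
  have "norm ((F n y - blinfun_apply (DF n x) y) - (F n x - blinfun_apply (DF n x) x)) \<le> (C * norm (y - x)) * norm (y - x)"
  proof (rule differentiable_bound[of "closed_segment x y" _ "\<lambda>z. blinfun_apply (DF n z - DF n x)"])
    fix z assume z: "z \<in> closed_segment x y"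
    show "((\<lambda>y. F n y - blinfun_apply (DF n x) y) has_derivative blinfun_apply (DF n z - DF n x)) (at z within closed_segment x y)"
      unfolding minus_blinfun.rep_eq
      by (rule has_derivative_at_withinI) (intro has_derivative_diff DF bounded_linear_imp_has_derivative blinfun.bounded_linear_right)
    have "norm (DF n z - DF n x) \<le> C * dist z x" by (rule DF_lipschitz)
    also have "\<dots> \<le> C * norm (y - x)"
      using dist_in_closed_segment[OF z] C_ge_1
      by (intro mult_left_mono) (auto simp: dist_norm norm_minus_commute)
    finally show "onorm (blinfun_apply (DF n z - DF n x)) \<le> C * norm (y - x)"
      by (simp only: norm_blinfun.rep_eq)
  qed auto
  then show ?thesis by (simp add: blinfun.bilinear_simps algebra_simps power2_eq_square)
qed

text \<open>Passage from tangent vectors to finite increments. The linear part lands at angle at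
  least \<theta> from the boundary of the cone, and at small distance the quadratic Taylor error can
  neither turn it that far nor undo the expansion.\<close>

lemma local_expansion:
  "\<exists>\<epsilon>>0. \<exists>l>1. \<forall>n x y. y - x \<in> cu x \<longrightarrow> dist x y \<le> \<epsilon> \<longrightarrow>
     F n y - F n x \<in> cu (F n x) \<and> l * dist x y \<le> dist (F n x) (F n y)"
proof -
  \<comment> \<open>Cut off at pi because cosines compare angles only on [0, pi].\<close>
  define b where "b = min \<theta> pi"
  define c where "c = cos b"
  have b: "0 < b" "b \<le> pi" "b \<le> \<theta>" using theta by (auto simp: b_def)
  have c: "c < 1" using cos_monotone_0_pi[of 0 b] b by (simp add: c_def)
  \<comment> \<open>The three bounds give, in order, \<kappa> < 1, a remaining expansion rate \<eta>
    - \<kappa> > 1, and c (1 + \<kappa>) < 1 - \<kappa> as \<open>cos_le_vec_angle\<close>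
    requires.\<close>
  define \<kappa> where "\<kappa> = min (1 / 2) (min ((\<eta> - 1) / 2) ((1 - c) / 4))"
  have k4: "\<kappa> \<le> (1 - c) / 4" unfolding \<kappa>_def by (rule min.coboundedI2, rule min.cobounded2)
  have k3: "\<kappa> \<le> (\<eta> - 1) / 2" unfolding \<kappa>_def by (rule min.coboundedI2, rule min.cobounded1)
  have k12: "0 < \<kappa>" "\<kappa> < 1" using eta c by (auto simp: \<kappa>_def)
  have "4 * \<kappa> \<le> 1 - c" using k4 by (simp add: field_simps)
  note k = k12 k3 this
  have "c * \<kappa> \<le> 1 * \<kappa>" using c k by (intro mult_right_mono) auto
  moreover have "c * (1 + \<kappa>) = c + c * \<kappa>" by (simp add: algebra_simps)
  ultimately have ck: "c * (1 + \<kappa>) < 1 - \<kappa>" using k(1,4) by linarith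
  have C0: "0 < C" using C_ge_1 by simp
  show ?thesis
  proof (rule exI[of _ "\<kappa> / C"], intro conjI, use k C0 in simp, rule exI[of _ "\<eta> - \<kappa>"], intro conjI allI impI)
    show "1 < \<eta> - \<kappa>" using k(3) eta by simp
    fix n x y assume d: "y - x \<in> cu x" and dist: "dist x y \<le> \<kappa> / C"
    define w where "w = blinfun_apply (DF n x) (y - x)"
    define e where "e = F n y - F n x - w"
    have Fe: "F n y - F n x = w + e" by (simp add: e_def)
    have nd: "norm (y - x) \<le> \<kappa> / C" using dist by (simp add: dist_norm norm_minus_commute)
    have "norm e \<le> C * (norm (y - x))\<^sup>2" unfolding e_def w_def by (rule F_taylor)
    also have "\<dots> = (C * norm (y - x)) * norm (y - x)" by (simp add: power2_eq_square)
    also have "\<dots> \<le> \<kappa> * norm (y - x)"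
      using nd C0 by (intro mult_right_mono) (auto simp: pos_le_divide_eq mult.commute)
    finally have e1: "norm e \<le> \<kappa> * norm (y - x)" .
    have w1: "\<eta> * norm (y - x) \<le> norm w" unfolding w_def by (rule expand_F[OF d])
    have "1 * norm (y - x) \<le> \<eta> * norm (y - x)" using eta by (intro mult_right_mono) auto
    then have "norm (y - x) \<le> norm w" using w1 by simp
    then have e2: "norm e \<le> \<kappa> * norm w" using e1 mult_left_mono[of "norm (y - x)" "norm w" \<kappa>] k(1) by linarith
    have "(\<eta> - \<kappa>) * norm (y - x) \<le> norm w - norm e" using w1 e1 by (simp add: algebra_simps)
    also have "\<dots> \<le> norm (w + e)" using norm_diff_ineq[of w e] by simp
    finally show "(\<eta> - \<kappa>) * dist x y \<le> dist (F n x) (F n y)"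
      by (simp add: dist_norm norm_minus_commute[of x y] norm_minus_commute[of "F n x"] Fe)
    show "F n y - F n x \<in> cu (F n x)"
    proof (cases "y = x")
      case False
      then have yx: "y - x \<noteq> 0" by simp
      have wc: "w \<in> cu (F n x)" unfolding w_def by (rule DF_cu[OF d])
      have w0: "w \<noteq> 0" using \<open>norm (y - x) \<le> norm w\<close> yx by auto
      show ?thesis
      proof (rule ccontr)
        assume "F n y - F n x \<notin> cu (F n x)"
        then have "w + e \<notin> cu (F n x)" by (simp add: Fe)
        \<comment> \<open>A segment leaving the cone meets its frontier at some w + t e. This is
          again a perturbation of relative size at most \<kappa>, so the uniform angle gap excludes
          it.\<close>
        then have "closed_segment w (w + e) \<inter> frontier (cu (F n x)) \<noteq> {}"
          using wc by (intro connected_Int_frontier) (auto intro: connected_segment)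
        then obtain u where u: "u \<in> closed_segment w (w + e)" "u \<in> frontier (cu (F n x))" by blast
        obtain t where t: "0 \<le> t" "t \<le> 1" "u = (1 - t) *\<^sub>R w + t *\<^sub>R (w + e)"
          using u(1) by (auto simp: in_segment)
        have ut: "u = w + t *\<^sub>R e" unfolding t(3) by (simp add: algebra_simps)
        have te: "norm (t *\<^sub>R e) \<le> \<kappa> * norm w"
          using t e2 mult_right_mono[of t 1 "norm e"] by simp
        have "\<kappa> * norm w < 1 * norm w" using k w0 by (intro mult_strict_right_mono) auto
        then have "u \<noteq> 0" using te norm_diff_ineq[of w "t *\<^sub>R e"] unfolding ut by auto
        then have "\<theta> \<le> vec_angle w u" unfolding w_def using angle_F[OF d yx u(2)] by simp
        moreover have "vec_angle w u < b" unfolding ut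
          by (rule cos_le_vec_angle[OF w0 te _ k(2) ck c_def]) (use k b in auto)
        ultimately show False using b by simp
      qed
    qed simp
  qed
qed

text \<open>While orbits stay within the radius of \<open>local_expansion\<close>, their difference
  remains in the unstable cone and grows like l^n, so a bounded difference must vanish.\<close>

lemma expansive_on_unstable_cone:
  "\<exists>\<epsilon>>0. \<forall>x y. y - x \<in> cu x \<longrightarrow> (\<forall>n. dist (orb 0 n x) (orb 0 n y) \<le> \<epsilon>) \<longrightarrow> y = x"
proof -
  obtain \<epsilon> l where e: "\<epsilon> > 0" "l > 1" and step: "\<And>n x y. y - x \<in> cu x \<Longrightarrow> dist x y \<le> \<epsilon> \<Longrightarrow>
     F n y - F n x \<in> cu (F n x) \<and> l * dist x y \<le> dist (F n x) (F n y)"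
    using local_expansion by blast
  show ?thesis
  proof (intro exI[of _ \<epsilon>] conjI e(1) allI impI)
    fix x y assume d: "y - x \<in> cu x" and close: "\<forall>n. dist (orb 0 n x) (orb 0 n y) \<le> \<epsilon>"
    have grow: "orb 0 n y - orb 0 n x \<in> cu (orb 0 n x) \<and> l ^ n * dist x y \<le> dist (orb 0 n x) (orb 0 n y)" for n
    proof (induction n)
      case (Suc n)
      have s: "F n (orb 0 n y) - F n (orb 0 n x) \<in> cu (F n (orb 0 n x))"
        "l * dist (orb 0 n x) (orb 0 n y) \<le> dist (F n (orb 0 n x)) (F n (orb 0 n y))"
        using step[of "orb 0 n y" "orb 0 n x" n] Suc close by auto
      have "l ^ Suc n * dist x y \<le> l * dist (orb 0 n x) (orb 0 n y)"
        using mult_left_mono[of _ _ l] Suc e(2) by (simp add: mult.assoc)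
      then show ?case using s by simp
    qed (simp add: d)
    show "y = x"
    proof (rule ccontr)
      assume "y \<noteq> x"
      then have pos: "dist x y > 0" by simp
      obtain n where "\<epsilon> / dist x y < l ^ n" using real_arch_pow[OF e(2)] by blast
      then have "\<epsilon> < l ^ n * dist x y" using pos by (simp add: pos_divide_less_eq)
      then show False using grow[of n] close by (meson not_le order_trans)
    qed
  qed
qed

text \<open>By Cramer's rule, positivity of the continuous function \<open>f\<close> at x puts
  \<open>h p\<close> in the cone at x. At x = p its second term vanishes and the first is
  positive.\<close>

lemma unstable_near: "\<exists>\<rho>>0. \<forall>x\<in>ball p \<rho>. h p \<in> cu x"
proof -
  obtain c where c: "c > 0" "\<And>x. c \<le> \<bar>wedge (h x) (v x)\<bar>" using wedge_hv by auto
  define f where "f x = \<mu> * \<bar>wedge (h p) (v x)\<bar> - \<bar>wedge (h x) (h p)\<bar>" for x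
  have "continuous_on UNIV f"
    unfolding f_def[abs_def]
    by (intro continuous_on_diff continuous_on_mult continuous_on_rabs wedge.continuous_on continuous_on_const h_cont v_cont)
  then have "isCont f p" by (simp add: continuous_on_eq_continuous_at)
  moreover have "0 < f p" using c(1) c(2)[of p] mu by (simp add: f_def)
  ultimately have "\<forall>\<^sub>F x in nhds p. 0 < f x"
    by (intro order_tendstoD(1)[of f "f p"]) (simp_all add: isCont_def tendsto_at_iff_tendsto_nhds)
  then obtain \<rho> where \<rho>: "\<rho> > 0" "\<And>x. dist x p < \<rho> \<Longrightarrow> 0 < f x"
    unfolding eventually_nhds_metric by blast
  have "h p \<in> cu x" if "x \<in> ball p \<rho>" for x
  proof -
    let ?W = "wedge (h x) (v x)"
    have W: "?W \<noteq> 0" using c(1) c(2)[of x] by auto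
    have "0 < f x" using \<rho>(2)[of x] that by (simp add: dist_commute)
    then have le: "\<bar>wedge (h x) (h p)\<bar> \<le> \<mu> * \<bar>wedge (h p) (v x)\<bar>" by (simp add: f_def)
    have "h p = (wedge (h p) (v x) / ?W) *\<^sub>R h x + (wedge (h x) (h p) / ?W) *\<^sub>R v x"
      by (rule wedge_decompose[OF W])
    moreover have "\<bar>wedge (h x) (h p) / ?W\<bar> \<le> \<mu> * \<bar>wedge (h p) (v x) / ?W\<bar>"
      using divide_right_mono[OF le, of "\<bar>?W\<bar>"] by (simp add: abs_divide)
    ultimately show ?thesis unfolding cone_u_def by blast
  qed
  then show ?thesis using \<rho>(1) by blast
qed

end

text \<open>The ball of radius 3 r contains the parallelogram of coordinates at most r, whose points
  are at distance at most 2 r from p. With r \<le> 1 / 8 any two points of the ball have distance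
  below 1, the range of the Hoelder estimates.\<close>

locale cone_chart = cone_system +
  fixes p :: "real^2" and r B L \<delta> :: real
  assumes unstable: "x \<in> ball p (3 * r) \<Longrightarrow> h p \<in> cone_u h v \<mu> x" and r_small: "r \<le> 1 / 8"
    and flow: "scalar_flow (\<lambda>a t. sigl (h p) (v p) (p + a *\<^sub>R h p + t *\<^sub>R v p))
      (\<lambda>a t. dsigl (h p) (v p) (p + a *\<^sub>R h p + t *\<^sub>R v p)) r B L \<delta>"

lemma (in cone_system) cone_chart_exists:
  "\<exists>r B L \<delta>. cone_chart F G DF DG D2F C \<mu> \<eta> \<theta> h v p r B L \<delta>"
proof -
  obtain \<rho> where \<rho>: "\<rho> > 0" "\<And>x. x \<in> ball p \<rho> \<Longrightarrow> h p \<in> cu x" using unstable_near by blast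
  define r where "r = min (\<rho> / 3) (1 / 8)"
  have r: "0 < r" "3 * r \<le> \<rho>" "r \<le> 1 / 8" using \<rho> by (auto simp: r_def)
  have un: "h p \<in> cu x" if "x \<in> ball p (3 * r)" for x
    using \<rho>(2)[of x] that r by auto
  let ?pt = "\<lambda>a t. p + a *\<^sub>R h p + t *\<^sub>R v p"
  let ?s = "\<lambda>a t. sigl (h p) (v p) (?pt a t)" and ?ds = "\<lambda>a t. dsigl (h p) (v p) (?pt a t)"
  let ?Q = "{-r..r} \<times> {-r..r}"
  have inb: "?pt a t \<in> ball p (3 * r)" if "a \<in> {-r..r}" "t \<in> {-r..r}" for a t
  proof -
    have "norm (a *\<^sub>R h p + t *\<^sub>R v p) \<le> \<bar>a\<bar> + \<bar>t\<bar>"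
      using norm_triangle_ineq[of "a *\<^sub>R h p" "t *\<^sub>R v p"] by simp
    also have "\<dots> < 3 * r" using that r by auto
    finally have "norm (a *\<^sub>R h p + t *\<^sub>R v p) < 3 * r" .
    moreover have "dist p (?pt a t) = norm (a *\<^sub>R h p + t *\<^sub>R v p)"
      unfolding dist_norm norm_minus_commute[of p] by (simp add: add.assoc)
    ultimately show ?thesis by simp
  qed
  note reg = sigl_regular[OF open_ball un norm_h[of p] norm_v[of p]]
  have ptc: "continuous_on ?Q (\<lambda>q. ?pt (fst q) (snd q))" by (intro continuous_intros)
  have sub: "(\<lambda>q. ?pt (fst q) (snd q)) ` ?Q \<subseteq> ball p (3 * r)" using inb by auto
  have sc: "continuous_on ?Q (\<lambda>q. ?s (fst q) (snd q))"
    by (rule continuous_on_compose2[OF reg(1) ptc sub]) simp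
  have dsc: "continuous_on ?Q (\<lambda>q. ?ds (fst q) (snd q))"
    by (rule continuous_on_compose2[OF reg(2) ptc sub]) simp
  have cQ: "compact ?Q" by (intro compact_Times compact_Icc)
  obtain B where B: "B > 0" "\<And>q. q \<in> ?Q \<Longrightarrow> \<bar>?s (fst q) (snd q)\<bar> \<le> B"
  proof -
    from compact_imp_bounded[OF compact_continuous_image[OF sc cQ], unfolded bounded_pos]
    obtain B where "B > 0" "\<forall>x\<in>(\<lambda>q. ?s (fst q) (snd q)) ` ?Q. norm x \<le> B" by (elim exE conjE)
    then show thesis by (intro that[of B]) (simp_all only: ball_simps real_norm_def)
  qed
  obtain L where L: "L > 0" "\<And>q. q \<in> ?Q \<Longrightarrow> \<bar>?ds (fst q) (snd q)\<bar> \<le> L"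
  proof -
    from compact_imp_bounded[OF compact_continuous_image[OF dsc cQ], unfolded bounded_pos]
    obtain L where "L > 0" "\<forall>x\<in>(\<lambda>q. ?ds (fst q) (snd q)) ` ?Q. norm x \<le> L" by (elim exE conjE)
    then show thesis by (intro that[of L]) (simp_all only: ball_simps real_norm_def)
  qed
  define \<delta> where "\<delta> = min (r / 2) (min (r / (6 * B)) (1 / (4 * L)))"
  have "\<delta> \<le> r / (6 * B)" "\<delta> \<le> 1 / (4 * L)" by (auto simp: \<delta>_def)
  then have d: "0 < \<delta>" "\<delta> \<le> r / 2" "6 * \<delta> * B \<le> r" "4 * \<delta> * L \<le> 1"
  proof -
    assume 1: "\<delta> \<le> r / (6 * B)" "\<delta> \<le> 1 / (4 * L)"
    show "0 < \<delta>" "\<delta> \<le> r / 2" using r(1) B(1) L(1) by (auto simp: \<delta>_def)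
    have "\<delta> * (6 * B) \<le> r" "\<delta> * (4 * L) \<le> 1"
      using 1 B(1) L(1) by (simp_all only: pos_le_divide_eq zero_less_mult_iff zero_less_numeral simp_thms)
    then show "6 * \<delta> * B \<le> r" "4 * \<delta> * L \<le> 1" by (simp_all add: mult_ac)
  qed
  have der: "((\<lambda>a. ?s a t) has_real_derivative ?ds a t) (at a within {-r..r})" if "a \<in> {-r..r}" "t \<in> {-r..r}" for a t
  proof -
    have "((\<lambda>b. sigl (h p) (v p) (?pt a t + b *\<^sub>R h p)) has_real_derivative ?ds a t) (at 0)"
      by (rule reg(3)[OF _ inb[OF that]])
    moreover have "?pt a t + b *\<^sub>R h p = ?pt (a + b) t" for b by (simp add: algebra_simps)
    ultimately have "((\<lambda>b. ?s (a + b) t) has_real_derivative ?ds a t) (at 0)" by simp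
    then have "((\<lambda>b. ?s b t) has_real_derivative ?ds a t) (at a)"
      using DERIV_shift[of "\<lambda>b. ?s b t" _ 0 a] by (simp add: add.commute)
    then show ?thesis by (rule has_field_derivative_at_within)
  qed
  have "scalar_flow ?s ?ds r B L \<delta>"
  proof
    fix a t assume at: "a \<in> {-r..r}" "t \<in> {-r..r}"
    then have "(a, t) \<in> ?Q" by simp
    from B(2)[OF this] L(2)[OF this] show "\<bar>?s a t\<bar> \<le> B" "\<bar>?ds a t\<bar> \<le> L" by simp_all
    show "((\<lambda>a. ?s a t) has_real_derivative ?ds a t) (at a within {-r..r})" by (rule der[OF at])
  qed (fact r d sc dsc)+
  then have "cone_chart F G DF DG D2F C \<mu> \<eta> \<theta> h v p r B L \<delta>"
    by (intro cone_chart.intro cone_chart_axioms.intro cone_system_axioms un r(3))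
  then show ?thesis by blast
qed

section \<open>Foliation charts\<close>

definition row :: "2 \<Rightarrow> real^2 \<Rightarrow> (real^2) \<Rightarrow>\<^sub>L (real^2)" where
  "row i x = Blinfun (\<lambda>\<zeta>. \<zeta> $ i *\<^sub>R x)"

lemma row_apply [simp]: "blinfun_apply (row i x) \<zeta> = \<zeta> $ i *\<^sub>R x"
  unfolding row_def
  by (subst bounded_linear_Blinfun_apply)
     (intro bounded_linear_compose[OF bounded_linear_scaleR_left] bounded_linear_vec_nth, simp)

definition wedge_row :: "real^2 \<Rightarrow> real^2 \<Rightarrow> (real^2) \<Rightarrow>\<^sub>L (real^2)" where
  "wedge_row a x = Blinfun (\<lambda>\<zeta>. wedge a \<zeta> *\<^sub>R x)"

lemma wedge_row_apply [simp]: "blinfun_apply (wedge_row a x) \<zeta> = wedge a \<zeta> *\<^sub>R x"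
  unfolding wedge_row_def
  by (subst bounded_linear_Blinfun_apply)
     (intro bounded_linear_compose[OF bounded_linear_scaleR_left] wedge.bounded_linear_right, simp)

definition scalar_holder :: "real \<Rightarrow> 'a::metric_space set \<Rightarrow> ('a \<Rightarrow> real) \<Rightarrow> bool" where
  "scalar_holder \<alpha> S f \<longleftrightarrow> (\<exists>C\<ge>0. \<forall>x\<in>S. \<forall>y\<in>S. \<bar>f x - f y\<bar> \<le> C * dist x y powr \<alpha>)"

lemma scalar_holderI:
  "0 \<le> C \<Longrightarrow> (\<And>x y. x \<in> S \<Longrightarrow> y \<in> S \<Longrightarrow> \<bar>f x - f y\<bar> \<le> C * dist x y powr \<alpha>) \<Longrightarrow> scalar_holder \<alpha> S f"
  unfolding scalar_holder_def by blast

lemma scalar_holderE: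
  assumes "scalar_holder \<alpha> S f"
  obtains C where "0 \<le> C" "\<And>x y. x \<in> S \<Longrightarrow> y \<in> S \<Longrightarrow> \<bar>f x - f y\<bar> \<le> C * dist x y powr \<alpha>"
  using assms unfolding scalar_holder_def by blast

lemma scalar_holder_mult:
  assumes f: "scalar_holder \<alpha> S f" "\<And>x. x \<in> S \<Longrightarrow> \<bar>f x\<bar> \<le> A"
    and g: "scalar_holder \<alpha> S g" "\<And>x. x \<in> S \<Longrightarrow> \<bar>g x\<bar> \<le> B"
  shows "scalar_holder \<alpha> S (\<lambda>x. f x * g x)"
proof -
  obtain C where C: "0 \<le> C" "\<And>x y. x \<in> S \<Longrightarrow> y \<in> S \<Longrightarrow> \<bar>f x - f y\<bar> \<le> C * dist x y powr \<alpha>"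
    by (rule scalar_holderE[OF f(1)]) (rule that)
  obtain D where D: "0 \<le> D" "\<And>x y. x \<in> S \<Longrightarrow> y \<in> S \<Longrightarrow> \<bar>g x - g y\<bar> \<le> D * dist x y powr \<alpha>"
    by (rule scalar_holderE[OF g(1)]) (rule that)
  show ?thesis
  proof (rule scalar_holderI[of "\<bar>A\<bar> * D + C * \<bar>B\<bar>"])
    show "0 \<le> \<bar>A\<bar> * D + C * \<bar>B\<bar>" using C(1) D(1) by simp
    fix x y assume x: "x \<in> S" and y: "y \<in> S"
    have A: "\<bar>f x\<bar> \<le> \<bar>A\<bar>" and B: "\<bar>g y\<bar> \<le> \<bar>B\<bar>" using f(2)[OF x] g(2)[OF y] by linarith+
    have "f x * g x - f y * g y = f x * (g x - g y) + (f x - f y) * g y" by (simp add: algebra_simps)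
    then have "\<bar>f x * g x - f y * g y\<bar> \<le> \<bar>f x\<bar> * \<bar>g x - g y\<bar> + \<bar>f x - f y\<bar> * \<bar>g y\<bar>"
      by (simp only: abs_mult[symmetric] abs_triangle_ineq)
    also have "\<dots> \<le> \<bar>A\<bar> * (D * dist x y powr \<alpha>) + (C * dist x y powr \<alpha>) * \<bar>B\<bar>"
      by (intro add_mono mult_mono A B C D x y mult_nonneg_nonneg) auto
    finally show "\<bar>f x * g x - f y * g y\<bar> \<le> (\<bar>A\<bar> * D + C * \<bar>B\<bar>) * dist x y powr \<alpha>"
      by (simp add: algebra_simps)
  qed
qed

lemma scalar_holder_inverse:
  assumes f: "scalar_holder \<alpha> S f" "\<And>x. x \<in> S \<Longrightarrow> b \<le> f x" and b: "0 < b"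
  shows "scalar_holder \<alpha> S (\<lambda>x. inverse (f x))"
proof -
  obtain C where C: "0 \<le> C" "\<And>x y. x \<in> S \<Longrightarrow> y \<in> S \<Longrightarrow> \<bar>f x - f y\<bar> \<le> C * dist x y powr \<alpha>"
    by (rule scalar_holderE[OF f(1)]) (rule that)
  show ?thesis
  proof (rule scalar_holderI[of "C / (b * b)"])
    show "0 \<le> C / (b * b)" using C(1) by simp
    fix x y assume x: "x \<in> S" and y: "y \<in> S"
    have fx: "b \<le> f x" "b \<le> f y" using f(2) x y by auto
    have bb: "b * b \<le> f x * f y" using fx b by (intro mult_mono) auto
    have "inverse (f x) - inverse (f y) = - (f x - f y) / (f x * f y)"
      using fx b by (simp add: field_simps)
    moreover have "0 < f x * f y" using fx b by (intro mult_pos_pos) auto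
    ultimately have "\<bar>inverse (f x) - inverse (f y)\<bar> = \<bar>f x - f y\<bar> / (f x * f y)"
      by (simp only: abs_divide abs_minus_cancel abs_of_pos)
    also have "\<dots> \<le> (C * dist x y powr \<alpha>) / (b * b)"
      using bb b C(1) by (intro frac_le C(2) x y) auto
    finally show "\<bar>inverse (f x) - inverse (f y)\<bar> \<le> C / (b * b) * dist x y powr \<alpha>" by simp
  qed
qed

lemma scalar_holder_compose:
  assumes f: "scalar_holder \<alpha> T f" and g: "\<And>x. x \<in> S \<Longrightarrow> g x \<in> T"
    "\<And>x y. x \<in> S \<Longrightarrow> y \<in> S \<Longrightarrow> dist (g x) (g y) \<le> K * dist x y" and K: "0 \<le> K" and a: "0 \<le> \<alpha>"
  shows "scalar_holder \<alpha> S (\<lambda>x. f (g x))"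
proof -
  obtain C where C: "0 \<le> C" "\<And>x y. x \<in> T \<Longrightarrow> y \<in> T \<Longrightarrow> \<bar>f x - f y\<bar> \<le> C * dist x y powr \<alpha>"
    by (rule scalar_holderE[OF f(1)]) (rule that)
  show ?thesis
  proof (rule scalar_holderI[of "C * K powr \<alpha>"])
    show "0 \<le> C * K powr \<alpha>" using C(1) by simp
    fix x y assume x: "x \<in> S" and y: "y \<in> S"
    have "\<bar>f (g x) - f (g y)\<bar> \<le> C * dist (g x) (g y) powr \<alpha>" by (intro C g(1) x y)
    also have "\<dots> \<le> C * (K * dist x y) powr \<alpha>"
      using C(1) a by (intro mult_left_mono powr_mono2 g(2) x y) auto
    also have "\<dots> = C * K powr \<alpha> * dist x y powr \<alpha>" using K by (simp add: powr_mult)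
    finally show "\<bar>f (g x) - f (g y)\<bar> \<le> C * K powr \<alpha> * dist x y powr \<alpha>" .
  qed
qed

lemma scalar_holder_const: "scalar_holder \<alpha> S (\<lambda>x. c)"
  by (rule scalar_holderI[of 0]) auto

text \<open>The derivatives of a chart and of its inverse are combinations of three constant
  rank-one maps, so their regularity reduces to that of the scalar coefficients.\<close>

lemma holder_on_combination:
  assumes "scalar_holder \<alpha> S f" "scalar_holder \<alpha> S g" "scalar_holder \<alpha> S k"
  shows "holder_on \<alpha> S (\<lambda>x. f x *\<^sub>R P + g x *\<^sub>R Q + k x *\<^sub>R R)"
proof -
  obtain A where A: "0 \<le> A" "\<And>x y. x \<in> S \<Longrightarrow> y \<in> S \<Longrightarrow> \<bar>f x - f y\<bar> \<le> A * dist x y powr \<alpha>"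
    by (rule scalar_holderE[OF assms(1)]) (rule that)
  obtain B where B: "0 \<le> B" "\<And>x y. x \<in> S \<Longrightarrow> y \<in> S \<Longrightarrow> \<bar>g x - g y\<bar> \<le> B * dist x y powr \<alpha>"
    by (rule scalar_holderE[OF assms(2)]) (rule that)
  obtain C where C: "0 \<le> C" "\<And>x y. x \<in> S \<Longrightarrow> y \<in> S \<Longrightarrow> \<bar>k x - k y\<bar> \<le> C * dist x y powr \<alpha>"
    by (rule scalar_holderE[OF assms(3)]) (rule that)
  show ?thesis
    unfolding holder_on_def
  proof (intro exI[of _ "A * norm P + B * norm Q + C * norm R"] ballI)
    fix x y assume x: "x \<in> S" and y: "y \<in> S"
    have "(f x *\<^sub>R P + g x *\<^sub>R Q + k x *\<^sub>R R) - (f y *\<^sub>R P + g y *\<^sub>R Q + k y *\<^sub>R R)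
       = (f x - f y) *\<^sub>R P + (g x - g y) *\<^sub>R Q + (k x - k y) *\<^sub>R R"
      by (simp add: algebra_simps)
    also have "norm \<dots> \<le> \<bar>f x - f y\<bar> * norm P + \<bar>g x - g y\<bar> * norm Q + \<bar>k x - k y\<bar> * norm R"
      by (intro norm_triangle_le add_mono) auto
    also have "\<dots> \<le> A * dist x y powr \<alpha> * norm P + B * dist x y powr \<alpha> * norm Q + C * dist x y powr \<alpha> * norm R"
      by (intro add_mono mult_right_mono A B C x y norm_ge_zero)
    finally show "norm ((f x *\<^sub>R P + g x *\<^sub>R Q + k x *\<^sub>R R) - (f y *\<^sub>R P + g y *\<^sub>R Q + k y *\<^sub>R R))
        \<le> (A * norm P + B * norm Q + C * norm R) * dist x y powr \<alpha>"
      by (simp add: algebra_simps)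
  qed
qed

lemma norm_vec2_le: "norm (x::real^2) \<le> \<bar>x $ 1\<bar> + \<bar>x $ 2\<bar>"
  using norm_le_l1_cart[of x] by (simp add: sum_2)

lemma connected_unit_box_slice: "connected {w \<in> unit_box. w $ 2 = c}"
proof (rule convex_connected, rule convexI)
  fix x y :: "real^2" and a b :: real
  assume x: "x \<in> {w \<in> unit_box. w $ 2 = c}" and y: "y \<in> {w \<in> unit_box. w $ 2 = c}"
    and ab: "0 \<le> a" "0 \<le> b" "a + b = 1"
  have "-1 < a * x $ i + b * y $ i \<and> a * x $ i + b * y $ i < 1" for i
  proof -
    have "x $ i \<in> {-1<..<1}" "y $ i \<in> {-1<..<1}" using x y by (auto simp: unit_box_def)
    then have "a *\<^sub>R x $ i + b *\<^sub>R y $ i \<in> {-1<..<1::real}"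
      using convex_real_interval(8)[of "-1::real" 1] ab unfolding convex_def by blast
    then show ?thesis by simp
  qed
  moreover have "a * c + b * c = c" using ab(3) by (simp add: distrib_right[symmetric])
  ultimately show "a *\<^sub>R x + b *\<^sub>R y \<in> {w \<in> unit_box. w $ 2 = c}"
    using x y by (auto simp: unit_box_def)
qed

lemma open_unit_box: "open unit_box"
proof -
  have eq: "unit_box = (\<Inter>i\<in>UNIV. {z::real^2. -1 < z $ i} \<inter> {z. z $ i < 1})"
    by (auto simp: unit_box_def)
  show ?thesis
    unfolding eq by (intro open_INT open_Int finite_class.finite_UNIV ballI open_halfspace_component_gt_cart open_halfspace_component_lt_cart)
qed

lemma lipschitz_continuous_on:
  fixes f :: "'a::metric_space \<Rightarrow> 'b::metric_space"
  assumes "0 \<le> K" "\<And>x y. x \<in> S \<Longrightarrow> y \<in> S \<Longrightarrow> dist (f x) (f y) \<le> K * dist x y"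
  shows "continuous_on S f"
  by (rule lipschitz_on_continuous_on[of K]) (rule lipschitz_onI, use assms in auto)

section \<open>The flow box as a foliation chart\<close>

context cone_chart
begin

abbreviation "hp \<equiv> h p"
abbreviation "vp \<equiv> v p"

definition pt :: "real \<Rightarrow> real \<Rightarrow> real^2" where
  "pt a t = p + a *\<^sub>R hp + t *\<^sub>R vp"

sublocale scalar_flow "\<lambda>a t. sigl hp vp (pt a t)" "\<lambda>a t. dsigl hp vp (pt a t)" r B L \<delta>
  unfolding pt_def by (rule flow)

definition "W = wedge hp vp"

lemma W_nonzero: "W \<noteq> 0"
  using wedge_hv unfolding W_def by (metis abs_zero not_le)

text \<open>\<open>ca\<close> and \<open>ct\<close> are the affine coordinates along
  \<open>hp\<close> and \<open>vp\<close> by Cramer's rule, inverse to \<open>pt\<close>.\<close>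

definition "ca z = wedge (z - p) vp / W"
definition "ct z = wedge hp (z - p) / W"

lemma ca_pt [simp]: "ca (pt a t) = a"
  using W_nonzero by (simp add: ca_def pt_def wedge.add_left wedge.scaleR_left W_def)

lemma ct_pt [simp]: "ct (pt a t) = t"
  using W_nonzero by (simp add: ct_def pt_def wedge.add_right wedge.scaleR_right W_def)

lemma ct_lipschitz: "\<bar>ct z - ct z'\<bar> \<le> dist z z' / \<bar>W\<bar>"
proof -
  have "ct z - ct z' = wedge hp (z - z') / W"
    unfolding ct_def by (simp add: diff_divide_distrib[symmetric] wedge.diff_right)
  then show ?thesis using abs_wedge_le[of hp "z - z'"] by (simp add: abs_divide divide_right_mono dist_norm)
qed

lemma ca_lipschitz: "\<bar>ca z - ca z'\<bar> \<le> dist z z' / \<bar>W\<bar>"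
proof -
  have "ca z - ca z' = wedge (z - z') vp / W"
    unfolding ca_def by (simp add: diff_divide_distrib[symmetric] wedge.diff_left)
  then show ?thesis using abs_wedge_le[of "z - z'" vp] by (simp add: abs_divide divide_right_mono dist_norm)
qed

lemma pt_diff: "pt a t - pt a' t' = (a - a') *\<^sub>R hp + (t - t') *\<^sub>R vp"
  by (simp add: pt_def algebra_simps)

lemma pt_lipschitz: "dist (pt a t) (pt a' t') \<le> \<bar>a - a'\<bar> + \<bar>t - t'\<bar>"
  unfolding dist_norm pt_diff using norm_triangle_ineq[of "(a - a') *\<^sub>R hp" "(t - t') *\<^sub>R vp"] by simp

lemma pt_in_ball: "a \<in> {-r..r} \<Longrightarrow> t \<in> {-r..r} \<Longrightarrow> pt a t \<in> ball p (3 * r)"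
proof -
  assume "a \<in> {-r..r}" "t \<in> {-r..r}"
  then have "dist (pt 0 0) (pt a t) < 3 * r"
    using pt_lipschitz[of 0 0 a t] r by auto
  then show ?thesis by (simp add: pt_def)
qed

abbreviation "\<rho> \<equiv> r / 2"

text \<open>The first box coordinate is time and the second the initial value, so plaques are images
  of horizontal slices. The scaling keeps initial values below r / 2, where solutions exist for all
  times up to \<delta>.\<close>

definition psi :: "real^2 \<Rightarrow> real^2" where
  "psi w = pt (X (\<rho> * w $ 2) (\<delta> * w $ 1)) (\<delta> * w $ 1)"

lemma box_params:
  assumes "w \<in> unit_box"
  shows "\<bar>\<rho> * w $ 2\<bar> < r / 2" "\<bar>\<rho> * w $ 2\<bar> \<le> r / 2" "\<bar>\<delta> * w $ 1\<bar> < \<delta>" "\<delta> * w $ 1 \<in> {-\<delta>..\<delta>}"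
proof -
  have a: "\<bar>w $ 1\<bar> < 1" "\<bar>w $ 2\<bar> < 1" using assms by (auto simp: unit_box_def abs_less_iff)
  have "\<rho> * \<bar>w $ 2\<bar> < \<rho> * 1" using a r by (intro mult_strict_left_mono) auto
  then show 1: "\<bar>\<rho> * w $ 2\<bar> < r / 2" using r by (simp add: abs_mult)
  then show "\<bar>\<rho> * w $ 2\<bar> \<le> r / 2" by simp
  have "\<delta> * \<bar>w $ 1\<bar> < \<delta> * 1" using a delta by (intro mult_strict_left_mono) auto
  then show 2: "\<bar>\<delta> * w $ 1\<bar> < \<delta>" using delta by (simp add: abs_mult)
  show "\<delta> * w $ 1 \<in> {-\<delta>..\<delta>}"
    unfolding atLeastAtMost_iff using 2 by (intro conjI) linarith+
qed

lemma psi_in_ball: "w \<in> unit_box \<Longrightarrow> psi w \<in> ball p (3 * r)"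
  unfolding psi_def by (intro pt_in_ball X(2) time_in box_params)

lemma psi_unstable: "w \<in> unit_box \<Longrightarrow> hp \<in> cu (psi w)"
  by (intro unstable psi_in_ball)

definition "Lpsi = M * \<rho> + B * \<delta> + \<delta>"

lemma Lpsi_nonneg: "0 \<le> Lpsi"
  using M_ge_1 B_nonneg r delta by (simp add: Lpsi_def)

lemma psi_lipschitz:
  assumes w: "w \<in> unit_box" "w' \<in> unit_box"
  shows "dist (psi w) (psi w') \<le> Lpsi * dist w w'"
proof -
  have c1: "\<bar>w $ i - w' $ i\<bar> \<le> dist w w'" for i
    using component_le_norm_cart[of "w - w'" i] by (simp add: dist_norm)
  have d2: "\<bar>\<rho> * w $ 2 - \<rho> * w' $ 2\<bar> \<le> \<rho> * dist w w'"
    unfolding right_diff_distrib[symmetric] abs_mult using c1[of 2] r by (simp add: mult_left_mono)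
  have d1: "\<bar>\<delta> * w $ 1 - \<delta> * w' $ 1\<bar> \<le> \<delta> * dist w w'"
    unfolding right_diff_distrib[symmetric] abs_mult using c1[of 1] delta by (simp add: mult_left_mono)
  have "dist (psi w) (psi w') \<le> (M * \<bar>\<rho> * w $ 2 - \<rho> * w' $ 2\<bar> + B * \<bar>\<delta> * w $ 1 - \<delta> * w' $ 1\<bar>) + \<bar>\<delta> * w $ 1 - \<delta> * w' $ 1\<bar>"
    unfolding psi_def
    by (rule order_trans[OF pt_lipschitz add_right_mono]) (intro X_lipschitz box_params w)
  also have "\<dots> \<le> (M * (\<rho> * dist w w') + B * (\<delta> * dist w w')) + \<delta> * dist w w'"
    using M_ge_1 B_nonneg by (intro add_mono mult_left_mono d1 d2) auto
  finally show ?thesis by (simp add: Lpsi_def algebra_simps)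
qed

definition "Lphi = 1 / (\<bar>W\<bar> * \<delta>) + M * (1 + B) / (\<bar>W\<bar> * \<rho>)"

lemma Lphi_nonneg: "0 \<le> Lphi"
  using M_ge_1 B_nonneg r delta by (simp add: Lphi_def)

text \<open>Time is recovered linearly by \<open>ct\<close>. The states, recovered by
  \<open>ca\<close>, are first moved to a common time by the Lipschitz bound in time; then
  Gronwall's estimate runs back to the initial values.\<close>

lemma psi_expand:
  assumes w: "w \<in> unit_box" "w' \<in> unit_box"
  shows "dist w w' \<le> Lphi * dist (psi w) (psi w')"
proof -
  let ?c = "\<rho> * w $ 2" and ?t = "\<delta> * w $ 1" and ?c' = "\<rho> * w' $ 2" and ?t' = "\<delta> * w' $ 1"
  let ?d = "dist (psi w) (psi w')"
  have W0: "0 < \<bar>W\<bar>" using W_nonzero by simp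
  have t: "\<bar>?t - ?t'\<bar> \<le> ?d / \<bar>W\<bar>" using ct_lipschitz[of "psi w" "psi w'"] by (simp add: psi_def)
  have a: "\<bar>X ?c ?t - X ?c' ?t'\<bar> \<le> ?d / \<bar>W\<bar>" using ca_lipschitz[of "psi w" "psi w'"] by (simp add: psi_def)
  have "\<bar>X ?c' ?t' - X ?c' ?t\<bar> \<le> B * \<bar>?t' - ?t\<bar>"
    by (intro X_time_lipschitz box_params w)
  also have "\<dots> \<le> B * (?d / \<bar>W\<bar>)" using t B_nonneg by (intro mult_left_mono) (auto simp: abs_minus_commute)
  finally have "\<bar>X ?c ?t - X ?c' ?t\<bar> \<le> ?d / \<bar>W\<bar> + B * (?d / \<bar>W\<bar>)" using a by linarith
  then have "M * \<bar>X ?c ?t - X ?c' ?t\<bar> \<le> M * (?d / \<bar>W\<bar> + B * (?d / \<bar>W\<bar>))"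
    using M_ge_1 by (intro mult_left_mono) auto
  with X_gronwall(2)[OF box_params(2)[OF w(1)] box_params(2)[OF w(2)] box_params(4)[OF w(1)]]
  have c: "\<bar>?c - ?c'\<bar> \<le> M * (?d / \<bar>W\<bar> + B * (?d / \<bar>W\<bar>))" by linarith
  have e1: "\<delta> * \<bar>w $ 1 - w' $ 1\<bar> \<le> ?d / \<bar>W\<bar>"
    using t delta unfolding right_diff_distrib[symmetric] abs_mult by simp
  have e2: "\<rho> * \<bar>w $ 2 - w' $ 2\<bar> \<le> M * (?d / \<bar>W\<bar> + B * (?d / \<bar>W\<bar>))"
    using c r unfolding right_diff_distrib[symmetric] abs_mult by simp
  have "\<bar>w $ 1 - w' $ 1\<bar> \<le> ?d / \<bar>W\<bar> / \<delta>" using e1 delta(1) by (simp only: pos_le_divide_eq mult.commute)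
  moreover have "\<bar>w $ 2 - w' $ 2\<bar> \<le> M * (?d / \<bar>W\<bar> + B * (?d / \<bar>W\<bar>)) / \<rho>"
    using e2 r by (subst pos_le_divide_eq) (auto simp: mult.commute)
  ultimately have "dist w w' \<le> ?d / \<bar>W\<bar> / \<delta> + M * (?d / \<bar>W\<bar> + B * (?d / \<bar>W\<bar>)) / \<rho>"
    using norm_vec2_le[of "w - w'"] unfolding dist_norm by simp
  also have "\<dots> = Lphi * ?d"
    unfolding Lphi_def using W0 delta(1) r by (simp add: field_simps)
  finally show ?thesis .
qed

lemma psi_inj: "inj_on psi unit_box"
proof (rule inj_onI)
  fix w w' assume "w \<in> unit_box" "w' \<in> unit_box" "psi w = psi w'"
  then show "w = w'" using psi_expand[of w w'] by simp
qed

definition "U = psi ` unit_box"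
definition "phi = inv_into unit_box psi"

lemma phi_psi: "w \<in> unit_box \<Longrightarrow> phi (psi w) = w"
  unfolding phi_def by (rule inv_into_f_f[OF psi_inj])

lemma psi_phi: "z \<in> U \<Longrightarrow> psi (phi z) = z"
  unfolding phi_def U_def by (rule f_inv_into_f)

lemma phi_in: "z \<in> U \<Longrightarrow> phi z \<in> unit_box"
  unfolding phi_def U_def by (rule inv_into_into)

lemma phi_image: "phi ` U = unit_box"
  using phi_psi phi_in unfolding U_def by force

lemma phi_lipschitz: "z \<in> U \<Longrightarrow> z' \<in> U \<Longrightarrow> dist (phi z) (phi z') \<le> Lphi * dist z z'"
  using psi_expand[OF phi_in phi_in, of z z'] by (simp add: psi_phi)

lemma psi_cont: "continuous_on unit_box psi"
  by (rule lipschitz_continuous_on[OF Lpsi_nonneg psi_lipschitz])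

lemma phi_cont: "continuous_on U phi"
  by (rule lipschitz_continuous_on[OF Lphi_nonneg phi_lipschitz])

lemma U_open: "open U"
  unfolding U_def by (rule invariance_of_domain[OF psi_cont open_unit_box psi_inj])

lemma p_in_U: "p \<in> U"
proof -
  have 0: "(0::real^2) \<in> unit_box" by (simp add: unit_box_def)
  have "psi 0 = pt (X 0 0) 0" by (simp add: psi_def)
  also have "\<dots> = p" using X(1)[of 0] r by (simp add: pt_def)
  finally show ?thesis unfolding U_def using 0 by (metis image_eqI)
qed

definition "sg w = sigl hp vp (psi w)"
definition "ex w = dX (\<rho> * w $ 2) (\<delta> * w $ 1)"

definition "Dpsi w = \<delta> *\<^sub>R row 1 vp + (\<delta> * sg w) *\<^sub>R row 1 hp + (\<rho> * ex w) *\<^sub>R row 2 hp"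

text \<open>The inverse of \<open>Dpsi\<close> by Cramer's rule: \<open>wedge hp\<close> and
  \<open>wedge vp\<close> read off the components along \<open>vp\<close> and \<open>hp\<close>.
  Subtracting the slope times the time component leaves the variation of the initial value, scaled
  by \<open>ex\<close>.\<close>

definition "Dphi z = (1 / (\<delta> * W)) *\<^sub>R wedge_row hp (axis 1 1)
   + (- 1 / (\<rho> * W) * inverse (ex (phi z))) *\<^sub>R wedge_row vp (axis 2 1)
   + (- 1 / (\<rho> * W) * (sg (phi z) * inverse (ex (phi z)))) *\<^sub>R wedge_row hp (axis 2 1)"

lemma psi_deriv:
  assumes w: "w \<in> unit_box"
  shows "(psi has_derivative blinfun_apply (Dpsi w)) (at w)"
proof -
  let ?c = "\<rho> * w $ 2" and ?t = "\<delta> * w $ 1"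
  define Y where "Y q = (case q of (t, c) \<Rightarrow> X c t)" for q
  have comp: "((\<lambda>w::real^2. w $ i) has_derivative (\<lambda>w. w $ i)) (at w)" for i
    by (rule bounded_linear_imp_has_derivative[OF bounded_linear_vec_nth])
  have g: "((\<lambda>w::real^2. (\<delta> * w $ 1, \<rho> * w $ 2)) has_derivative (\<lambda>\<zeta>. (\<delta> * \<zeta> $ 1, \<rho> * \<zeta> $ 2))) (at w)"
    by (intro has_derivative_Pair has_derivative_mult_right comp)
  have Yd: "(Y has_derivative (\<lambda>(x, y). sg w * x + ex w * y)) (at (?t, ?c))"
    unfolding Y_def[abs_def] sg_def ex_def psi_def by (rule flow_deriv[OF box_params(1,3)[OF w]])
  have Xd: "((\<lambda>w. Y (\<delta> * w $ 1, \<rho> * w $ 2)) has_derivative (\<lambda>\<zeta>. sg w * (\<delta> * \<zeta> $ 1) + ex w * (\<rho> * \<zeta> $ 2))) (at w)"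
    using has_derivative_compose[OF g Yd] by simp
  have "((\<lambda>w. p + Y (\<delta> * w $ 1, \<rho> * w $ 2) *\<^sub>R hp + (\<delta> * w $ 1) *\<^sub>R vp) has_derivative
     (\<lambda>\<zeta>. 0 + (sg w * (\<delta> * \<zeta> $ 1) + ex w * (\<rho> * \<zeta> $ 2)) *\<^sub>R hp + (\<delta> * \<zeta> $ 1) *\<^sub>R vp)) (at w)"
    by (intro has_derivative_add has_derivative_const has_derivative_scaleR_left Xd has_derivative_mult_right comp)
  moreover have "(\<lambda>w. p + Y (\<delta> * w $ 1, \<rho> * w $ 2) *\<^sub>R hp + (\<delta> * w $ 1) *\<^sub>R vp) = psi"
    by (simp add: psi_def[abs_def] pt_def Y_def)
  moreover have "(\<lambda>\<zeta>. 0 + (sg w * (\<delta> * \<zeta> $ 1) + ex w * (\<rho> * \<zeta> $ 2)) *\<^sub>R hp + (\<delta> * \<zeta> $ 1) *\<^sub>R vp) = blinfun_apply (Dpsi w)"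
    by (rule ext) (simp add: Dpsi_def blinfun.bilinear_simps algebra_simps)
  ultimately show ?thesis by simp
qed

lemma ex_bounds: "w \<in> unit_box \<Longrightarrow> exp (-1) \<le> ex w" "w \<in> unit_box \<Longrightarrow> ex w \<le> exp 1" "0 < ex w"
  unfolding ex_def by (intro dX_bounds box_params; assumption)+ simp

lemma Dphi_Dpsi:
  assumes z: "z \<in> U"
  shows "blinfun_apply (Dphi z) (blinfun_apply (Dpsi (phi z)) \<zeta>) = \<zeta>"
proof -
  let ?e = "ex (phi z)" and ?s = "sg (phi z)"
  have nz: "?e \<noteq> 0" "\<delta> \<noteq> 0" "\<rho> \<noteq> 0" using ex_bounds(3)[of "phi z"] delta r by auto
  define x where "x = blinfun_apply (Dpsi (phi z)) \<zeta>"
  have x: "x = (\<delta> * ?s * \<zeta> $ 1 + \<rho> * ?e * \<zeta> $ 2) *\<^sub>R hp + (\<delta> * \<zeta> $ 1) *\<^sub>R vp"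
    unfolding x_def Dpsi_def by (simp add: blinfun.bilinear_simps algebra_simps)
  have h: "wedge hp x = (\<delta> * \<zeta> $ 1) * W" unfolding x by (simp add: wedge.bilinear_simps W_def)
  have v: "wedge vp x = - (\<delta> * ?s * \<zeta> $ 1 + \<rho> * ?e * \<zeta> $ 2) * W"
    unfolding x by (simp add: wedge.bilinear_simps W_def wedge_commute[of vp hp] algebra_simps)
  define b where "b = - 1 / (\<rho> * W)"
  have "blinfun_apply (Dphi z) x = (1 / (\<delta> * W) * wedge hp x) *\<^sub>R axis 1 1
     + (b * inverse ?e * (wedge vp x + ?s * wedge hp x)) *\<^sub>R axis 2 1"
    unfolding Dphi_def b_def[symmetric]
    by (simp add: blinfun.bilinear_simps distrib_left scaleR_add_left mult_ac add.assoc)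
  also have "1 / (\<delta> * W) * wedge hp x = \<zeta> $ 1" unfolding h using nz W_nonzero by simp
  also have "wedge vp x + ?s * wedge hp x = - (\<rho> * ?e * \<zeta> $ 2) * W" unfolding h v by (simp add: algebra_simps)
  also have "b * inverse ?e * (- (\<rho> * ?e * \<zeta> $ 2) * W) = \<zeta> $ 2"
    using nz W_nonzero by (simp add: b_def field_simps)
  finally show ?thesis unfolding x_def vec2_axis[symmetric] .
qed

lemma phi_deriv:
  assumes z: "z \<in> U"
  shows "(phi has_derivative blinfun_apply (Dphi z)) (at z)"
proof (rule has_derivative_inverse_basic)
  show "(psi has_derivative blinfun_apply (Dpsi (phi z))) (at (phi z))" by (rule psi_deriv[OF phi_in[OF z]])
  show "bounded_linear (blinfun_apply (Dphi z))" by (rule blinfun.bounded_linear_right)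
  show "blinfun_apply (Dphi z) \<circ> blinfun_apply (Dpsi (phi z)) = id" using Dphi_Dpsi[OF z] by auto
  show "continuous (at z) phi" using phi_cont U_open z by (simp add: continuous_on_eq_continuous_at)
  show "open U" "z \<in> U" by (fact U_open z)+
  show "psi (phi y) = y" if "y \<in> U" for y by (rule psi_phi[OF that])
qed

lemma sg_cont: "continuous_on unit_box sg"
proof -
  have "continuous_on (ball p (3 * r)) (sigl hp vp)"
    by (rule sigl_regular(1)[OF open_ball unstable norm_h norm_v])
  then show ?thesis
    unfolding sg_def[abs_def] by (rule continuous_on_compose2[OF _ psi_cont]) (use psi_in_ball in blast)
qed

lemma ex_cont: "continuous_on unit_box ex"
proof -
  have "continuous_on unit_box (\<lambda>w. dX (snd (\<delta> * w $ 1, \<rho> * w $ 2)) (fst (\<delta> * w $ 1, \<rho> * w $ 2)))"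
  proof (rule continuous_on_compose2[OF dX_cont])
    show "continuous_on unit_box (\<lambda>w::real^2. (\<delta> * w $ 1, \<rho> * w $ 2))" by (intro continuous_intros)
    show "(\<lambda>w. (\<delta> * w $ 1, \<rho> * w $ 2)) ` unit_box \<subseteq> {-\<delta>..\<delta>} \<times> {-\<rho>..\<rho>}"
    proof (rule image_subsetI)
      fix w assume w: "w \<in> unit_box"
      have "\<rho> * w $ 2 \<in> {-\<rho>..\<rho>}" using box_params(2)[OF w] by (auto simp: abs_le_iff)
      then show "(\<delta> * w $ 1, \<rho> * w $ 2) \<in> {-\<delta>..\<delta>} \<times> {-\<rho>..\<rho>}" using box_params(4)[OF w] by blast
    qed
  qed
  then show ?thesis unfolding ex_def[abs_def] fst_conv snd_conv .
qed

lemma psi_C1: "C1_on unit_box psi Dpsi"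
  unfolding C1_on_def Dpsi_def[abs_def]
  by (intro conjI ballI psi_deriv[unfolded Dpsi_def] continuous_on_add continuous_on_scaleR continuous_on_const
      continuous_on_mult sg_cont ex_cont)

lemma phi_C1: "C1_on U phi Dphi"
proof -
  have s: "continuous_on U (\<lambda>z. sg (phi z))"
    by (rule continuous_on_compose2[OF sg_cont phi_cont]) (use phi_in in blast)
  have e: "continuous_on U (\<lambda>z. ex (phi z))"
    by (rule continuous_on_compose2[OF ex_cont phi_cont]) (use phi_in in blast)
  have ie: "continuous_on U (\<lambda>z. inverse (ex (phi z)))"
    by (rule continuous_on_inverse[OF e]) (use ex_bounds(3) in \<open>metis less_irrefl\<close>)
  show ?thesis
    unfolding C1_on_def Dphi_def[abs_def]
    by (intro conjI ballI phi_deriv[unfolded Dphi_def] continuous_on_add continuous_on_scaleR continuous_on_const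
      continuous_on_mult s ie)
qed

lemma sg_bound: "w \<in> unit_box \<Longrightarrow> \<bar>sg w\<bar> \<le> B"
  unfolding sg_def psi_def by (intro s_bound X(2) time_in box_params)

text \<open>The slope coefficient is a Hoelder function composed with the Lipschitz map
  \<open>psi\<close>. The coefficient \<open>ex\<close> is the exponential of an integral of
  \<open>dsigl\<close> along a solution and inherits the exponent because solutions depend on c in a
  Lipschitz way, uniformly in time.\<close>

lemma charts_holder:
  assumes a: "0 < \<alpha>" "\<alpha> \<le> 1" and K: "0 \<le> K"
    and hol: "\<And>x y. hp \<in> cu x \<Longrightarrow> hp \<in> cu y \<Longrightarrow> dist x y \<le> 1 \<Longrightarrow>
     \<bar>sigl hp vp x - sigl hp vp y\<bar> \<le> K * dist x y powr \<alpha> \<and> \<bar>dsigl hp vp x - dsigl hp vp y\<bar> \<le> K * dist x y powr \<alpha>"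
  shows "holder_on \<alpha> unit_box Dpsi" "holder_on \<alpha> U Dphi"
proof -
  have ball: "dist x y \<le> 1" if "x \<in> ball p (3 * r)" "y \<in> ball p (3 * r)" for x y
    using that r_small dist_triangle[of x y p] by (simp add: dist_commute)
  have sh: "scalar_holder \<alpha> unit_box sg"
    unfolding sg_def[abs_def]
  proof (rule scalar_holder_compose[where T = "ball p (3 * r)" and g = psi and K = Lpsi])
    show "scalar_holder \<alpha> (ball p (3 * r)) (sigl hp vp)"
      by (rule scalar_holderI[OF K]) (use hol unstable ball in blast)
  qed (use psi_in_ball psi_lipschitz Lpsi_nonneg a in auto)
  have eh: "scalar_holder \<alpha> unit_box ex"
  proof (rule scalar_holderI[of "exp 1 * (L + 3 * \<delta> * (K * M powr \<alpha>))"])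
    show "0 \<le> exp 1 * (L + 3 * \<delta> * (K * M powr \<alpha>))" using L_nonneg delta K by simp
    fix w w' assume w: "w \<in> unit_box" "w' \<in> unit_box"
    let ?c = "\<rho> * w $ 2" and ?t = "\<delta> * w $ 1" and ?c' = "\<rho> * w' $ 2" and ?t' = "\<delta> * w' $ 1"
    have c1: "\<bar>w $ i - w' $ i\<bar> \<le> dist w w'" for i
      using component_le_norm_cart[of "w - w'" i] by (simp add: dist_norm)
    have dd: "\<bar>?c - ?c'\<bar> \<le> dist w w'"
    proof -
      have "\<rho> * \<bar>w $ 2 - w' $ 2\<bar> \<le> 1 * dist w w'" using r r_small by (intro mult_mono c1) auto
      then show ?thesis unfolding right_diff_distrib[symmetric] abs_mult using r by simp
    qed
    have dt1: "\<bar>?t - ?t'\<bar> \<le> dist w w'"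
    proof -
      have "\<delta> * \<bar>w $ 1 - w' $ 1\<bar> \<le> 1 * dist w w'" using delta r_small by (intro mult_mono c1) auto
      then show ?thesis unfolding right_diff_distrib[symmetric] abs_mult using delta by simp
    qed
    have "\<bar>?t - ?t'\<bar> \<le> 1"
      using box_params(3)[OF w(1)] box_params(3)[OF w(2)] delta(2) r_small by linarith
    \<comment> \<open>Lipschitz dependence on time is Hoelder dependence, because \<alpha> \<le> 1
      and the two times differ by at most 1.\<close>
    then have "\<bar>?t - ?t'\<bar> powr 1 \<le> \<bar>?t - ?t'\<bar> powr \<alpha>" using a by (intro powr_mono') auto
    also have "\<dots> \<le> dist w w' powr \<alpha>" using a by (intro powr_mono2 dt1) auto
    finally have dt: "\<bar>?t - ?t'\<bar> \<le> dist w w' powr \<alpha>" by simp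
    note c = box_params(2)[OF w(1)] box_params(2)[OF w(2)]
    have "\<bar>k ?c \<tau> - k ?c' \<tau>\<bar> \<le> K * M powr \<alpha> * dist w w' powr \<alpha>" if \<tau>: "\<tau> \<in> {-\<delta>..\<delta>}" for \<tau>
    proof -
      let ?x = "pt (X ?c \<tau>) \<tau>" and ?y = "pt (X ?c' \<tau>) \<tau>"
      have xy: "?x \<in> ball p (3 * r)" "?y \<in> ball p (3 * r)"
        by (intro pt_in_ball X(2)[OF c(1) \<tau>] X(2)[OF c(2) \<tau>] time_in[OF \<tau>])+
      have "\<bar>k ?c \<tau> - k ?c' \<tau>\<bar> \<le> K * dist ?x ?y powr \<alpha>"
        unfolding k_def by (rule conjunct2[OF hol[OF unstable[OF xy(1)] unstable[OF xy(2)] ball[OF xy]]])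
      also have "dist ?x ?y \<le> M * dist w w'"
      proof -
        have "dist ?x ?y \<le> \<bar>X ?c \<tau> - X ?c' \<tau>\<bar>" using pt_lipschitz[of "X ?c \<tau>" \<tau> "X ?c' \<tau>" \<tau>] by simp
        also have "\<dots> \<le> M * \<bar>?c - ?c'\<bar>" by (rule X_gronwall(1)[OF c \<tau>])
        also have "\<dots> \<le> M * dist w w'" using M_ge_1 dd by (intro mult_left_mono) auto
        finally show ?thesis .
      qed
      then have "K * dist ?x ?y powr \<alpha> \<le> K * (M * dist w w') powr \<alpha>"
        using K a by (intro mult_left_mono powr_mono2) auto
      also have "\<dots> = K * M powr \<alpha> * dist w w' powr \<alpha>" using M_ge_1 by (simp add: powr_mult)
      finally show ?thesis .
    qed
    from dX_modulus[OF c box_params(4)[OF w(1)] box_params(4)[OF w(2)] this]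
    have "\<bar>ex w - ex w'\<bar> \<le> exp 1 * (L * \<bar>?t - ?t'\<bar> + 3 * \<delta> * (K * M powr \<alpha> * dist w w' powr \<alpha>))"
      unfolding ex_def .
    also have "\<dots> \<le> exp 1 * (L * dist w w' powr \<alpha> + 3 * \<delta> * (K * M powr \<alpha> * dist w w' powr \<alpha>))"
      using dt L_nonneg by (intro mult_left_mono add_right_mono) auto
    finally show "\<bar>ex w - ex w'\<bar> \<le> exp 1 * (L + 3 * \<delta> * (K * M powr \<alpha>)) * dist w w' powr \<alpha>"
      by (simp add: algebra_simps)
  qed
  have eb: "\<bar>ex w\<bar> \<le> exp 1" if "w \<in> unit_box" for w
    using ex_bounds(2)[OF that] ex_bounds(3)[of w] by simp
  have ieb: "\<bar>inverse (ex w)\<bar> \<le> exp 1" if "w \<in> unit_box" for w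
  proof -
    have "inverse (ex w) \<le> inverse (exp (-1))" by (rule le_imp_inverse_le[OF ex_bounds(1)[OF that]]) simp
    then show ?thesis using ex_bounds(3)[of w] by (simp add: exp_minus)
  qed
  have ieh: "scalar_holder \<alpha> unit_box (\<lambda>w. inverse (ex w))"
    by (rule scalar_holder_inverse[OF eh ex_bounds(1)]) auto
  have sieh: "scalar_holder \<alpha> unit_box (\<lambda>w. sg w * inverse (ex w))"
    by (rule scalar_holder_mult[OF sh sg_bound ieh ieb])
  have sieb: "\<bar>sg w * inverse (ex w)\<bar> \<le> B * exp 1" if "w \<in> unit_box" for w
    unfolding abs_mult using sg_bound[OF that] ieb[OF that] B_nonneg by (intro mult_mono) auto
  have const: "scalar_holder \<alpha> unit_box (\<lambda>w. c * f w)" if "scalar_holder \<alpha> unit_box f" "\<And>w. w \<in> unit_box \<Longrightarrow> \<bar>f w\<bar> \<le> A" for c f A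
    by (rule scalar_holder_mult[OF scalar_holder_const[of \<alpha> unit_box c] order_refl that])
  show "holder_on \<alpha> unit_box Dpsi"
    unfolding Dpsi_def[abs_def]
    by (intro holder_on_combination scalar_holder_const const[OF sh sg_bound] const[OF eh eb])
  have comp: "scalar_holder \<alpha> U (\<lambda>z. f (phi z))" if "scalar_holder \<alpha> unit_box f" for f
    by (rule scalar_holder_compose[OF that phi_in phi_lipschitz Lphi_nonneg]) (use a in auto)
  show "holder_on \<alpha> U Dphi"
    unfolding Dphi_def[abs_def]
    by (intro holder_on_combination scalar_holder_const comp[OF const[OF ieh ieb]] comp[OF const[OF sieh sieb]])
qed

text \<open>The velocity of a plaque is \<open>vp\<close> plus the limit slope times
  \<open>hp\<close>, exactly the vector contracted in \<open>stable_direction\<close>; the mean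
  value inequality in t integrates this contraction.\<close>

lemma plaque_contraction:
  assumes c: "\<bar>c\<bar> \<le> r / 2" and t: "t \<in> {-\<delta>..\<delta>}" "t' \<in> {-\<delta>..\<delta>}"
  shows "dist (orb 0 n (pt (X c t) t)) (orb 0 n (pt (X c t') t')) \<le> S3 * (1 / \<eta>) ^ n * \<bar>t - t'\<bar>"
proof -
  let ?\<gamma> = "\<lambda>t. pt (X c t) t"
  let ?r = "\<lambda>t. vp + sigl hp vp (?\<gamma> t) *\<^sub>R hp"
  have D: "((\<lambda>t. orb 0 n (?\<gamma> t)) has_derivative (\<lambda>x. blinfun_apply (coc 0 n (?\<gamma> \<tau>)) (x *\<^sub>R ?r \<tau>))) (at \<tau> within {-\<delta>..\<delta>})"
    if \<tau>: "\<tau> \<in> {-\<delta>..\<delta>}" for \<tau>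
  proof -
    have Xd: "(X c has_derivative (\<lambda>x. x * sigl hp vp (?\<gamma> \<tau>))) (at \<tau> within {-\<delta>..\<delta>})"
      using X(3)[OF c \<tau>] by (simp only: has_field_derivative_def mult_commute_abs)
    have "(?\<gamma> has_derivative (\<lambda>x. 0 + (x * sigl hp vp (?\<gamma> \<tau>)) *\<^sub>R hp + x *\<^sub>R vp)) (at \<tau> within {-\<delta>..\<delta>})"
      unfolding pt_def
      by (intro has_derivative_add has_derivative_const has_derivative_scaleR_left Xd[unfolded pt_def] has_derivative_ident)
    moreover have "(\<lambda>x. 0 + (x * sigl hp vp (?\<gamma> \<tau>)) *\<^sub>R hp + x *\<^sub>R vp) = (\<lambda>x. x *\<^sub>R ?r \<tau>)"
      by (simp add: scaleR_add_right add.commute)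
    ultimately have "(?\<gamma> has_derivative (\<lambda>x. x *\<^sub>R ?r \<tau>)) (at \<tau> within {-\<delta>..\<delta>})" by simp
    from has_derivative_compose[OF this orb_deriv[of 0 n]] show ?thesis .
  qed
  have "norm (orb 0 n (?\<gamma> t) - orb 0 n (?\<gamma> t')) \<le> (S3 * (1 / \<eta>) ^ n) * norm (t - t')"
  proof (rule differentiable_bound[OF _ D])
    fix \<tau> assume \<tau>: "\<tau> \<in> {-\<delta>..\<delta>}"
    have "hp \<in> cu (?\<gamma> \<tau>)"
      by (intro unstable pt_in_ball X(2)[OF c \<tau>] time_in[OF \<tau>])
    then have st: "norm (blinfun_apply (coc 0 n (?\<gamma> \<tau>)) (?r \<tau>)) \<le> S3 * (1 / \<eta>) ^ n"
      by (rule stable_direction) simp_all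
    show "onorm (\<lambda>x. blinfun_apply (coc 0 n (?\<gamma> \<tau>)) (x *\<^sub>R ?r \<tau>)) \<le> S3 * (1 / \<eta>) ^ n"
    proof (rule onorm_le)
      fix x :: real
      have "norm (blinfun_apply (coc 0 n (?\<gamma> \<tau>)) (x *\<^sub>R ?r \<tau>)) = \<bar>x\<bar> * norm (blinfun_apply (coc 0 n (?\<gamma> \<tau>)) (?r \<tau>))"
        by (simp add: blinfun.scaleR_right)
      also have "\<dots> \<le> \<bar>x\<bar> * (S3 * (1 / \<eta>) ^ n)" by (intro mult_left_mono st) simp
      finally show "norm (blinfun_apply (coc 0 n (?\<gamma> \<tau>)) (x *\<^sub>R ?r \<tau>)) \<le> S3 * (1 / \<eta>) ^ n * norm x"
        by (simp add: mult.commute)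
    qed
  qed (use t in auto)
  then show ?thesis by (simp add: dist_norm)
qed

lemma S3_nonneg: "0 \<le> S3"
  using S1_nonneg tv(1) by (simp add: S3_def)

lemma plaque_in_stable_set:
  assumes y: "y \<in> U" and z: "z \<in> U" and eq: "phi z $ 2 = phi y $ 2"
  shows "z \<in> stable_set F y"
proof -
  let ?c = "\<rho> * phi y $ 2" and ?t = "\<delta> * phi y $ 1" and ?t' = "\<delta> * phi z $ 1"
  have yz: "y = pt (X ?c ?t) ?t" "z = pt (X ?c ?t') ?t'"
    using psi_phi[OF y] psi_phi[OF z] eq by (simp_all add: psi_def)
  have d: "dist (orb 0 n y) (orb 0 n z) \<le> S3 * (1 / \<eta>) ^ n * \<bar>?t - ?t'\<bar>" for n
    using plaque_contraction[OF box_params(2)[OF phi_in[OF y]] box_params(4)[OF phi_in[OF y]] box_params(4)[OF phi_in[OF z]], of n]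
    unfolding yz[symmetric] .
  have le: "norm (infdist (orb 0 n y - orb 0 n z) Zvec) \<le> (S3 * \<bar>?t - ?t'\<bar>) * (1 / \<eta>) ^ n" for n
  proof -
    have "infdist (orb 0 n y - orb 0 n z) Zvec \<le> dist (orb 0 n y) (orb 0 n z)"
      using infdist_le[OF zero_in_Zvec, of "orb 0 n y - orb 0 n z"] by (simp add: dist_norm)
    also note d[of n]
    also have "S3 * (1 / \<eta>) ^ n * \<bar>?t - ?t'\<bar> = (S3 * \<bar>?t - ?t'\<bar>) * (1 / \<eta>) ^ n" by (simp only: mult_ac)
    finally show ?thesis unfolding real_norm_def by (simp only: abs_of_nonneg[OF infdist_nonneg])
  qed
  have "(\<lambda>n. (S3 * \<bar>?t - ?t'\<bar>) * (1 / \<eta>) ^ n) \<longlonglongrightarrow> (S3 * \<bar>?t - ?t'\<bar>) * 0"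
    by (rule tendsto_mult_left[OF LIMSEQ_realpow_zero[OF q_bounds(2,3)]])
  then have lim: "(\<lambda>n. (S3 * \<bar>?t - ?t'\<bar>) * (1 / \<eta>) ^ n) \<longlonglongrightarrow> 0" unfolding mult_zero_right .
  have "(\<lambda>n. infdist (orb 0 n y - orb 0 n z) Zvec) \<longlonglongrightarrow> 0"
    by (rule Lim_null_comparison[OF always_eventually[OF allI[OF le]] lim])
  then show ?thesis unfolding stable_set_def itcomp_eq_orb mem_Collect_eq .
qed

text \<open>The sets \<open>S N k\<close> fix a time \<open>N\<close> after which the orbits stay close modulo the lattice and the lattice vector \<open>k\<close> at
  time \<open>N\<close>. Two nearby points of one \<open>S N k\<close> have orbits that are close in the plane at all times; sliding one of
  them along its plaque makes their difference parallel to the unstable vector \<open>hp\<close>, and expansivity applies.\<close>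

lemma countable_plaques: "countable ((\<lambda>z. phi z $ 2) ` (stable_set F y \<inter> U))"
proof -
  obtain \<epsilon>0 where e0: "\<epsilon>0 > 0" "\<And>x y. y - x \<in> cu x \<Longrightarrow> (\<And>n. dist (orb 0 n x) (orb 0 n y) \<le> \<epsilon>0) \<Longrightarrow> y = x"
    using expansive_on_unstable_cone by blast
  \<comment> \<open>Two requirements: 2 \<epsilon> is at most half of the expansivity radius, and 2
    \<epsilon> + 2 C \<epsilon> < 1 prevents two lattice vectors occurring at the same time from
    differing.\<close>
  define \<epsilon> where "\<epsilon> = min (\<epsilon>0 / 4) (1 / (4 + 4 * C))"
  have C0: "0 < C" using C_ge_1 by simp
  have e: "0 < \<epsilon>" "4 * \<epsilon> \<le> \<epsilon>0" using e0(1) C0 by (auto simp: \<epsilon>_def)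
  have "\<epsilon> \<le> 1 / (4 + 4 * C)" by (simp add: \<epsilon>_def)
  then have "\<epsilon> * (4 + 4 * C) \<le> 1" using C0 by (simp add: pos_le_divide_eq)
  then have eC: "2 * \<epsilon> + C * (2 * \<epsilon>) < 1" using e(1) C0 by (simp add: algebra_simps)
  define S where "S N k = {z \<in> U. norm (orb 0 N y - orb 0 N z - k) \<le> \<epsilon> \<and>
     (\<forall>n\<ge>N. \<exists>k\<in>Zvec. norm (orb 0 n y - orb 0 n z - k) \<le> \<epsilon>)}" for N k
  have cover: "stable_set F y \<inter> U \<subseteq> (\<Union>N. \<Union>k\<in>Zvec. S N k)"
  proof
    fix z assume z: "z \<in> stable_set F y \<inter> U"
    then have "(\<lambda>n. infdist (orb 0 n y - orb 0 n z) Zvec) \<longlonglongrightarrow> 0"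
      by (simp add: stable_set_def itcomp_eq_orb)
    then have "\<forall>\<^sub>F n in sequentially. infdist (orb 0 n y - orb 0 n z) Zvec < \<epsilon>"
      using e(1) by (intro order_tendstoD(2)[of _ "0"])
    then obtain N where N: "\<And>n. n \<ge> N \<Longrightarrow> infdist (orb 0 n y - orb 0 n z) Zvec < \<epsilon>"
      unfolding eventually_sequentially by blast
    have near: "\<exists>k\<in>Zvec. norm (orb 0 n y - orb 0 n z - k) \<le> \<epsilon>" if "n \<ge> N" for n
    proof (rule ccontr)
      assume far: "\<not> ?thesis"
      have ne: "Zvec \<noteq> {}" using zero_in_Zvec by blast
      have "\<epsilon> \<le> (INF a\<in>Zvec. dist (orb 0 n y - orb 0 n z) a)"
        using far by (intro cINF_greatest[OF ne]) (simp only: dist_norm, meson le_cases)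
      then have "\<epsilon> \<le> infdist (orb 0 n y - orb 0 n z) Zvec"
        unfolding infdist_notempty[OF ne] .
      then show False using N[OF that] by simp
    qed
    obtain k where "k \<in> Zvec" "norm (orb 0 N y - orb 0 N z - k) \<le> \<epsilon>" using near[of N] by blast
    then have "z \<in> S N k" unfolding S_def using z near by blast
    then show "z \<in> (\<Union>N. \<Union>k\<in>Zvec. S N k)" using \<open>k \<in> Zvec\<close> by blast
  qed
  have close: "dist (orb 0 n z) (orb 0 n z') \<le> 2 * \<epsilon>" if z: "z \<in> S N k" "z' \<in> S N k" and n: "n \<ge> N" for N k z z' n
    using n
  proof (induction n rule: dec_induct)
    case base
    have eq: "orb 0 N z - orb 0 N z' = (orb 0 N y - orb 0 N z' - k) - (orb 0 N y - orb 0 N z - k)" by simp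
    have "norm (orb 0 N y - orb 0 N z' - k) \<le> \<epsilon>" "norm (orb 0 N y - orb 0 N z - k) \<le> \<epsilon>"
      using z unfolding S_def by blast+
    then show ?case
      using norm_triangle_ineq4[of "orb 0 N y - orb 0 N z' - k" "orb 0 N y - orb 0 N z - k"]
      unfolding dist_norm eq by linarith
  next
    case (step n)
    let ?a = "orb 0 (Suc n) y - orb 0 (Suc n) z" and ?b = "orb 0 (Suc n) y - orb 0 (Suc n) z'"
    have "Suc n \<ge> N" using step by simp
    then obtain k1 k2 where k: "k1 \<in> Zvec" "norm (?a - k1) \<le> \<epsilon>" "k2 \<in> Zvec" "norm (?b - k2) \<le> \<epsilon>"
      using z unfolding S_def by blast
    have "dist (orb 0 (Suc n) z) (orb 0 (Suc n) z') \<le> C * dist (orb 0 n z) (orb 0 n z')"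
      by (simp add: F_lipschitz)
    also have "\<dots> \<le> C * (2 * \<epsilon>)" using step.IH C0 by (intro mult_left_mono) auto
    finally have d: "norm (?b - ?a) \<le> C * (2 * \<epsilon>)" by (simp add: dist_norm del: orb.simps)
    \<comment> \<open>By induction the orbits of z and z' are at most 2 C \<epsilon> apart after the
      next step, so k1 and k2 differ by less than 1 and coincide. This upgrades closeness modulo the
      lattice to closeness in the plane.\<close>
    have "k2 - k1 = (?b - ?a) - ((?b - k2) - (?a - k1))" by simp
    then have "norm (k2 - k1) \<le> norm (?b - ?a) + norm ((?b - k2) - (?a - k1))"
      by (metis norm_triangle_ineq4)
    moreover have ba: "norm ((?b - k2) - (?a - k1)) \<le> 2 * \<epsilon>"
      using norm_triangle_ineq4[of "?b - k2" "?a - k1"] k by linarith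
    ultimately have "norm (k2 - k1) < 1" using d eC by linarith
    then have "k2 - k1 = 0" by (rule Zvec_small[OF Zvec_diff[OF k(3) k(1)]])
    then have "(?b - k2) - (?a - k1) = orb 0 (Suc n) z - orb 0 (Suc n) z'" by (simp del: orb.simps)
    then show ?case using ba unfolding dist_norm by (simp only:)
  qed
  have "countable ((\<lambda>z. phi z $ 2) ` S N k)" for N k
  proof -
    \<comment> \<open>\<open>C ^ N\<close> bounds the separation before time N, where nothing is
      known modulo the lattice, and the second term pays for the slide along the plaque. At distance
      \<rho>' the two together use half of \<open>\<epsilon>0\<close>.\<close>
    define Q where "Q = C ^ N + S3 / \<bar>W\<bar>"
    have Q: "0 < Q" using C0 S3_nonneg by (simp add: Q_def add_pos_nonneg)
    define \<rho>' where "\<rho>' = \<epsilon>0 / (2 * Q)"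
    have rho: "0 < \<rho>'" "Q * \<rho>' = \<epsilon>0 / 2" using Q e0(1) by (auto simp: \<rho>'_def)
    show ?thesis
    proof (rule countable_image_locally_constant[OF rho(1)])
      fix z z' assume zS: "z \<in> S N k" and z'S: "z' \<in> S N k" and zz: "dist z z' < \<rho>'"
      have zU: "z \<in> U" "z' \<in> U" using zS z'S by (auto simp: S_def)
      let ?c = "\<rho> * phi z $ 2" and ?t = "\<delta> * phi z $ 1" and ?c' = "\<rho> * phi z' $ 2" and ?t' = "\<delta> * phi z' $ 1"
      note b = box_params[OF phi_in[OF zU(1)]] and b' = box_params[OF phi_in[OF zU(2)]]
      have z: "z = pt (X ?c ?t) ?t" "z' = pt (X ?c' ?t') ?t'"
        using psi_phi[OF zU(1)] psi_phi[OF zU(2)] by (simp_all add: psi_def)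
      define z'' where "z'' = pt (X ?c' ?t) ?t"
      have ct: "ct z = ?t" "ct z' = ?t'" and ca: "ca z = X ?c ?t"
        using arg_cong[OF z(1), of ct] arg_cong[OF z(2), of ct] arg_cong[OF z(1), of ca]
        unfolding ct_pt ca_pt .
      have "S3 * \<bar>?t - ?t'\<bar> \<le> S3 * (dist z z' / \<bar>W\<bar>)"
        using ct_lipschitz[of z z'] unfolding ct by (rule mult_left_mono[OF _ S3_nonneg])
      then have tt: "S3 * \<bar>?t - ?t'\<bar> \<le> S3 / \<bar>W\<bar> * dist z z'" by (simp only: times_divide_eq_left times_divide_eq_right)
      have slide: "dist (orb 0 n z') (orb 0 n z'') \<le> S3 / \<bar>W\<bar> * dist z z'" for n
      proof -
        have "dist (orb 0 n z') (orb 0 n z'') \<le> S3 * (1 / \<eta>) ^ n * \<bar>?t' - ?t\<bar>"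
          using plaque_contraction[OF b'(2) b'(4) b(4), of n] unfolding z(2)[symmetric] z''_def .
        also have "\<dots> = (1 / \<eta>) ^ n * (S3 * \<bar>?t - ?t'\<bar>)" by (simp add: abs_minus_commute)
        also have "\<dots> \<le> 1 * (S3 * \<bar>?t - ?t'\<bar>)"
          using q_bounds S3_nonneg by (intro mult_right_mono power_le_one) auto
        finally show ?thesis using tt by simp
      qed
      have "dist (orb 0 n z) (orb 0 n z'') \<le> \<epsilon>0" for n
      proof -
        have S0: "S3 / \<bar>W\<bar> * dist z z' \<le> S3 / \<bar>W\<bar> * \<rho>'"
          using zz S3_nonneg by (intro mult_left_mono) auto
        have Qe: "C ^ N * \<rho>' + S3 / \<bar>W\<bar> * \<rho>' = \<epsilon>0 / 2" using rho(2) by (simp add: Q_def algebra_simps)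
        have CN: "0 \<le> C ^ N * \<rho>'" using C0 rho by simp
        have A: "dist (orb 0 n z) (orb 0 n z') \<le> C ^ N * \<rho>' + 2 * \<epsilon>"
        proof (cases "n \<ge> N")
          case True
          show ?thesis using close[OF zS z'S True] CN by linarith
        next
          case False
          have "dist (orb 0 n z) (orb 0 n z') \<le> C ^ n * dist z z'" by (rule orb_lipschitz)
          also have "\<dots> \<le> C ^ N * \<rho>'"
            using False zz C_ge_1 by (intro mult_mono power_increasing) auto
          finally show ?thesis using e by simp
        qed
        have "dist (orb 0 n z) (orb 0 n z'') \<le> (C ^ N * \<rho>' + 2 * \<epsilon>) + S3 / \<bar>W\<bar> * \<rho>'"
          by (rule order_trans[OF dist_triangle add_mono[OF A order_trans[OF slide S0]]])
        also have "\<dots> = (C ^ N * \<rho>' + S3 / \<bar>W\<bar> * \<rho>') + 2 * \<epsilon>" by (simp only: add_ac)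
        also have "\<dots> \<le> \<epsilon>0" unfolding Qe using e(2) by simp
        finally show ?thesis .
      qed
      moreover have "z'' - z \<in> cu z"
      proof -
        have "z'' - pt (X ?c ?t) ?t = (X ?c' ?t - X ?c ?t) *\<^sub>R hp" unfolding z''_def pt_diff by simp
        then have "z'' - z = (X ?c' ?t - X ?c ?t) *\<^sub>R hp" unfolding z(1)[symmetric] .
        moreover have "hp \<in> cu z" using psi_unstable[OF phi_in[OF zU(1)]] psi_phi[OF zU(1)] by simp
        ultimately show ?thesis by (simp add: cone_u_scale)
      qed
      ultimately have "z'' = z" using e0(2) by blast
      then have "ca z'' = ca z" by simp
      then have "X ?c' ?t = X ?c ?t" unfolding ca z''_def ca_pt .
      then have "?c = ?c'" using X_gronwall(2)[OF b(2) b'(2) b(4)] by simp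
      then show "phi z $ 2 = phi z' $ 2" using r by simp
    qed
  qed
  then have "countable (\<Union>N. \<Union>k\<in>Zvec. (\<lambda>z. phi z $ 2) ` S N k)"
    using countable_Zvec by (intro countable_UN) auto
  moreover have "(\<lambda>z. phi z $ 2) ` (stable_set F y \<inter> U) \<subseteq> (\<Union>N. \<Union>k\<in>Zvec. (\<lambda>z. phi z $ 2) ` S N k)"
    using cover by blast
  ultimately show ?thesis by (rule countable_subset[rotated])
qed

lemma stable_set_refl: "y \<in> stable_set F y"
  unfolding stable_set_def using infdist_zero[OF zero_in_Zvec] by simp

text \<open>The second chart coordinate maps the component onto a connected countable set of reals,
  hence to one point. Conversely a plaque is the image of a convex slice and lies in the stable set,
  so it is part of the component.\<close>

lemma plaques:
  assumes y: "y \<in> U"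
  shows "connected_component_set (stable_set F y \<inter> U) y = {z \<in> U. phi z $ 2 = phi y $ 2}"
proof
  let ?K = "connected_component_set (stable_set F y \<inter> U) y"
  have yin: "y \<in> stable_set F y \<inter> U" using y stable_set_refl by blast
  show "?K \<subseteq> {z \<in> U. phi z $ 2 = phi y $ 2}"
  proof
    fix z assume z: "z \<in> ?K"
    have sub: "?K \<subseteq> stable_set F y \<inter> U" by (rule connected_component_subset)
    then have zU: "z \<in> U" using z by blast
    have "continuous_on ?K (\<lambda>z. phi z $ 2)"
      using sub by (intro continuous_on_component continuous_on_subset[OF phi_cont]) auto
    then have con: "connected ((\<lambda>z. phi z $ 2) ` ?K)"
      by (rule connected_continuous_image) (rule connected_connected_component)
    have "countable ((\<lambda>z. phi z $ 2) ` ?K)"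
      by (rule countable_subset[OF image_mono[OF sub] countable_plaques])
    moreover have "y \<in> ?K" using yin by (simp add: connected_component_refl)
    ultimately have "phi z $ 2 = phi y $ 2"
      using connected_uncountable[OF con imageI[OF z] imageI[of y]] by metis
    then show "z \<in> {z \<in> U. phi z $ 2 = phi y $ 2}" using zU by simp
  qed
  let ?P = "{z \<in> U. phi z $ 2 = phi y $ 2}"
  have "?P = psi ` {w \<in> unit_box. w $ 2 = phi y $ 2}"
  proof (rule set_eqI, rule iffI)
    fix z assume z: "z \<in> ?P"
    then have "z = psi (phi z)" "phi z \<in> {w \<in> unit_box. w $ 2 = phi y $ 2}"
      using psi_phi phi_in by auto
    then show "z \<in> psi ` {w \<in> unit_box. w $ 2 = phi y $ 2}" by (rule image_eqI)
  next
    fix z assume "z \<in> psi ` {w \<in> unit_box. w $ 2 = phi y $ 2}"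
    then obtain w where "w \<in> unit_box" "w $ 2 = phi y $ 2" "z = psi w" by blast
    then show "z \<in> ?P" using phi_psi unfolding U_def by auto
  qed
  then have "connected ?P"
    by (simp only:) (intro connected_continuous_image continuous_on_subset[OF psi_cont] connected_unit_box_slice, blast)
  then show "?P \<subseteq> ?K"
    using plaque_in_stable_set[OF y] y by (intro connected_component_maximal) blast+
qed

text \<open>The same chart serves both conclusions of the theorem; the regularity class P is left
  open for this reason.\<close>

lemma foliation_chart_exists:
  assumes "P U phi Dphi" "P unit_box psi Dpsi"
  shows "foliation_chart P (stable_set F) p"
  unfolding foliation_chart_def
  by (rule exI[of _ U], rule exI[of _ phi], rule exI[of _ psi], rule exI[of _ Dphi], rule exI[of _ Dpsi])
     (intro conjI ballI assms U_open p_in_U phi_image psi_phi phi_psi plaques; assumption)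

end

section \<open>From the hypotheses on the lifts to the cone system and its charts\<close>

theorem theorem1:
  fixes Fs Gs :: "nat \<Rightarrow> real^2 \<Rightarrow> real^2"
  assumes "\<forall>n. torus_homeo_lift (Fs n) (Gs n)"
    and "\<exists>C. \<forall>n. C2_bounded (Fs n) C \<and> C2_bounded (Gs n) C"
    and "common_cone_condition Fs Gs"
  shows "C1_foliation (stable_set Fs) \<and>
    ((\<exists>C. \<forall>n. C3_bounded (Fs n) C \<and> C3_bounded (Gs n) C) \<longrightarrow>
       C1_holder_foliation (stable_set Fs))"
proof -
  obtain C where C: "\<And>n. C2_bounded (Fs n) C" "\<And>n. C2_bounded (Gs n) C" using assms(2) by blast
  \<comment> \<open>The derivatives sit behind an existential for each n; choice turns them into
    families indexed by n, as the locale expects.\<close>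
  have "\<exists>D1 D2. \<forall>n. (\<forall>x. (Fs n has_derivative blinfun_apply (D1 n x)) (at x)) \<and>
     (\<forall>x. (D1 n has_derivative blinfun_apply (D2 n x)) (at x)) \<and>
     continuous_on UNIV (D2 n) \<and> (\<forall>x. norm (D1 n x) \<le> C \<and> norm (D2 n x) \<le> C)"
    using C(1) unfolding C2_bounded_def by metis
  then obtain DF D2F where DF: "\<And>n x. (Fs n has_derivative blinfun_apply (DF n x)) (at x)"
    "\<And>n x. (DF n has_derivative blinfun_apply (D2F n x)) (at x)"
    "\<And>n. continuous_on UNIV (D2F n)" "\<And>n x. norm (DF n x) \<le> C" "\<And>n x. norm (D2F n x) \<le> C" by blast
  have "\<exists>D1. \<forall>n x. (Gs n has_derivative blinfun_apply (D1 n x)) (at x) \<and> norm (D1 n x) \<le> C"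
    using C(2) unfolding C2_bounded_def by metis
  then obtain DG where DG: "\<And>n x. (Gs n has_derivative blinfun_apply (DG n x)) (at x)"
    "\<And>n x. norm (DG n x) \<le> C" by blast
  have fr: "frechet_derivative (Fs n) (at x) = blinfun_apply (DF n x)"
    "frechet_derivative (Gs n) (at x) = blinfun_apply (DG n x)" for n x
    using frechet_derivative_at[OF DF(1)] frechet_derivative_at[OF DG(1)] by metis+
  obtain \<mu> \<eta> h v \<theta> where cone: "0 < \<mu> \<and> \<mu> < 1 \<and> 1 < \<eta> \<and> 0 < \<theta> \<and>
     continuous_on UNIV h \<and> continuous_on UNIV v \<and>
     (\<forall>x. norm (h x) = 1 \<and> norm (v x) = 1) \<and>
     (\<forall>x a b. a *\<^sub>R h x + b *\<^sub>R v x = 0 \<longrightarrow> a = 0 \<and> b = 0) \<and>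
     (\<forall>x k. k \<in> Zvec \<longrightarrow> (h (x + k) = h x \<or> h (x + k) = - h x) \<and>
                           (v (x + k) = v x \<or> v (x + k) = - v x)) \<and>
     (\<forall>n x.
        (\<forall>w \<in> cone_u h v \<mu> x - {0}.
            blinfun_apply (DF n x) w \<in> interior (cone_u h v \<mu> (Fs n x)) \<and>
            (\<forall>u \<in> frontier (cone_u h v \<mu> (Fs n x)) - {0}. \<theta> \<le> vec_angle (blinfun_apply (DF n x) w) u)) \<and>
        (\<forall>w \<in> cone_s h v \<mu> x - {0}.
            blinfun_apply (DG n x) w \<in> interior (cone_s h v \<mu> (Gs n x)) \<and>
            (\<forall>u \<in> frontier (cone_s h v \<mu> (Gs n x)) - {0}. \<theta> \<le> vec_angle (blinfun_apply (DG n x) w) u)) \<and>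
        (\<forall>w \<in> cone_u h v \<mu> x. \<eta> * norm w \<le> norm (blinfun_apply (DF n x) w)) \<and>
        (\<forall>w \<in> cone_s h v \<mu> x. \<eta> * norm w \<le> norm (blinfun_apply (DG n x) w)))"
    using assms(3)[unfolded common_cone_condition_def fr] by (elim exE) (rule that)
  have basic: "0 < \<mu>" "\<mu> < 1" "1 < \<eta>" "0 < \<theta>" "continuous_on UNIV h" "continuous_on UNIV v"
    by (insert cone, elim conjE, assumption)+
  have unit: "\<forall>x. norm (h x) = 1 \<and> norm (v x) = 1"
    and indep: "\<forall>x a b. a *\<^sub>R h x + b *\<^sub>R v x = 0 \<longrightarrow> a = 0 \<and> b = 0"
    and per: "\<forall>x k. k \<in> Zvec \<longrightarrow> (h (x + k) = h x \<or> h (x + k) = - h x) \<and> (v (x + k) = v x \<or> v (x + k) = - v x)"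
    by (insert cone, elim conjE, assumption)+
  note dyn = cone[THEN conjunct2, THEN conjunct2, THEN conjunct2, THEN conjunct2, THEN conjunct2, THEN conjunct2,
      THEN conjunct2, THEN conjunct2, THEN conjunct2, THEN spec, THEN spec]
  note dyn1 = dyn[THEN conjunct1] and dyn2 = dyn[THEN conjunct2, THEN conjunct1]
    and dyn3 = dyn[THEN conjunct2, THEN conjunct2, THEN conjunct1]
    and dyn4 = dyn[THEN conjunct2, THEN conjunct2, THEN conjunct2]
  interpret cone_system Fs Gs DF DG D2F C \<mu> \<eta> \<theta> h v
  proof
    fix n x
    show "Gs n (Fs n x) = x" "Fs n (Gs n x) = x"
      using assms(1) by (auto simp: torus_homeo_lift_def)
    show "norm (h x) = 1" "norm (v x) = 1" using unit by auto
    show "h (x + k) = h x \<or> h (x + k) = - h x" "v (x + k) = v x \<or> v (x + k) = - v x" if "k \<in> Zvec" for k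
      using per that by auto
    fix w
    show "blinfun_apply (DF n x) w \<in> interior (cone_u h v \<mu> (Fs n x))"
      if "w \<in> cone_u h v \<mu> x" "w \<noteq> 0" using dyn1[of x n] that by blast
    show "\<theta> \<le> vec_angle (blinfun_apply (DF n x) w) u"
      if "w \<in> cone_u h v \<mu> x" "w \<noteq> 0" "u \<in> frontier (cone_u h v \<mu> (Fs n x))" "u \<noteq> 0" for u
      using dyn1[of x n] that by blast
    show "blinfun_apply (DG n x) w \<in> cone_s h v \<mu> (Gs n x)"
      if "w \<in> cone_s h v \<mu> x" "w \<noteq> 0" using dyn2[of x n] that interior_subset by blast
    show "\<eta> * norm w \<le> norm (blinfun_apply (DF n x) w)" if "w \<in> cone_u h v \<mu> x" using dyn3[of x n] that by blast
    show "\<eta> * norm w \<le> norm (blinfun_apply (DG n x) w)" if "w \<in> cone_s h v \<mu> x" using dyn4[of x n] that by blast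
    show "a = 0 \<and> b = 0" if "a *\<^sub>R h x + b *\<^sub>R v x = 0" for a b using indep that by blast
  qed (fact DF DG basic)+
  have "foliation_chart C1_on (stable_set Fs) p" for p
  proof -
    obtain r B L \<delta> where "cone_chart Fs Gs DF DG D2F C \<mu> \<eta> \<theta> h v p r B L \<delta>" using cone_chart_exists by blast
    then interpret cone_chart Fs Gs DF DG D2F C \<mu> \<eta> \<theta> h v p r B L \<delta> .
    show ?thesis by (rule foliation_chart_exists[OF phi_C1 psi_C1])
  qed
  moreover have "C1_holder_foliation (stable_set Fs)" if C3b: "\<exists>C. \<forall>n. C3_bounded (Fs n) C \<and> C3_bounded (Gs n) C"
  proof -
    obtain C3 where C3: "\<And>n. C3_bounded (Fs n) C3" using C3b by blast
    have D2F_lip: "norm (D2F n x - D2F n y) \<le> C3 * dist x y" for n x y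
    proof -
      obtain D1 D2 D3 where D: "\<And>x. (Fs n has_derivative blinfun_apply (D1 x)) (at x)"
        "\<And>x. (D1 has_derivative blinfun_apply (D2 x)) (at x)"
        "\<And>x. (D2 has_derivative blinfun_apply (D3 x)) (at x)" "\<And>x. norm (D3 x) \<le> C3"
        using C3[of n] unfolding C3_bounded_def by blast
      \<comment> \<open>The derivatives witnessing the C^3 bound come from a separate choice;
        uniqueness of derivatives identifies them with \<open>DF n\<close> and, below,
        \<open>D2F n\<close>.\<close>
      have "D1 = DF n"
        using has_derivative_unique[OF D(1) DF] by (intro ext) (simp add: blinfun_apply_inject)
      then have D2: "(DF n has_derivative blinfun_apply (D2 x)) (at x)" for x using D(2) by simp
      have "D2 = D2F n"
        using has_derivative_unique[OF D2 D2F] by (intro ext) (simp add: blinfun_apply_inject)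
      then have D': "(D2F n has_derivative blinfun_apply (D3 x)) (at x)" for x using D(3) by simp
      show ?thesis
        unfolding dist_norm
        by (rule differentiable_bound[OF convex_UNIV D'])
           (simp_all only: norm_blinfun.rep_eq[symmetric] D(4) UNIV_I)
    qed
    \<comment> \<open>Obtained before any point p is fixed, so that one exponent works for every
      chart.\<close>
    obtain \<alpha> K where aK: "0 < \<alpha>" "\<alpha> \<le> 1" "0 \<le> K" "\<And>w \<xi> x y. norm w = 1 \<Longrightarrow> norm \<xi> = 1 \<Longrightarrow> w \<in> cu x \<Longrightarrow> w \<in> cu y \<Longrightarrow>
      dist x y \<le> 1 \<Longrightarrow> \<bar>sigl w \<xi> x - sigl w \<xi> y\<bar> \<le> K * dist x y powr \<alpha> \<and>
        \<bar>dsigl w \<xi> x - dsigl w \<xi> y\<bar> \<le> K * dist x y powr \<alpha>"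
      using sigl_holder[OF D2F_lip] by blast
    have "foliation_chart (\<lambda>S f Df. C1_on S f Df \<and> holder_on \<alpha> S Df) (stable_set Fs) p" for p
    proof -
      obtain r B L \<delta> where "cone_chart Fs Gs DF DG D2F C \<mu> \<eta> \<theta> h v p r B L \<delta>" using cone_chart_exists by blast
      then interpret cone_chart Fs Gs DF DG D2F C \<mu> \<eta> \<theta> h v p r B L \<delta> .
      note H = charts_holder[OF aK(1-3) aK(4)[OF norm_h norm_v]]
      show ?thesis by (rule foliation_chart_exists) (intro conjI phi_C1 psi_C1 H; assumption)+
    qed
    then show ?thesis unfolding C1_holder_foliation_def using aK(1,2) by blast
  qed
  ultimately show ?thesis unfolding C1_foliation_def by blast
qed

end
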